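(* The system $\mathsf{E\text{-}PA}^{\omega}_{\mathrm{st}}+\mathsf I+\mathsf{HAC}_{\mathrm{int}}+\mathsf{PF\text{-}TP}_\forall$ is conservative over $\mathsf{E\text{-}PA}^{\omega}$. In fact, for every internal formula $\varphi(\underline x,\underline y,\underline a)$, if $$\mathsf{E\text{-}PA}^{\omega}_{\mathrm{st}}+\mathsf I+\mathsf{HAC}_{\mathrm{int}}+\mathsf{PF\text{-}TP}_\forall\vdash\forall^{\mathrm{st}}\underline x\,\exists\underline y\,\varphi(\underline x,\underline y,\underline a),$$ then $\mathsf{E\text{-}PA}^{\omega}\vdash\forall\underline x\,\exists\underline y\,\varphi(\underline x,\underline y,\underline a)$.
   Context: $\mathsf{E\text{-}PA}^{\omega}$ is classical extensional Peano arithmetic in all finite types (types generated from $0$ by $\to$, no product types). The language of $\mathsf{E\text{-}PA}^{\omega}_{\mathrm{st}}$ adds unary predicates $\mathrm{st}^\sigma$ and quantifiers $\forall^{\mathrm{st}}x^\sigma,\exists^{\mathrm{st}}x^\sigma$ for every finite type $\sigma$. Formulas without these new symbols are called internal; small Greek letters denote internal formulas, capital Greek letters arbitrary (possibly external) formulas. Conservativity means: every formula of the language of $\mathsf{E\text{-}PA}^\omega$ (i.e. every internal formula) provable in the larger system is provable in $\mathsf{E\text{-}PA}^\omega$. $\mathsf{E\text{-}PA}^{\omega}_{\mathrm{st}}$ is $\mathsf{E\text{-}PA}^{\omega}$ (with induction for internal formulas) plus: (EQ) $\forall^{\mathrm{st}}x\,\Phi(x)\leftrightarrow\forall x(\mathrm{st}(x)\to\Phi(x))$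 and $\exists^{\mathrm{st}}x\,\Phi(x)\leftrightarrow\exists x(\mathrm{st}(x)\wedge\Phi(x))$; ($\mathcal T_{\mathrm{st}}$) $\mathrm{st}(x)\wedge x=y\to\mathrm{st}(y)$; $\mathrm{st}(t)$ for each closed term $t$; $\mathrm{st}(f)\wedge\mathrm{st}(x)\to\mathrm{st}(fx)$; $\mathrm{st}^0(x)\wedge y\le x\to\mathrm{st}^0(y)$; ($\mathsf{IA}^{\mathrm{st}}$) $(\Phi(0)\wedge\forall^{\mathrm{st}}x^0(\Phi(x)\to\Phi(x+1)))\to\forall^{\mathrm{st}}x^0\Phi(x)$ for arbitrary external $\Phi$ (parameters allowed). Finite sequences of objects of type $\sigma$ are coded as single objects of type $\sigma$, such that every object codes a finite sequence; $x\in y$ means $x$ equals one of the components of the sequence coded by $y$; $\cup$ is concatenation; for $Y$ of type $\sigma\to\tau$ and $x$ of type $\sigma$, $Y[x]:=\bigcup_{f\in Y}f(x)$. Underlined letters denote tuples. Further axioms ($\varphi$ internal): ($\mathsf I$) $\forall^{\mathrm{st}}y'\,\exists x\,\forall y\in y'\,\varphi(x,y)\to\exists x\,\forall^{\mathrm{st}}y\,\varphi(x,y)$; ($\mathsf{HAC}_{\mathrm{int}}$) $\forall^{\mathrm{st}}x^\sigma\,\exists^{\mathrm{st}}y^\tau\,\varphi(x,y)\to\exists^{\mathrm{st}}Y^{\sigma\to\tau}\,\forall^{\mathrm{st}}x^\sigma\,\exists y^\tau\in Y[x]\ \varphi(x,y)$ (in both of these, further parameters are allowed in $\varphi$); ($\mathsf{PF\text{-}TP}_\forall$)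 $\forall^{\mathrm{st}}\underline x\,\varphi(\underline x)\to\forall\underline x\,\varphi(\underline x)$, where internal $\varphi(\underline x)$ has no free variables besides $\underline x$. *)

theory Defs
  imports Main
begin

datatype ty = Nat | Fn ty ty (infixr "\<rightarrow>\<^sub>t" 65)

text \<open>A variable is a name together with its type, so terms and formulas need no typing context.\<close>

type_synonym var = "nat \<times> ty"

datatype tm =
    Var var
  | Zero
  | Succ
  | Kc ty ty
  | Sc ty ty ty
  | Rc ty
  | App tm tm (infixl "\<cdot>" 75)

text \<open>On ill-typed terms \<open>tyof\<close> is junk; \<open>wt\<close> singles out the terms of the language.\<close>

fun tyof :: "tm \<Rightarrow> ty" where
  "tyof (Var x) = snd x"
| "tyof Zero = Nat"
| "tyof Succ = Nat \<rightarrow>\<^sub>t Nat"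
| "tyof (Kc \<rho> \<sigma>) = \<rho> \<rightarrow>\<^sub>t \<sigma> \<rightarrow>\<^sub>t \<rho>"
| "tyof (Sc \<rho> \<sigma> \<tau>) = (\<rho> \<rightarrow>\<^sub>t \<sigma> \<rightarrow>\<^sub>t \<tau>) \<rightarrow>\<^sub>t (\<rho> \<rightarrow>\<^sub>t \<sigma>) \<rightarrow>\<^sub>t \<rho> \<rightarrow>\<^sub>t \<tau>"
| "tyof (Rc \<sigma>) = \<sigma> \<rightarrow>\<^sub>t (\<sigma> \<rightarrow>\<^sub>t Nat \<rightarrow>\<^sub>t \<sigma>) \<rightarrow>\<^sub>t Nat \<rightarrow>\<^sub>t \<sigma>"
| "tyof (s \<cdot> t) = (case tyof s of \<sigma> \<rightarrow>\<^sub>t \<tau> \<Rightarrow> \<tau> | Nat \<Rightarrow> Nat)"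

fun wt :: "tm \<Rightarrow> bool" where
  "wt (s \<cdot> t) \<longleftrightarrow> wt s \<and> wt t \<and> (\<exists>\<tau>. tyof s = tyof t \<rightarrow>\<^sub>t \<tau>)"
| "wt _ \<longleftrightarrow> True"

fun fvt :: "tm \<Rightarrow> var set" where
  "fvt (Var x) = {x}"
| "fvt (s \<cdot> t) = fvt s \<union> fvt t"
| "fvt _ = {}"

fun substt :: "var \<Rightarrow> tm \<Rightarrow> tm \<Rightarrow> tm" where
  "substt x r (Var y) = (if x = y then r else Var y)"
| "substt x r (s \<cdot> t) = substt x r s \<cdot> substt x r t"
| "substt x r c = c"

datatype fm =
    Eq tm tm (infix "\<^bold>=" 60)
  | Bot
  | And fm fm (infixr "\<^bold>\<and>" 58)
  | Or fm fm (infixr "\<^bold>\<or>" 56)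
  | Imp fm fm (infixr "\<^bold>\<longrightarrow>" 54)
  | Forall var fm
  | Exists var fm
  | St tm
  | ForallSt var fm
  | ExistsSt var fm

abbreviation Neg :: "fm \<Rightarrow> fm" where
  "Neg \<phi> \<equiv> \<phi> \<^bold>\<longrightarrow> Bot"

abbreviation Iff :: "fm \<Rightarrow> fm \<Rightarrow> fm" where
  "Iff \<phi> \<psi> \<equiv> (\<phi> \<^bold>\<longrightarrow> \<psi>) \<^bold>\<and> (\<psi> \<^bold>\<longrightarrow> \<phi>)"

fun wff :: "fm \<Rightarrow> bool" where
  "wff (s \<^bold>= t) \<longleftrightarrow> wt s \<and> wt t \<and> tyof s = tyof t"
| "wff Bot \<longleftrightarrow> True"
| "wff (\<phi> \<^bold>\<and> \<psi>) \<longleftrightarrow> wff \<phi> \<and> wff \<psi>"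
| "wff (\<phi> \<^bold>\<or> \<psi>) \<longleftrightarrow> wff \<phi> \<and> wff \<psi>"
| "wff (\<phi> \<^bold>\<longrightarrow> \<psi>) \<longleftrightarrow> wff \<phi> \<and> wff \<psi>"
| "wff (Forall x \<phi>) \<longleftrightarrow> wff \<phi>"
| "wff (Exists x \<phi>) \<longleftrightarrow> wff \<phi>"
| "wff (St t) \<longleftrightarrow> wt t"
| "wff (ForallSt x \<phi>) \<longleftrightarrow> wff \<phi>"
| "wff (ExistsSt x \<phi>) \<longleftrightarrow> wff \<phi>"

fun internal :: "fm \<Rightarrow> bool" where
  "internal (s \<^bold>= t) \<longleftrightarrow> True"
| "internal Bot \<longleftrightarrow> True"
| "internal (\<phi> \<^bold>\<and> \<psi>) \<longleftrightarrow> internal \<phi> \<and> internal \<psi>"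
| "internal (\<phi> \<^bold>\<or> \<psi>) \<longleftrightarrow> internal \<phi> \<and> internal \<psi>"
| "internal (\<phi> \<^bold>\<longrightarrow> \<psi>) \<longleftrightarrow> internal \<phi> \<and> internal \<psi>"
| "internal (Forall x \<phi>) \<longleftrightarrow> internal \<phi>"
| "internal (Exists x \<phi>) \<longleftrightarrow> internal \<phi>"
| "internal (St t) \<longleftrightarrow> False"
| "internal (ForallSt x \<phi>) \<longleftrightarrow> False"
| "internal (ExistsSt x \<phi>) \<longleftrightarrow> False"

fun fv :: "fm \<Rightarrow> var set" where
  "fv (s \<^bold>= t) = fvt s \<union> fvt t"
| "fv Bot = {}"
| "fv (\<phi> \<^bold>\<and> \<psi>) = fv \<phi> \<union> fv \<psi>"
| "fv (\<phi> \<^bold>\<or> \<psi>) = fv \<phi> \<union> fv \<psi>"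
| "fv (\<phi> \<^bold>\<longrightarrow> \<psi>) = fv \<phi> \<union> fv \<psi>"
| "fv (Forall x \<phi>) = fv \<phi> - {x}"
| "fv (Exists x \<phi>) = fv \<phi> - {x}"
| "fv (St t) = fvt t"
| "fv (ForallSt x \<phi>) = fv \<phi> - {x}"
| "fv (ExistsSt x \<phi>) = fv \<phi> - {x}"

text \<open>Substitution does not rename bound variables; it is only used where \<open>free_for\<close> holds.\<close>

fun subst :: "var \<Rightarrow> tm \<Rightarrow> fm \<Rightarrow> fm" where
  "subst x r (s \<^bold>= t) = (substt x r s \<^bold>= substt x r t)"
| "subst x r Bot = Bot"
| "subst x r (\<phi> \<^bold>\<and> \<psi>) = (subst x r \<phi> \<^bold>\<and> subst x r \<psi>)"
| "subst x r (\<phi> \<^bold>\<or> \<psi>) = (subst x r \<phi> \<^bold>\<or> subst x r \<psi>)"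
| "subst x r (\<phi> \<^bold>\<longrightarrow> \<psi>) = (subst x r \<phi> \<^bold>\<longrightarrow> subst x r \<psi>)"
| "subst x r (Forall y \<phi>) = Forall y (if x = y then \<phi> else subst x r \<phi>)"
| "subst x r (Exists y \<phi>) = Exists y (if x = y then \<phi> else subst x r \<phi>)"
| "subst x r (St t) = St (substt x r t)"
| "subst x r (ForallSt y \<phi>) = ForallSt y (if x = y then \<phi> else subst x r \<phi>)"
| "subst x r (ExistsSt y \<phi>) = ExistsSt y (if x = y then \<phi> else subst x r \<phi>)"

fun free_for :: "var \<Rightarrow> tm \<Rightarrow> fm \<Rightarrow> bool" where
  "free_for x r (s \<^bold>= t) \<longleftrightarrow> True"
| "free_for x r Bot \<longleftrightarrow> True"
| "free_for x r (\<phi> \<^bold>\<and> \<psi>) \<longleftrightarrow> free_for x r \<phi> \<and> free_for x r \<psi>"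
| "free_for x r (\<phi> \<^bold>\<or> \<psi>) \<longleftrightarrow> free_for x r \<phi> \<and> free_for x r \<psi>"
| "free_for x r (\<phi> \<^bold>\<longrightarrow> \<psi>) \<longleftrightarrow> free_for x r \<phi> \<and> free_for x r \<psi>"
| "free_for x r (Forall y \<phi>) \<longleftrightarrow> x \<notin> fv \<phi> - {y} \<or> (y \<notin> fvt r \<and> free_for x r \<phi>)"
| "free_for x r (Exists y \<phi>) \<longleftrightarrow> x \<notin> fv \<phi> - {y} \<or> (y \<notin> fvt r \<and> free_for x r \<phi>)"
| "free_for x r (St t) \<longleftrightarrow> True"
| "free_for x r (ForallSt y \<phi>) \<longleftrightarrow> x \<notin> fv \<phi> - {y} \<or> (y \<notin> fvt r \<and> free_for x r \<phi>)"
| "free_for x r (ExistsSt y \<phi>) \<longleftrightarrow> x \<notin> fv \<phi> - {y} \<or> (y \<notin> fvt r \<and> free_for x r \<phi>)"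

abbreviation Foralls :: "var list \<Rightarrow> fm \<Rightarrow> fm" where
  "Foralls xs \<phi> \<equiv> foldr Forall xs \<phi>"

abbreviation Existss :: "var list \<Rightarrow> fm \<Rightarrow> fm" where
  "Existss xs \<phi> \<equiv> foldr Exists xs \<phi>"

abbreviation ForallSts :: "var list \<Rightarrow> fm \<Rightarrow> fm" where
  "ForallSts xs \<phi> \<equiv> foldr ForallSt xs \<phi>"

text \<open>Many-sorted classical predicate logic. \<open>L\<close> is the set of formulas of the language and \<open>Ax\<close>
  the set of nonlogical axioms; every formula occurring in a derivation belongs to \<open>L\<close>.
  \<open>ForallSt\<close> and \<open>ExistsSt\<close> have no logical rules, they are governed by the axioms \<open>EQ_ax\<close> below.\<close>

inductive_set logic_ax :: "fm set" where
  "\<phi> \<^bold>\<longrightarrow> \<psi> \<^bold>\<longrightarrow> \<phi> \<in> logic_ax"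
| "(\<phi> \<^bold>\<longrightarrow> \<psi> \<^bold>\<longrightarrow> \<chi>) \<^bold>\<longrightarrow> (\<phi> \<^bold>\<longrightarrow> \<psi>) \<^bold>\<longrightarrow> \<phi> \<^bold>\<longrightarrow> \<chi> \<in> logic_ax"
| "\<phi> \<^bold>\<and> \<psi> \<^bold>\<longrightarrow> \<phi> \<in> logic_ax"
| "\<phi> \<^bold>\<and> \<psi> \<^bold>\<longrightarrow> \<psi> \<in> logic_ax"
| "\<phi> \<^bold>\<longrightarrow> \<psi> \<^bold>\<longrightarrow> \<phi> \<^bold>\<and> \<psi> \<in> logic_ax"
| "\<phi> \<^bold>\<longrightarrow> \<phi> \<^bold>\<or> \<psi> \<in> logic_ax"
| "\<psi> \<^bold>\<longrightarrow> \<phi> \<^bold>\<or> \<psi> \<in> logic_ax"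
| "(\<phi> \<^bold>\<longrightarrow> \<chi>) \<^bold>\<longrightarrow> (\<psi> \<^bold>\<longrightarrow> \<chi>) \<^bold>\<longrightarrow> \<phi> \<^bold>\<or> \<psi> \<^bold>\<longrightarrow> \<chi> \<in> logic_ax"
| "Bot \<^bold>\<longrightarrow> \<phi> \<in> logic_ax"
| "Neg (Neg \<phi>) \<^bold>\<longrightarrow> \<phi> \<in> logic_ax"
| "wt t \<Longrightarrow> tyof t = snd x \<Longrightarrow> free_for x t \<phi> \<Longrightarrow> Forall x \<phi> \<^bold>\<longrightarrow> subst x t \<phi> \<in> logic_ax"
| "wt t \<Longrightarrow> tyof t = snd x \<Longrightarrow> free_for x t \<phi> \<Longrightarrow> subst x t \<phi> \<^bold>\<longrightarrow> Exists x \<phi> \<in> logic_ax"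

inductive provable :: "fm set \<Rightarrow> fm set \<Rightarrow> fm \<Rightarrow> bool" for L :: "fm set" and Ax :: "fm set" where
  logic: "\<phi> \<in> logic_ax \<Longrightarrow> \<phi> \<in> L \<Longrightarrow> provable L Ax \<phi>"
| axiom: "\<phi> \<in> Ax \<Longrightarrow> \<phi> \<in> L \<Longrightarrow> provable L Ax \<phi>"
| mp: "provable L Ax (\<phi> \<^bold>\<longrightarrow> \<psi>) \<Longrightarrow> provable L Ax \<phi> \<Longrightarrow> provable L Ax \<psi>"
| gen_Forall: "provable L Ax (\<phi> \<^bold>\<longrightarrow> \<psi>) \<Longrightarrow> x \<notin> fv \<phi> \<Longrightarrow> provable L Ax (\<phi> \<^bold>\<longrightarrow> Forall x \<psi>)"
| gen_Exists: "provable L Ax (\<psi> \<^bold>\<longrightarrow> \<phi>) \<Longrightarrow> x \<notin> fv \<phi> \<Longrightarrow> provable L Ax (Exists x \<psi> \<^bold>\<longrightarrow> \<phi>)"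

text \<open>Axioms of \<open>E-PA\<^sup>\<omega>\<close>, with equality primitive at every type. Ill-typed instances are harmless,
  since \<open>provable\<close> only uses axioms that belong to the language.\<close>

inductive_set EPA_ax :: "fm set" where
  Eq_refl: "t \<^bold>= t \<in> EPA_ax"
| Eq_euclid: "r \<^bold>= s \<^bold>\<longrightarrow> r \<^bold>= t \<^bold>\<longrightarrow> s \<^bold>= t \<in> EPA_ax"
| Eq_App: "f \<^bold>= g \<^bold>\<longrightarrow> s \<^bold>= t \<^bold>\<longrightarrow> f \<cdot> s \<^bold>= g \<cdot> t \<in> EPA_ax"
| Ext: "x \<notin> fvt f \<union> fvt g \<Longrightarrow> Forall x (f \<cdot> Var x \<^bold>= g \<cdot> Var x) \<^bold>\<longrightarrow> f \<^bold>= g \<in> EPA_ax"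
| Kc_eq: "Kc \<rho> \<sigma> \<cdot> r \<cdot> s \<^bold>= r \<in> EPA_ax"
| Sc_eq: "Sc \<rho> \<sigma> \<tau> \<cdot> r \<cdot> s \<cdot> t \<^bold>= r \<cdot> t \<cdot> (s \<cdot> t) \<in> EPA_ax"
| Rc_Zero: "Rc \<sigma> \<cdot> r \<cdot> s \<cdot> Zero \<^bold>= r \<in> EPA_ax"
| Rc_Succ: "Rc \<sigma> \<cdot> r \<cdot> s \<cdot> (Succ \<cdot> t) \<^bold>= s \<cdot> (Rc \<sigma> \<cdot> r \<cdot> s \<cdot> t) \<cdot> t \<in> EPA_ax"
| Succ_not_Zero: "Neg (Succ \<cdot> t \<^bold>= Zero) \<in> EPA_ax"
| Succ_inj: "Succ \<cdot> s \<^bold>= Succ \<cdot> t \<^bold>\<longrightarrow> s \<^bold>= t \<in> EPA_ax"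
| Ind: "snd x = Nat \<Longrightarrow> internal \<phi> \<Longrightarrow>
    subst x Zero \<phi> \<^bold>\<and> Forall x (\<phi> \<^bold>\<longrightarrow> subst x (Succ \<cdot> Var x) \<phi>) \<^bold>\<longrightarrow> Forall x \<phi> \<in> EPA_ax"

abbreviation EPA_lang :: "fm set" where
  "EPA_lang \<equiv> {\<phi>. wff \<phi> \<and> internal \<phi>}"

abbreviation EPA_st_lang :: "fm set" where
  "EPA_st_lang \<equiv> {\<phi>. wff \<phi>}"

abbreviation EPA_proves :: "fm \<Rightarrow> bool" where
  "EPA_proves \<equiv> provable EPA_lang EPA_ax"

text \<open>Bracket abstraction: \<open>lam x t\<close> is the combinatory term for \<open>\<lambda>x. t\<close>.\<close>

fun lam :: "var \<Rightarrow> tm \<Rightarrow> tm" where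
  "lam x (Var y) =
     (if x = y
      then Sc (snd x) (snd x \<rightarrow>\<^sub>t snd x) (snd x) \<cdot> Kc (snd x) (snd x \<rightarrow>\<^sub>t snd x) \<cdot> Kc (snd x) (snd x)
      else Kc (snd y) (snd x) \<cdot> Var y)"
| "lam x (s \<cdot> t) = Sc (snd x) (tyof t) (tyof (s \<cdot> t)) \<cdot> lam x s \<cdot> lam x t"
| "lam x c = Kc (tyof c) (snd x) \<cdot> c"

text \<open>Below, \<open>\<^bold>\<lambda>n:\<sigma>. t\<close> binds the variable with name \<open>n\<close> and type \<open>\<sigma>\<close>, and \<open>v n \<sigma>\<close> is that variable.\<close>

abbreviation v :: "nat \<Rightarrow> ty \<Rightarrow> tm" where
  "v n \<sigma> \<equiv> Var (n, \<sigma>)"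

abbreviation lam_ty :: "nat \<Rightarrow> ty \<Rightarrow> tm \<Rightarrow> tm" ("(3\<^bold>\<lambda>_:_./ _)" [1000, 65, 10] 10) where
  "\<^bold>\<lambda>n:\<sigma>. t \<equiv> lam (n, \<sigma>) t"

definition pred_c :: tm where
  "pred_c = Rc Nat \<cdot> Zero \<cdot> (\<^bold>\<lambda>0:Nat. \<^bold>\<lambda>1:Nat. v 1 Nat)"

definition add_c :: tm where
  "add_c = (\<^bold>\<lambda>0:Nat. Rc Nat \<cdot> v 0 Nat \<cdot> (\<^bold>\<lambda>1:Nat. \<^bold>\<lambda>2:Nat. Succ \<cdot> v 1 Nat))"

text \<open>Truncated subtraction.\<close>

definition monus_c :: tm where
  "monus_c = (\<^bold>\<lambda>0:Nat. Rc Nat \<cdot> v 0 Nat \<cdot> (\<^bold>\<lambda>1:Nat. \<^bold>\<lambda>2:Nat. pred_c \<cdot> v 1 Nat))"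

text \<open>\<open>cond_c \<sigma> \<cdot> n \<cdot> a \<cdot> b\<close> is \<open>a\<close> if \<open>n = 0\<close>, and \<open>b\<close> otherwise.\<close>

definition cond_c :: "ty \<Rightarrow> tm" where
  "cond_c \<sigma> = (\<^bold>\<lambda>0:Nat. \<^bold>\<lambda>1:\<sigma>. \<^bold>\<lambda>2:\<sigma>.
     Rc \<sigma> \<cdot> v 1 \<sigma> \<cdot> (\<^bold>\<lambda>3:\<sigma>. \<^bold>\<lambda>4:Nat. v 2 \<sigma>) \<cdot> v 0 Nat)"

definition le :: "tm \<Rightarrow> tm \<Rightarrow> fm" where
  "le s t = (monus_c \<cdot> s \<cdot> t \<^bold>= Zero)"

text \<open>Cantor pairing \<open>(a, b) \<mapsto> (0 + 1 + \<dots> + (a + b)) + b\<close>. Its inverse \<open>unpair_c\<close> enumerates the pairs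
  \<open>(0,0), (1,0), (0,1), (2,0), \<dots>\<close>; a pair \<open>(a, b)\<close> is represented there by a function \<open>e\<close>
  with \<open>e 0 = a\<close> and \<open>e 1 = b\<close>.\<close>

definition tri_c :: tm where
  "tri_c = Rc Nat \<cdot> Zero \<cdot> (\<^bold>\<lambda>0:Nat. \<^bold>\<lambda>1:Nat. Succ \<cdot> (add_c \<cdot> v 0 Nat \<cdot> v 1 Nat))"

definition pair_c :: tm where
  "pair_c = (\<^bold>\<lambda>0:Nat. \<^bold>\<lambda>1:Nat.
     add_c \<cdot> (tri_c \<cdot> (add_c \<cdot> v 0 Nat \<cdot> v 1 Nat)) \<cdot> v 1 Nat)"

definition unpair_step_c :: tm where
  "unpair_step_c = (\<^bold>\<lambda>0:Nat \<rightarrow>\<^sub>t Nat. \<^bold>\<lambda>1:Nat.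
     (let a = v 0 (Nat \<rightarrow>\<^sub>t Nat) \<cdot> Zero; b = v 0 (Nat \<rightarrow>\<^sub>t Nat) \<cdot> (Succ \<cdot> Zero) in
      cond_c Nat \<cdot> v 1 Nat
        \<cdot> (cond_c Nat \<cdot> a \<cdot> (Succ \<cdot> b) \<cdot> (pred_c \<cdot> a))
        \<cdot> (cond_c Nat \<cdot> a \<cdot> Zero \<cdot> (Succ \<cdot> b))))"

definition unpair_c :: tm where
  "unpair_c = Rc (Nat \<rightarrow>\<^sub>t Nat) \<cdot> (\<^bold>\<lambda>0:Nat. Zero) \<cdot>
     (\<^bold>\<lambda>0:Nat \<rightarrow>\<^sub>t Nat. \<^bold>\<lambda>1:Nat. unpair_step_c \<cdot> v 0 (Nat \<rightarrow>\<^sub>t Nat))"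

definition fst_c :: tm where
  "fst_c = (\<^bold>\<lambda>0:Nat. unpair_c \<cdot> v 0 Nat \<cdot> Zero)"

definition snd_c :: tm where
  "snd_c = (\<^bold>\<lambda>0:Nat. unpair_c \<cdot> v 0 Nat \<cdot> (Succ \<cdot> Zero))"

text \<open>Coding of finite sequences of objects of type \<open>\<sigma>\<close> by objects of type \<open>\<sigma>\<close>. At type \<open>Nat\<close>, the
  number \<open>pair n (pair a\<^sub>0 (pair a\<^sub>1 \<dots>))\<close> codes the sequence of length \<open>n\<close> with components \<open>a\<^sub>i\<close>, \<open>i < n\<close>.
  At type \<open>\<sigma> \<rightarrow>\<^sub>t \<tau>\<close>, the components are taken pointwise and the length is read off at the
  argument zero. So every object codes exactly one sequence (sequences have several codes).
  \<open>seq_c \<sigma> \<cdot> n \<cdot> h\<close> codes the sequence \<open>h 0, \<dots>, h (n - 1)\<close>.\<close>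

fun zero_c :: "ty \<Rightarrow> tm" where
  "zero_c Nat = Zero"
| "zero_c (\<sigma> \<rightarrow>\<^sub>t \<tau>) = Kc \<tau> \<sigma> \<cdot> zero_c \<tau>"

fun len_c :: "ty \<Rightarrow> tm" where
  "len_c Nat = fst_c"
| "len_c (\<sigma> \<rightarrow>\<^sub>t \<tau>) = (\<^bold>\<lambda>0:\<sigma> \<rightarrow>\<^sub>t \<tau>. len_c \<tau> \<cdot> (v 0 (\<sigma> \<rightarrow>\<^sub>t \<tau>) \<cdot> zero_c \<sigma>))"

fun proj_c :: "ty \<Rightarrow> tm" where
  "proj_c Nat = (\<^bold>\<lambda>0:Nat. \<^bold>\<lambda>1:Nat.
     fst_c \<cdot> (Rc Nat \<cdot> (snd_c \<cdot> v 0 Nat) \<cdot> (\<^bold>\<lambda>2:Nat. \<^bold>\<lambda>3:Nat. snd_c \<cdot> v 2 Nat) \<cdot> v 1 Nat))"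
| "proj_c (\<sigma> \<rightarrow>\<^sub>t \<tau>) = (\<^bold>\<lambda>0:\<sigma> \<rightarrow>\<^sub>t \<tau>. \<^bold>\<lambda>1:Nat. \<^bold>\<lambda>2:\<sigma>.
     proj_c \<tau> \<cdot> (v 0 (\<sigma> \<rightarrow>\<^sub>t \<tau>) \<cdot> v 2 \<sigma>) \<cdot> v 1 Nat)"

definition tail_c :: tm where
  "tail_c = Rc ((Nat \<rightarrow>\<^sub>t Nat) \<rightarrow>\<^sub>t Nat) \<cdot> (\<^bold>\<lambda>0:Nat \<rightarrow>\<^sub>t Nat. Zero) \<cdot>
     (\<^bold>\<lambda>0:(Nat \<rightarrow>\<^sub>t Nat) \<rightarrow>\<^sub>t Nat. \<^bold>\<lambda>1:Nat. \<^bold>\<lambda>2:Nat \<rightarrow>\<^sub>t Nat.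
        pair_c \<cdot> (v 2 (Nat \<rightarrow>\<^sub>t Nat) \<cdot> Zero) \<cdot>
          (v 0 ((Nat \<rightarrow>\<^sub>t Nat) \<rightarrow>\<^sub>t Nat) \<cdot> (\<^bold>\<lambda>3:Nat. v 2 (Nat \<rightarrow>\<^sub>t Nat) \<cdot> (Succ \<cdot> v 3 Nat))))"

fun seq_c :: "ty \<Rightarrow> tm" where
  "seq_c Nat = (\<^bold>\<lambda>0:Nat. \<^bold>\<lambda>1:Nat \<rightarrow>\<^sub>t Nat.
     pair_c \<cdot> v 0 Nat \<cdot> (tail_c \<cdot> v 0 Nat \<cdot> v 1 (Nat \<rightarrow>\<^sub>t Nat)))"
| "seq_c (\<sigma> \<rightarrow>\<^sub>t \<tau>) = (\<^bold>\<lambda>0:Nat. \<^bold>\<lambda>1:Nat \<rightarrow>\<^sub>t \<sigma> \<rightarrow>\<^sub>t \<tau>. \<^bold>\<lambda>2:\<sigma>.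
     seq_c \<tau> \<cdot> v 0 Nat \<cdot> (\<^bold>\<lambda>3:Nat. v 1 (Nat \<rightarrow>\<^sub>t \<sigma> \<rightarrow>\<^sub>t \<tau>) \<cdot> v 3 Nat \<cdot> v 2 \<sigma>))"

definition empty_c :: "ty \<Rightarrow> tm" where
  "empty_c \<sigma> = seq_c \<sigma> \<cdot> Zero \<cdot> (\<^bold>\<lambda>0:Nat. zero_c \<sigma>)"

text \<open>Concatenation of sequences.\<close>

definition cat_c :: "ty \<Rightarrow> tm" where
  "cat_c \<sigma> = (\<^bold>\<lambda>0:\<sigma>. \<^bold>\<lambda>1:\<sigma>.
     (let m = len_c \<sigma> \<cdot> v 0 \<sigma>; n = len_c \<sigma> \<cdot> v 1 \<sigma>; i = v 2 Nat in
      seq_c \<sigma> \<cdot> (add_c \<cdot> m \<cdot> n) \<cdot>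
        (\<^bold>\<lambda>2:Nat. cond_c \<sigma> \<cdot> (monus_c \<cdot> (Succ \<cdot> i) \<cdot> m)
           \<cdot> (proj_c \<sigma> \<cdot> v 0 \<sigma> \<cdot> i)
           \<cdot> (proj_c \<sigma> \<cdot> v 1 \<sigma> \<cdot> (monus_c \<cdot> i \<cdot> m)))))"

text \<open>\<open>sapp_c \<sigma> \<tau> \<cdot> Y \<cdot> x\<close> is \<open>Y[x]\<close>, the concatenation of \<open>f x\<close> for the components \<open>f\<close> of \<open>Y\<close>.\<close>

definition sapp_c :: "ty \<Rightarrow> ty \<Rightarrow> tm" where
  "sapp_c \<sigma> \<tau> = (\<^bold>\<lambda>0:\<sigma> \<rightarrow>\<^sub>t \<tau>. \<^bold>\<lambda>1:\<sigma>.
     Rc \<tau> \<cdot> empty_c \<tau> \<cdot>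
       (\<^bold>\<lambda>2:\<tau>. \<^bold>\<lambda>3:Nat. cat_c \<tau> \<cdot> v 2 \<tau> \<cdot> (proj_c (\<sigma> \<rightarrow>\<^sub>t \<tau>) \<cdot> v 0 (\<sigma> \<rightarrow>\<^sub>t \<tau>) \<cdot> v 3 Nat \<cdot> v 1 \<sigma>)) \<cdot>
       (len_c (\<sigma> \<rightarrow>\<^sub>t \<tau>) \<cdot> v 0 (\<sigma> \<rightarrow>\<^sub>t \<tau>)))"

definition mem :: "tm \<Rightarrow> tm \<Rightarrow> fm" where
  "mem s t = (let i = ((LEAST n. (n, Nat) \<notin> fvt s \<union> fvt t), Nat) in
     Exists i (le (Succ \<cdot> Var i) (len_c (tyof t) \<cdot> t) \<^bold>\<and> s \<^bold>= proj_c (tyof t) \<cdot> t \<cdot> Var i))"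

inductive_set EQ_ax :: "fm set" where
  "Iff (ForallSt x \<Phi>) (Forall x (St (Var x) \<^bold>\<longrightarrow> \<Phi>)) \<in> EQ_ax"
| "Iff (ExistsSt x \<Phi>) (Exists x (St (Var x) \<^bold>\<and> \<Phi>)) \<in> EQ_ax"

inductive_set T_st_ax :: "fm set" where
  "St s \<^bold>\<and> s \<^bold>= t \<^bold>\<longrightarrow> St t \<in> T_st_ax"
| "fvt t = {} \<Longrightarrow> St t \<in> T_st_ax"
| "St f \<^bold>\<and> St t \<^bold>\<longrightarrow> St (f \<cdot> t) \<in> T_st_ax"
| "St s \<^bold>\<and> le t s \<^bold>\<longrightarrow> St t \<in> T_st_ax"

inductive_set IA_st_ax :: "fm set" where
  "snd x = Nat \<Longrightarrow>
    subst x Zero \<Phi> \<^bold>\<and> ForallSt x (\<Phi> \<^bold>\<longrightarrow> subst x (Succ \<cdot> Var x) \<Phi>) \<^bold>\<longrightarrow> ForallSt x \<Phi> \<in> IA_st_ax"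

inductive_set I_ax :: "fm set" where
  "internal \<phi> \<Longrightarrow> snd y' = snd y \<Longrightarrow> distinct [x, y, y'] \<Longrightarrow> y' \<notin> fv \<phi> \<Longrightarrow>
    ForallSt y' (Exists x (Forall y (mem (Var y) (Var y') \<^bold>\<longrightarrow> \<phi>)))
      \<^bold>\<longrightarrow> Exists x (ForallSt y \<phi>) \<in> I_ax"

inductive_set HAC_int_ax :: "fm set" where
  "internal \<phi> \<Longrightarrow> snd Y = snd x \<rightarrow>\<^sub>t snd y \<Longrightarrow> distinct [x, y, Y] \<Longrightarrow> Y \<notin> fv \<phi> \<Longrightarrow>
    ForallSt x (ExistsSt y \<phi>)
      \<^bold>\<longrightarrow> ExistsSt Y (ForallSt x (Exists y
            (mem (Var y) (sapp_c (snd x) (snd y) \<cdot> Var Y \<cdot> Var x) \<^bold>\<and> \<phi>))) \<in> HAC_int_ax"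

inductive_set PF_TP_ax :: "fm set" where
  "internal \<phi> \<Longrightarrow> distinct xs \<Longrightarrow> fv \<phi> \<subseteq> set xs \<Longrightarrow>
    ForallSts xs \<phi> \<^bold>\<longrightarrow> Foralls xs \<phi> \<in> PF_TP_ax"

definition EPA_st_ax :: "fm set" where
  "EPA_st_ax = EPA_ax \<union> EQ_ax \<union> T_st_ax \<union> IA_st_ax"

abbreviation EPA_st_I_HAC_PFTP_proves :: "fm \<Rightarrow> bool" where
  "EPA_st_I_HAC_PFTP_proves \<equiv>
     provable EPA_st_lang (EPA_st_ax \<union> I_ax \<union> HAC_int_ax \<union> PF_TP_ax)"

end

theory Submission
  imports Defs "HOL-Library.Countable"
begin

text \<open>By completeness it suffices to work in an arbitrary model \<open>M\<close> of \<open>E-PA\<^sup>\<omega>\<close>. There the external formulas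
  are interpreted in the style of Shoenfield's functional interpretation with Herbrand disjunctions:
  a formula \<open>\<Phi>\<close> is read as ``for every challenge \<open>x\<close> there is a finite list of responses, one of which
  works'', and \<open>\<Phi>\<close> is realized by an element \<open>T\<close> of \<open>M\<close> if \<open>T x\<close> is such a list for all challenges \<open>x\<close>
  and all values of the free variables simultaneously. Standardness of \<open>t\<close> is read as ``\<open>t\<close> occurs in a
  given list''. All axioms of the external system are realized. Since realizers may be arbitrary elements
  of \<open>M\<close> instead of closed terms, \<open>PF-TP\<close> is realized by a counterexample taken from \<open>M\<close>, if there is one.
  On internal formulas the interpretation is truth in \<open>M\<close>, and a realized formula
  \<open>\<forall>\<^sup>s\<^sup>t x. \<exists>y. \<phi>\<close> is true for all \<open>x\<close> in \<open>M\<close>, because \<open>x\<close> can be challenged by the list \<open>[x]\<close>.\<close>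

section \<open>Models of extensional Peano arithmetic in all finite types\<close>

text \<open>The language has no product types, but challenges and responses to implications are
  pairs. Products are therefore coded as types by \<open>pr\<close>, with only the two projection
  equations, and response sets are always read through images under projections. \<open>R\<close> is
  monotone in the response set, so alternatives never have to be decided: lists are concatenated,
  and double negation elimination simply lists all candidates. Response sets must be nonempty,
  because an implication tests its premise at all of them; hence the added zero element. A
  quantifier over all of \<open>M\<close> changes neither challenges nor responses. Since realizers
  do not see the values of the variables, one list has to serve all of them at once, and this is
  what yields the finite sequence for idealization. \<open>M\<close> may contain nonstandard numbers
  and has induction for internal formulas only. Facts about arithmetic, lists of arbitrary length in
  \<open>M\<close>, and finally \<open>R\<close> itself must therefore be expressed by formulas.
  Hilbert-style derivations of propositional laws are avoided in both calculi by a common argument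
  with valuations.\<close>

declare lam.simps [simp del]

lemma tyof_lam [simp]: "tyof (lam x t) = snd x \<rightarrow>\<^sub>t tyof t"
  by (induction t) (auto simp: lam.simps)

lemma wt_lam [simp]: "wt t \<Longrightarrow> wt (lam x t)"
  by (induction t) (auto simp: lam.simps)

lemma fvt_lam [simp]: "fvt (lam x t) = fvt t - {x}"
  by (induction t) (auto simp: lam.simps)

lemma finite_fvt [simp]: "finite (fvt t)"
  by (induction t) auto

lemma finite_fv [simp]: "finite (fv \<phi>)"
  by (induction \<phi>) auto

lemma tyof_substt [simp]: "tyof r = snd x \<Longrightarrow> tyof (substt x r t) = tyof t"
  by (induction t) auto

lemma wt_substt [simp]: "wt r \<Longrightarrow> tyof r = snd x \<Longrightarrow> wt t \<Longrightarrow> wt (substt x r t)"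
  by (induction t) auto

lemma substt_fresh [simp]: "x \<notin> fvt t \<Longrightarrow> substt x r t = t"
  by (induction t) auto

lemma wff_subst [simp]: "wt r \<Longrightarrow> tyof r = snd x \<Longrightarrow> wff \<phi> \<Longrightarrow> wff (subst x r \<phi>)"
  by (induction \<phi>) auto

lemma internal_subst [simp]: "internal (subst x r \<phi>) = internal \<phi>"
  by (induction \<phi>) auto

lemma free_for_not_fv: "x \<notin> fv \<phi> \<Longrightarrow> free_for x r \<phi>"
  by (induction \<phi>) auto

lemma subst_fresh: "x \<notin> fv \<phi> \<Longrightarrow> subst x r \<phi> = \<phi>"
  by (induction \<phi>) auto

lemma free_for_closed [simp]: "fvt r \<subseteq> {x} \<Longrightarrow> free_for x r \<phi>"
  by (induction \<phi>) auto

lemma wt_zero_c [simp]: "wt (zero_c \<sigma>)" and tyof_zero_c [simp]: "tyof (zero_c \<sigma>) = \<sigma>"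
  and fvt_zero_c [simp]: "fvt (zero_c \<sigma>) = {}"
  by (induction \<sigma>) auto

text \<open>\<open>res Nat\<close> copies the junk value of \<open>tyof\<close> on ill-typed
  applications, so that \<open>tp (eval e t) = tyof t\<close> holds without a typing hypothesis on
  \<open>t\<close>.\<close>

fun res :: "ty \<Rightarrow> ty" where
  "res (\<sigma> \<rightarrow>\<^sub>t \<tau>) = \<tau>"
| "res Nat = Nat"

fun fits :: "ty \<Rightarrow> ty \<Rightarrow> bool" where
  "fits (\<sigma> \<rightarrow>\<^sub>t \<tau>) \<rho> \<longleftrightarrow> \<sigma> = \<rho>"
| "fits Nat \<rho> \<longleftrightarrow> False"

section \<open>Structures, evaluation of terms and truth of internal formulas\<close>

text \<open>Elements carry their type \<open>tp\<close>, and \<open>ok\<close> singles out the genuine elements, so that typing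
  conditions can be discharged by rewriting.\<close>

locale struc =
  fixes ok :: "'a \<Rightarrow> bool" and tp :: "'a \<Rightarrow> ty"
    and ap :: "'a \<Rightarrow> 'a \<Rightarrow> 'a" (infixl "\<bullet>" 75) and I :: "tm \<Rightarrow> 'a"
begin

definition D :: "ty \<Rightarrow> 'a set" where "D \<sigma> = {a. ok a \<and> tp a = \<sigma>}"

lemma in_D [simp]: "a \<in> D \<sigma> \<longleftrightarrow> ok a \<and> tp a = \<sigma>"
  by (simp add: D_def)

fun eval :: "(var \<Rightarrow> 'a) \<Rightarrow> tm \<Rightarrow> 'a" where
  "eval e (Var x) = e x"
| "eval e (s \<cdot> t) = eval e s \<bullet> eval e t"
| "eval e c = I c"

fun sat :: "(var \<Rightarrow> 'a) \<Rightarrow> fm \<Rightarrow> bool" where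
  "sat e (s \<^bold>= t) \<longleftrightarrow> eval e s = eval e t"
| "sat e Bot \<longleftrightarrow> False"
| "sat e (\<phi> \<^bold>\<and> \<psi>) \<longleftrightarrow> sat e \<phi> \<and> sat e \<psi>"
| "sat e (\<phi> \<^bold>\<or> \<psi>) \<longleftrightarrow> sat e \<phi> \<or> sat e \<psi>"
| "sat e (\<phi> \<^bold>\<longrightarrow> \<psi>) \<longleftrightarrow> (sat e \<phi> \<longrightarrow> sat e \<psi>)"
| "sat e (Forall x \<phi>) \<longleftrightarrow> (\<forall>a \<in> D (snd x). sat (e(x := a)) \<phi>)"
| "sat e (Exists x \<phi>) \<longleftrightarrow> (\<exists>a \<in> D (snd x). sat (e(x := a)) \<phi>)"
| "sat e _ \<longleftrightarrow> False"

definition env :: "(var \<Rightarrow> 'a) \<Rightarrow> bool" where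
  "env e \<longleftrightarrow> (\<forall>x. ok (e x) \<and> tp (e x) = snd x)"

lemma env_upd [simp]: "env e \<Longrightarrow> ok a \<Longrightarrow> tp a = snd x \<Longrightarrow> env (e(x := a))"
  unfolding env_def by (metis fun_upd_apply)

lemma env_ok [simp]: "env e \<Longrightarrow> ok (e x)" and env_tp [simp]: "env e \<Longrightarrow> tp (e x) = snd x"
  unfolding env_def by blast+

lemma eval_cong: "(\<And>x. x \<in> fvt t \<Longrightarrow> e x = e' x) \<Longrightarrow> eval e t = eval e' t"
  by (induction t) auto

lemma sat_cong: "(\<And>x. x \<in> fv \<phi> \<Longrightarrow> e x = e' x) \<Longrightarrow> sat e \<phi> = sat e' \<phi>"
proof (induction \<phi> arbitrary: e e')
  case (Eq s t)
  then show ?case using eval_cong[of s e e'] eval_cong[of t e e'] by simp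
next
  case (And \<phi> \<psi>)
  have "sat e \<phi> = sat e' \<phi>" "sat e \<psi> = sat e' \<psi>" by (rule And.IH; use And.prems in simp)+
  then show ?case by simp
next
  case (Or \<phi> \<psi>)
  have "sat e \<phi> = sat e' \<phi>" "sat e \<psi> = sat e' \<psi>" by (rule Or.IH; use Or.prems in simp)+
  then show ?case by simp
next
  case (Imp \<phi> \<psi>)
  have "sat e \<phi> = sat e' \<phi>" "sat e \<psi> = sat e' \<psi>" by (rule Imp.IH; use Imp.prems in simp)+
  then show ?case by simp
next
  case (Forall x \<phi>)
  have "sat (e(x := a)) \<phi> = sat (e'(x := a)) \<phi>" for a
    by (rule Forall.IH) (use Forall.prems in auto)
  then show ?case by simp
next
  case (Exists x \<phi>)
  have "sat (e(x := a)) \<phi> = sat (e'(x := a)) \<phi>" for a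
    by (rule Exists.IH) (use Exists.prems in auto)
  then show ?case by simp
qed simp_all

lemma eval_upd_fresh [simp]: "x \<notin> fvt t \<Longrightarrow> eval (e(x := a)) t = eval e t"
  by (rule eval_cong) auto

lemma sat_upd_fresh: "x \<notin> fv \<phi> \<Longrightarrow> sat (e(x := a)) \<phi> = sat e \<phi>"
  by (rule sat_cong) auto

lemma eval_substt: "eval e (substt x r t) = eval (e(x := eval e r)) t"
  by (induction t) auto

lemma sat_subst: "free_for x r \<phi> \<Longrightarrow> sat e (subst x r \<phi>) = sat (e(x := eval e r)) \<phi>"
proof (induction \<phi> arbitrary: e)
  case (Forall y \<phi>)
  show ?case
  proof (cases "x \<in> fv \<phi> - {y}")
    case False
    then have x: "x \<notin> fv (Forall y \<phi>)" by simp
    show ?thesis unfolding subst_fresh[OF x] by (rule sat_upd_fresh[OF x, symmetric])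
  next
    case True
    then have "y \<notin> fvt r" "free_for x r \<phi>" using Forall.prems by auto
    then have "sat (e(y := a)) (subst x r \<phi>) = sat (e(x := eval e r, y := a)) \<phi>" for a
    proof -
      have "sat (e(y := a)) (subst x r \<phi>) = sat (e(y := a, x := eval (e(y := a)) r)) \<phi>"
        by (rule Forall.IH) fact+
      also have "e(y := a, x := eval (e(y := a)) r) = e(x := eval e r, y := a)"
        using True \<open>y \<notin> fvt r\<close> by (subst fun_upd_twist) auto
      finally show ?thesis .
    qed
    then show ?thesis using True by (simp only: subst.simps sat.simps Diff_iff singleton_iff if_False simp_thms)
  qed
next
  case (Exists y \<phi>)
  show ?case
  proof (cases "x \<in> fv \<phi> - {y}")
    case False
    then have x: "x \<notin> fv (Exists y \<phi>)" by simp
    show ?thesis unfolding subst_fresh[OF x] by (rule sat_upd_fresh[OF x, symmetric])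
  next
    case True
    then have "y \<notin> fvt r" "free_for x r \<phi>" using Exists.prems by auto
    then have "sat (e(y := a)) (subst x r \<phi>) = sat (e(x := eval e r, y := a)) \<phi>" for a
    proof -
      have "sat (e(y := a)) (subst x r \<phi>) = sat (e(y := a, x := eval (e(y := a)) r)) \<phi>"
        by (rule Exists.IH) fact+
      also have "e(y := a, x := eval (e(y := a)) r) = e(x := eval e r, y := a)"
        using True \<open>y \<notin> fvt r\<close> by (subst fun_upd_twist) auto
      finally show ?thesis .
    qed
    then show ?thesis using True by (simp only: subst.simps sat.simps Diff_iff singleton_iff if_False simp_thms)
  qed
qed (auto simp: eval_substt)

end

text \<open>Application is total on a single carrier, and types appear only as conditions.
  \<open>I\<close> is declared on all terms because the constants do not form a type of their own;
  \<open>eval\<close> consults it at constants only.\<close>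

locale model = struc +
  assumes tp_ap [simp]: "tp (f \<bullet> a) = res (tp f)"
    and ok_ap [simp]: "ok f \<Longrightarrow> ok a \<Longrightarrow> fits (tp f) (tp a) \<Longrightarrow> ok (f \<bullet> a)"
    and tp_I [simp]: "tp (I c) = tyof c"
    and ok_I [simp]: "wt c \<Longrightarrow> ok (I c)"
    and sat_ax: "\<phi> \<in> EPA_ax \<Longrightarrow> wff \<phi> \<Longrightarrow> internal \<phi> \<Longrightarrow> env e \<Longrightarrow> sat e \<phi>"
begin

lemma tp_eval [simp]: "env e \<Longrightarrow> tp (eval e t) = tyof t"
  by (induction t) (auto split: ty.split)

lemma ok_eval [simp]: "env e \<Longrightarrow> wt t \<Longrightarrow> ok (eval e t)"
  by (induction t) auto

definition zr :: "ty \<Rightarrow> 'a" where "zr \<sigma> = eval undefined (zero_c \<sigma>)"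

definition e0 :: "var \<Rightarrow> 'a" where "e0 x = zr (snd x)"

definition cl :: "tm \<Rightarrow> 'a" where "cl t = eval e0 t"

lemma zr_simps: "zr Nat = I Zero" "zr (\<sigma> \<rightarrow>\<^sub>t \<tau>) = I (Kc \<tau> \<sigma>) \<bullet> zr \<tau>"
  by (auto simp: zr_def)

lemma ok_zr [simp]: "ok (zr \<sigma>)" and tp_zr [simp]: "tp (zr \<sigma>) = \<sigma>"
  by (induction \<sigma>) (auto simp: zr_simps)

lemma env_e0 [simp]: "env e0"
  by (simp add: env_def e0_def)

lemma eval_closed: "fvt t = {} \<Longrightarrow> eval e t = cl t"
  unfolding cl_def by (rule eval_cong) simp

lemma eval_zero_c [simp]: "eval e (zero_c \<sigma>) = zr \<sigma>"
  unfolding zr_def by (rule eval_cong) simp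

lemma tp_cl [simp]: "tp (cl t) = tyof t" and ok_cl [simp]: "wt t \<Longrightarrow> ok (cl t)"
  by (simp_all add: cl_def)

abbreviation N where "N \<equiv> D Nat"
abbreviation ze where "ze \<equiv> I Zero"
abbreviation su where "su n \<equiv> I Succ \<bullet> n"

lemma Kc_eq [simp]:
  assumes "a \<in> D \<rho>" "b \<in> D \<sigma>" shows "I (Kc \<rho> \<sigma>) \<bullet> a \<bullet> b = a"
  using sat_ax[OF EPA_ax.Kc_eq[of \<rho> \<sigma> "v 0 \<rho>" "v 1 \<sigma>"], of "e0((0,\<rho>) := a, (1,\<sigma>) := b)"] assms
  by simp

lemma Sc_eq [simp]:
  assumes "a \<in> D (\<rho> \<rightarrow>\<^sub>t \<sigma> \<rightarrow>\<^sub>t \<tau>)" "b \<in> D (\<rho> \<rightarrow>\<^sub>t \<sigma>)" "c \<in> D \<rho>"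
  shows "I (Sc \<rho> \<sigma> \<tau>) \<bullet> a \<bullet> b \<bullet> c = a \<bullet> c \<bullet> (b \<bullet> c)"
  using sat_ax[OF EPA_ax.Sc_eq[of \<rho> \<sigma> \<tau> "v 0 (\<rho> \<rightarrow>\<^sub>t \<sigma> \<rightarrow>\<^sub>t \<tau>)" "v 1 (\<rho> \<rightarrow>\<^sub>t \<sigma>)" "v 2 \<rho>"],
    of "e0((0,(\<rho> \<rightarrow>\<^sub>t \<sigma> \<rightarrow>\<^sub>t \<tau>)) := a, (1,(\<rho> \<rightarrow>\<^sub>t \<sigma>)) := b, (2,\<rho>) := c)"] assms
  by simp

lemma Rc_Zero [simp]:
  assumes "a \<in> D \<sigma>" "b \<in> D (\<sigma> \<rightarrow>\<^sub>t Nat \<rightarrow>\<^sub>t \<sigma>)"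
  shows "I (Rc \<sigma>) \<bullet> a \<bullet> b \<bullet> ze = a"
  using sat_ax[OF EPA_ax.Rc_Zero[of \<sigma> "v 0 \<sigma>" "v 1 (\<sigma> \<rightarrow>\<^sub>t Nat \<rightarrow>\<^sub>t \<sigma>)"],
    of "e0((0,\<sigma>) := a, (1,(\<sigma> \<rightarrow>\<^sub>t Nat \<rightarrow>\<^sub>t \<sigma>)) := b)"] assms
  by simp

lemma Rc_Succ [simp]:
  assumes "a \<in> D \<sigma>" "b \<in> D (\<sigma> \<rightarrow>\<^sub>t Nat \<rightarrow>\<^sub>t \<sigma>)" "n \<in> N"
  shows "I (Rc \<sigma>) \<bullet> a \<bullet> b \<bullet> su n = b \<bullet> (I (Rc \<sigma>) \<bullet> a \<bullet> b \<bullet> n) \<bullet> n"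
  using sat_ax[OF EPA_ax.Rc_Succ[of \<sigma> "v 0 \<sigma>" "v 1 (\<sigma> \<rightarrow>\<^sub>t Nat \<rightarrow>\<^sub>t \<sigma>)" "v 2 Nat"],
    of "e0((0,\<sigma>) := a, (1,(\<sigma> \<rightarrow>\<^sub>t Nat \<rightarrow>\<^sub>t \<sigma>)) := b, (2,Nat) := n)"] assms
  by simp

lemma su_ze [simp]:
  assumes "n \<in> N" shows "su n \<noteq> ze" "ze \<noteq> su n"
  using sat_ax[OF EPA_ax.Succ_not_Zero[of "v 0 Nat"], of "e0((0,Nat) := n)"] assms
  by auto

lemma su_inj [simp]:
  assumes "m \<in> N" "n \<in> N" shows "su m = su n \<longleftrightarrow> m = n"
  using sat_ax[OF EPA_ax.Succ_inj[of "v 0 Nat" "v 1 Nat"], of "e0((0,Nat) := m, (1,Nat) := n)"] assms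
  by auto

lemma ext:
  assumes "f \<in> D (\<sigma> \<rightarrow>\<^sub>t \<tau>)" "g \<in> D (\<sigma> \<rightarrow>\<^sub>t \<tau>)" "\<And>a. a \<in> D \<sigma> \<Longrightarrow> f \<bullet> a = g \<bullet> a"
  shows "f = g"
  using sat_ax[OF EPA_ax.Ext[of "(2,\<sigma>)" "v 0 (\<sigma> \<rightarrow>\<^sub>t \<tau>)" "v 1 (\<sigma> \<rightarrow>\<^sub>t \<tau>)"],
    of "e0((0,(\<sigma> \<rightarrow>\<^sub>t \<tau>)) := f, (1,(\<sigma> \<rightarrow>\<^sub>t \<tau>)) := g)"] assms
  by simp

text \<open>The only induction available inside a model, whose numbers may be nonstandard. Each
  arithmetic law below is first written as a formula, proved by this rule, and then read back by
  simplification.\<close>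

lemma sat_ind:
  assumes "internal \<phi>" "wff \<phi>" "snd x = Nat" "env e"
    and "sat (e(x := ze)) \<phi>"
    and "\<And>n. n \<in> N \<Longrightarrow> sat (e(x := n)) \<phi> \<Longrightarrow> sat (e(x := su n)) \<phi>"
    and "n \<in> N"
  shows "sat (e(x := n)) \<phi>"
  using sat_ax[OF EPA_ax.Ind[of x \<phi>], of e] assms by (auto simp: sat_subst)

text \<open>Follows from the equations for \<open>Kc\<close> and \<open>Sc\<close>. No substitution
  takes place: the argument moves into the environment, so capture is not an issue.\<close>

lemma beta [simp]:
  assumes "env e" "wt t" "ok a" "tp a = snd x"
  shows "eval e (lam x t) \<bullet> a = eval (e(x := a)) t"
  using assms(2)
proof (induction t)
  case (App s t)
  then show ?case using assms by (auto simp add: lam.simps)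
qed (use assms in \<open>simp_all add: lam.simps\<close>)

end

section \<open>Arithmetic and coding of sequences in a model\<close>

lemma add_c [simp]: "wt add_c" "tyof add_c = Nat \<rightarrow>\<^sub>t Nat \<rightarrow>\<^sub>t Nat" "fvt add_c = {}"
  by (simp_all add: add_c_def)

lemma pred_c [simp]: "wt pred_c" "tyof pred_c = Nat \<rightarrow>\<^sub>t Nat" "fvt pred_c = {}"
  by (simp_all add: pred_c_def)

lemma monus_c [simp]: "wt monus_c" "tyof monus_c = Nat \<rightarrow>\<^sub>t Nat \<rightarrow>\<^sub>t Nat" "fvt monus_c = {}"
  by (simp_all add: monus_c_def)

lemma cond_c [simp]: "wt (cond_c \<sigma>)" "tyof (cond_c \<sigma>) = Nat \<rightarrow>\<^sub>t \<sigma> \<rightarrow>\<^sub>t \<sigma> \<rightarrow>\<^sub>t \<sigma>" "fvt (cond_c \<sigma>) = {}"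
  by (auto simp: cond_c_def)

lemma tri_c [simp]: "wt tri_c" "tyof tri_c = Nat \<rightarrow>\<^sub>t Nat" "fvt tri_c = {}"
  by (auto simp: tri_c_def)

lemma pair_c [simp]: "wt pair_c" "tyof pair_c = Nat \<rightarrow>\<^sub>t Nat \<rightarrow>\<^sub>t Nat" "fvt pair_c = {}"
  by (auto simp: pair_c_def)

lemma unpair_step_c [simp]: "wt unpair_step_c"
  "tyof unpair_step_c = (Nat \<rightarrow>\<^sub>t Nat) \<rightarrow>\<^sub>t Nat \<rightarrow>\<^sub>t Nat" "fvt unpair_step_c = {}"
  by (auto simp: unpair_step_c_def Let_def)

lemma unpair_c [simp]: "wt unpair_c" "tyof unpair_c = Nat \<rightarrow>\<^sub>t Nat \<rightarrow>\<^sub>t Nat" "fvt unpair_c = {}"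
  by (auto simp: unpair_c_def)

lemma fst_c [simp]: "wt fst_c" "tyof fst_c = Nat \<rightarrow>\<^sub>t Nat" "fvt fst_c = {}"
  by (auto simp: fst_c_def)

lemma snd_c [simp]: "wt snd_c" "tyof snd_c = Nat \<rightarrow>\<^sub>t Nat" "fvt snd_c = {}"
  by (auto simp: snd_c_def)

lemma len_c [simp]: "wt (len_c \<sigma>)" "tyof (len_c \<sigma>) = \<sigma> \<rightarrow>\<^sub>t Nat" "fvt (len_c \<sigma>) = {}"
  by (induction \<sigma>) auto

lemma proj_c [simp]: "wt (proj_c \<sigma>)" "tyof (proj_c \<sigma>) = \<sigma> \<rightarrow>\<^sub>t Nat \<rightarrow>\<^sub>t \<sigma>" "fvt (proj_c \<sigma>) = {}"
  by (induction \<sigma>) auto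

lemma tail_c [simp]: "wt tail_c" "tyof tail_c = Nat \<rightarrow>\<^sub>t (Nat \<rightarrow>\<^sub>t Nat) \<rightarrow>\<^sub>t Nat" "fvt tail_c = {}"
  by (auto simp: tail_c_def)

lemma seq_c [simp]: "wt (seq_c \<sigma>)" "tyof (seq_c \<sigma>) = Nat \<rightarrow>\<^sub>t (Nat \<rightarrow>\<^sub>t \<sigma>) \<rightarrow>\<^sub>t \<sigma>" "fvt (seq_c \<sigma>) = {}"
  by (induction \<sigma>) auto

lemma empty_c [simp]: "wt (empty_c \<sigma>)" "tyof (empty_c \<sigma>) = \<sigma>" "fvt (empty_c \<sigma>) = {}"
  by (auto simp: empty_c_def)

lemma cat_c [simp]: "wt (cat_c \<sigma>)" "tyof (cat_c \<sigma>) = \<sigma> \<rightarrow>\<^sub>t \<sigma> \<rightarrow>\<^sub>t \<sigma>" "fvt (cat_c \<sigma>) = {}"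
  by (auto simp: cat_c_def Let_def)

lemma sapp_c [simp]: "wt (sapp_c \<sigma> \<tau>)" "tyof (sapp_c \<sigma> \<tau>) = (\<sigma> \<rightarrow>\<^sub>t \<tau>) \<rightarrow>\<^sub>t \<sigma> \<rightarrow>\<^sub>t \<tau>" "fvt (sapp_c \<sigma> \<tau>) = {}"
  by (auto simp: sapp_c_def)

lemmas len_c_Nat = len_c.simps(1)
lemmas len_c_Fn = len_c.simps(2)
lemmas proj_c_Nat = proj_c.simps(1)
lemmas proj_c_Fn = proj_c.simps(2)
lemmas seq_c_Nat = seq_c.simps(1)
lemmas seq_c_Fn = seq_c.simps(2)
declare zero_c.simps [simp del] len_c.simps [simp del] proj_c.simps [simp del] seq_c.simps [simp del]

context model
begin

text \<open>Normal form for simplification: a closed constant has the same value everywhere, and its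
  definition is opened only where \<open>cl_eq\<close> is invoked.\<close>

lemma eval_consts [simp]: "eval e add_c = cl add_c" "eval e pred_c = cl pred_c"
  "eval e monus_c = cl monus_c" "eval e (cond_c \<sigma>) = cl (cond_c \<sigma>)" "eval e tri_c = cl tri_c"
  "eval e pair_c = cl pair_c" "eval e unpair_step_c = cl unpair_step_c"
  "eval e unpair_c = cl unpair_c" "eval e fst_c = cl fst_c" "eval e snd_c = cl snd_c"
  "eval e (len_c \<sigma>) = cl (len_c \<sigma>)" "eval e (proj_c \<sigma>) = cl (proj_c \<sigma>)" "eval e tail_c = cl tail_c"
  "eval e (seq_c \<sigma>) = cl (seq_c \<sigma>)" "eval e (empty_c \<sigma>) = cl (empty_c \<sigma>)"
  "eval e (cat_c \<sigma>) = cl (cat_c \<sigma>)" "eval e (sapp_c \<sigma> \<tau>) = cl (sapp_c \<sigma> \<tau>)"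
  by (simp_all add: eval_closed)

lemma cl_eq: "c = t \<Longrightarrow> cl c = eval e0 t"
  by (simp add: cl_def)

section \<open>Addition, truncated subtraction and the order\<close>

abbreviation add where "add m n \<equiv> cl add_c \<bullet> m \<bullet> n"
abbreviation sub where "sub m n \<equiv> cl monus_c \<bullet> m \<bullet> n"

lemma pred_ze [simp]: "cl pred_c \<bullet> ze = ze"
  and pred_su [simp]: "n \<in> N \<Longrightarrow> cl pred_c \<bullet> su n = n"
  by (simp_all add: cl_eq[OF pred_c_def])

lemma add_ze [simp]: "m \<in> N \<Longrightarrow> add m ze = m"
  and add_su [simp]: "m \<in> N \<Longrightarrow> n \<in> N \<Longrightarrow> add m (su n) = su (add m n)"
  by (simp_all add: cl_eq[OF add_c_def])

lemma sub_ze [simp]: "m \<in> N \<Longrightarrow> sub m ze = m"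
  and sub_su: "m \<in> N \<Longrightarrow> n \<in> N \<Longrightarrow> sub m (su n) = cl pred_c \<bullet> (sub m n)"
  by (simp_all add: cl_eq[OF monus_c_def])

lemma cond_ze [simp]: "a \<in> D \<sigma> \<Longrightarrow> b \<in> D \<sigma> \<Longrightarrow> cl (cond_c \<sigma>) \<bullet> ze \<bullet> a \<bullet> b = a"
  and cond_su [simp]: "n \<in> N \<Longrightarrow> a \<in> D \<sigma> \<Longrightarrow> b \<in> D \<sigma> \<Longrightarrow> cl (cond_c \<sigma>) \<bullet> su n \<bullet> a \<bullet> b = b"
  by (simp_all add: cl_eq[OF cond_c_def])

lemma nat_cases:
  assumes "n \<in> N" obtains "n = ze" | m where "m \<in> N" "n = su m"
proof -
  have "sat (e0((0,Nat) := n)) (v 0 Nat \<^bold>= Zero \<^bold>\<or> Exists (1,Nat) (v 0 Nat \<^bold>= Succ \<cdot> v 1 Nat))"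
    by (rule sat_ind) (use assms in auto)
  then show ?thesis using that by auto
qed

lemma add_zel [simp]:
  assumes "n \<in> N" shows "add ze n = n"
proof -
  have "sat (e0((0,Nat) := n)) (add_c \<cdot> Zero \<cdot> v 0 Nat \<^bold>= v 0 Nat)"
    by (rule sat_ind) (use assms in auto)
  then show ?thesis by simp
qed

lemma add_sul [simp]:
  assumes "m \<in> N" "n \<in> N" shows "add (su m) n = su (add m n)"
proof -
  have "sat (e0((1,Nat) := m, (0,Nat) := n))
    (add_c \<cdot> (Succ \<cdot> v 1 Nat) \<cdot> v 0 Nat \<^bold>= Succ \<cdot> (add_c \<cdot> v 1 Nat \<cdot> v 0 Nat))"
    by (rule sat_ind) (use assms in auto)
  then show ?thesis by simp
qed

lemma add_assoc:
  assumes "k \<in> N" "m \<in> N" "n \<in> N" shows "add (add k m) n = add k (add m n)"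
proof -
  have "sat (e0((2,Nat) := k, (1,Nat) := m, (0,Nat) := n))
    (add_c \<cdot> (add_c \<cdot> v 2 Nat \<cdot> v 1 Nat) \<cdot> v 0 Nat \<^bold>= add_c \<cdot> v 2 Nat \<cdot> (add_c \<cdot> v 1 Nat \<cdot> v 0 Nat))"
    by (rule sat_ind) (use assms in auto)
  then show ?thesis by simp
qed

lemma sub_su_su [simp]:
  assumes "m \<in> N" "n \<in> N" shows "sub (su m) (su n) = sub m n"
proof -
  have "sat (e0((1,Nat) := m, (0,Nat) := n))
    (monus_c \<cdot> (Succ \<cdot> v 1 Nat) \<cdot> (Succ \<cdot> v 0 Nat) \<^bold>= monus_c \<cdot> v 1 Nat \<cdot> v 0 Nat)"
    by (rule sat_ind) (use assms in \<open>auto simp: sub_su\<close>)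
  then show ?thesis by simp
qed

lemma sub_zel [simp]:
  assumes "n \<in> N" shows "sub ze n = ze"
proof -
  have "sat (e0((0,Nat) := n)) (monus_c \<cdot> Zero \<cdot> v 0 Nat \<^bold>= Zero)"
    by (rule sat_ind) (use assms in \<open>auto simp: sub_su\<close>)
  then show ?thesis by simp
qed

lemma sub_add [simp]:
  assumes "m \<in> N" "n \<in> N" shows "sub (add m n) m = n"
proof -
  have "sat (e0((1,Nat) := n, (0,Nat) := m))
    (monus_c \<cdot> (add_c \<cdot> v 0 Nat \<cdot> v 1 Nat) \<cdot> v 0 Nat \<^bold>= v 1 Nat)"
    by (rule sat_ind) (use assms in auto)
  then show ?thesis by simp
qed

lemma sub_add' [simp]:
  assumes "m \<in> N" "n \<in> N" shows "sub m (add m n) = ze"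
proof -
  have "sat (e0((1,Nat) := n, (0,Nat) := m))
    (monus_c \<cdot> v 0 Nat \<cdot> (add_c \<cdot> v 0 Nat \<cdot> v 1 Nat) \<^bold>= Zero)"
    by (rule sat_ind) (use assms in auto)
  then show ?thesis by simp
qed

text \<open>Turns the order, which \<open>le\<close> encodes by truncated subtraction, into an
  additive witness; later comparisons of indices become equations.\<close>

lemma sub_eq_ze:
  assumes "m \<in> N" "n \<in> N" "sub m n = ze" obtains k where "k \<in> N" "n = add m k"
proof -
  \<comment> \<open>The second number is quantified inside the formula because the induction step
    passes to its predecessor.\<close>
  let ?F = "Forall (1,Nat) (monus_c \<cdot> v 0 Nat \<cdot> v 1 Nat \<^bold>= Zero \<^bold>\<longrightarrow>
    Exists (2,Nat) (v 1 Nat \<^bold>= add_c \<cdot> v 0 Nat \<cdot> v 2 Nat))"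
  have "sat (e0((0,Nat) := m)) ?F"
  proof (rule sat_ind)
    fix n assume *: "n \<in> N" and IH: "sat (e0((0,Nat) := n)) ?F"
    have "\<exists>k\<in>N. m = add (su n) k" if "m \<in> N" "sub (su n) m = ze" for m
      using \<open>m \<in> N\<close>
    proof (cases rule: nat_cases)
      case 1
      then show ?thesis using that * by simp
    next
      case (2 m')
      then have "sub n m' = ze" using that * by simp
      then have "\<exists>k\<in>N. m' = add n k" using IH 2 * by auto
      then show ?thesis using 2 * by auto
    qed
    then show "sat (e0((0,Nat) := su n)) ?F"
      using * by auto
  qed (use assms in auto)
  then show ?thesis using assms that by auto
qed

abbreviation lt where "lt i n \<equiv> sub (su i) n = ze"

lemma lt_su:
  assumes "i \<in> N" "n \<in> N" "lt i (su n)" shows "lt i n \<or> i = n"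
proof -
  obtain k where k: "k \<in> N" "su n = add (su i) k"
    by (rule sub_eq_ze[of "su i" "su n"]) (use assms in auto)
  have n: "n = add i k" using k assms by simp
  show ?thesis using k(1)
  proof (cases rule: nat_cases)
    case 1
    then show ?thesis using n assms by simp
  next
    case (2 m)
    have "lt i (add (su i) m)" using assms 2 sub_add'[of "su i" m] by (simp del: add_sul)
    then show ?thesis using n 2 assms by simp
  qed
qed

section \<open>Cantor pairing and its inverse\<close>

lemma tri_ze [simp]: "cl tri_c \<bullet> ze = ze"
  and tri_su [simp]: "n \<in> N \<Longrightarrow> cl tri_c \<bullet> su n = su (add (cl tri_c \<bullet> n) n)"
  by (simp_all add: cl_eq[OF tri_c_def])

lemma pair_eq: "m \<in> N \<Longrightarrow> n \<in> N \<Longrightarrow> cl pair_c \<bullet> m \<bullet> n = add (cl tri_c \<bullet> add m n) n"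
  by (simp add: cl_eq[OF pair_c_def])

lemma unpair_ze [simp]: "n \<in> N \<Longrightarrow> cl unpair_c \<bullet> ze \<bullet> n = ze"
  and unpair_su [simp]: "n \<in> N \<Longrightarrow> cl unpair_c \<bullet> su n = cl unpair_step_c \<bullet> (cl unpair_c \<bullet> n)"
  by (simp_all add: cl_eq[OF unpair_c_def])

lemma unpair_step: "f \<in> D (Nat \<rightarrow>\<^sub>t Nat) \<Longrightarrow> n \<in> N \<Longrightarrow> cl unpair_step_c \<bullet> f \<bullet> n =
    cl (cond_c Nat) \<bullet> n \<bullet> (cl (cond_c Nat) \<bullet> (f \<bullet> ze) \<bullet> su (f \<bullet> su ze) \<bullet> (cl pred_c \<bullet> (f \<bullet> ze)))
      \<bullet> (cl (cond_c Nat) \<bullet> (f \<bullet> ze) \<bullet> ze \<bullet> su (f \<bullet> su ze))"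
  by (simp add: cl_eq[OF unpair_step_c_def] Let_def)

text \<open>The enumeration walks along the diagonal of sum \<open>s\<close>: from
  \<open>(s, 0)\<close> at code \<open>tri s\<close>, after \<open>b\<close> steps it has reached
  \<open>(s - b, b)\<close>. The induction on \<open>b\<close> quantifies over \<open>a\<close>,
  since the pair with \<open>b + 1\<close> is reached from the one with first component
  \<open>a + 1\<close>.\<close>

lemma unpair_diag:
  assumes t: "cl unpair_c \<bullet> (cl tri_c \<bullet> s) \<bullet> ze = s" "cl unpair_c \<bullet> (cl tri_c \<bullet> s) \<bullet> su ze = ze"
    and s: "s = add a b" "a \<in> N" "b \<in> N"
  shows "cl unpair_c \<bullet> add (cl tri_c \<bullet> s) b \<bullet> ze = a \<and> cl unpair_c \<bullet> add (cl tri_c \<bullet> s) b \<bullet> su ze = b"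
proof -
  let ?F = "Forall (2,Nat) (v 1 Nat \<^bold>= add_c \<cdot> v 2 Nat \<cdot> v 0 Nat \<^bold>\<longrightarrow>
    unpair_c \<cdot> (add_c \<cdot> (tri_c \<cdot> v 1 Nat) \<cdot> v 0 Nat) \<cdot> Zero \<^bold>= v 2 Nat \<^bold>\<and>
    unpair_c \<cdot> (add_c \<cdot> (tri_c \<cdot> v 1 Nat) \<cdot> v 0 Nat) \<cdot> (Succ \<cdot> Zero) \<^bold>= v 0 Nat)"
  have "sat (e0((1,Nat) := s, (0,Nat) := b)) ?F"
  proof (rule sat_ind)
    fix b assume b: "b \<in> N" and IH: "sat (e0((1,Nat) := s, (0,Nat) := b)) ?F"
    have sN: "s \<in> N" using s by simp
    have "cl unpair_c \<bullet> add (cl tri_c \<bullet> s) (su b) \<bullet> ze = a \<and> cl unpair_c \<bullet> add (cl tri_c \<bullet> s) (su b) \<bullet> su ze = su b"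
      if "a \<in> N" "s = add a (su b)" for a
    proof -
      have "s = add (su a) b" using that b by simp
      then have "cl unpair_c \<bullet> add (cl tri_c \<bullet> s) b \<bullet> ze = su a \<and> cl unpair_c \<bullet> add (cl tri_c \<bullet> s) b \<bullet> su ze = b"
        using IH b that(1) by (auto dest: bspec[of _ _ "su a"])
      then show ?thesis using b that(1) sN by (simp add: unpair_step)
    qed
    then show "sat (e0((1,Nat) := s, (0,Nat) := su b)) ?F"
      by auto
  qed (use s t in auto)
  then show ?thesis using s by auto
qed

text \<open>Diagonal \<open>s\<close> ends at \<open>(0, s)\<close> by \<open>unpair_diag\<close>,
  and the next step of the enumeration opens the new diagonal at \<open>(s + 1, 0)\<close>.\<close>

lemma unpair_tri:
  assumes "s \<in> N"
  shows "cl unpair_c \<bullet> (cl tri_c \<bullet> s) \<bullet> ze = s \<and> cl unpair_c \<bullet> (cl tri_c \<bullet> s) \<bullet> su ze = ze"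
proof -
  let ?F = "unpair_c \<cdot> (tri_c \<cdot> v 0 Nat) \<cdot> Zero \<^bold>= v 0 Nat \<^bold>\<and>
    unpair_c \<cdot> (tri_c \<cdot> v 0 Nat) \<cdot> (Succ \<cdot> Zero) \<^bold>= Zero"
  have "sat (e0((0,Nat) := s)) ?F"
  proof (rule sat_ind)
    fix s assume s: "s \<in> N" and "sat (e0((0,Nat) := s)) ?F"
    then have "cl unpair_c \<bullet> add (cl tri_c \<bullet> s) s \<bullet> ze = ze \<and> cl unpair_c \<bullet> add (cl tri_c \<bullet> s) s \<bullet> su ze = s"
      by (intro unpair_diag) auto
    then show "sat (e0((0,Nat) := su s)) ?F"
      using s by (simp add: unpair_step)
  qed (use assms in auto)
  then show ?thesis by simp
qed

lemma fst_pair [simp]: "m \<in> N \<Longrightarrow> n \<in> N \<Longrightarrow> cl fst_c \<bullet> (cl pair_c \<bullet> m \<bullet> n) = m"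
  and snd_pair [simp]: "m \<in> N \<Longrightarrow> n \<in> N \<Longrightarrow> cl snd_c \<bullet> (cl pair_c \<bullet> m \<bullet> n) = n"
  using unpair_diag[OF unpair_tri[THEN conjunct1] unpair_tri[THEN conjunct2] refl, of m n]
  by (simp_all add: cl_eq[OF fst_c_def] cl_eq[OF snd_c_def] pair_eq)

section \<open>Coded sequences and their components\<close>

definition shift where
  "shift h = eval (e0((2, Nat \<rightarrow>\<^sub>t Nat) := h)) (\<^bold>\<lambda>3:Nat. v 2 (Nat \<rightarrow>\<^sub>t Nat) \<cdot> (Succ \<cdot> v 3 Nat))"

lemma shift [simp]: "h \<in> D (Nat \<rightarrow>\<^sub>t Nat) \<Longrightarrow> ok (shift h)"
  "h \<in> D (Nat \<rightarrow>\<^sub>t Nat) \<Longrightarrow> tp (shift h) = Nat \<rightarrow>\<^sub>t Nat"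
  "h \<in> D (Nat \<rightarrow>\<^sub>t Nat) \<Longrightarrow> n \<in> N \<Longrightarrow> shift h \<bullet> n = h \<bullet> su n"
  by (simp_all add: shift_def)

lemma tail_su [simp]:
  assumes "n \<in> N" "h \<in> D (Nat \<rightarrow>\<^sub>t Nat)"
  shows "cl tail_c \<bullet> su n \<bullet> h = cl pair_c \<bullet> (h \<bullet> ze) \<bullet> (cl tail_c \<bullet> n \<bullet> shift h)"
proof -
  have "eval e (\<^bold>\<lambda>3:Nat. v 2 (Nat \<rightarrow>\<^sub>t Nat) \<cdot> (Succ \<cdot> v 3 Nat)) = shift h" if "e (2, Nat \<rightarrow>\<^sub>t Nat) = h" for e
    unfolding shift_def by (rule eval_cong) (use that in auto)
  then show ?thesis using assms by (simp add: cl_eq[OF tail_c_def])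
qed

text \<open>The recursion inside \<open>proj_c Nat\<close>: the second projection iterated
  \<open>i\<close> times, which drops the first \<open>i\<close> cells of a coded list.\<close>

definition snds :: "'a \<Rightarrow> 'a \<Rightarrow> 'a" where
  "snds y i = I (Rc Nat) \<bullet> y \<bullet> cl (\<^bold>\<lambda>2:Nat. \<^bold>\<lambda>3:Nat. snd_c \<cdot> v 2 Nat) \<bullet> i"

lemma ok_snds [simp]: "y \<in> N \<Longrightarrow> i \<in> N \<Longrightarrow> ok (snds y i)" "tp (snds y i) = Nat"
  by (simp_all add: snds_def)

lemma snds_ze [simp]: "y \<in> N \<Longrightarrow> snds y ze = y"
  and snds_su: "y \<in> N \<Longrightarrow> i \<in> N \<Longrightarrow> snds y (su i) = cl snd_c \<bullet> snds y i"
  by (simp_all add: snds_def) (simp_all add: cl_def[of "lam _ _"])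

text \<open>The recursor applies the new \<open>snd_c\<close> on the outside; moving it to the
  inside makes it remove the first cell of the list, as \<open>snds_tail\<close> requires.\<close>

lemma snds_shift [simp]:
  assumes "y \<in> N" "i \<in> N" shows "snds y (su i) = snds (cl snd_c \<bullet> y) i"
proof -
  let ?l = "\<^bold>\<lambda>2:Nat. \<^bold>\<lambda>3:Nat. snd_c \<cdot> v 2 Nat"
  have "eval e ?l = cl ?l" for e by (rule eval_closed) simp
  note [simp] = this snds_def[symmetric]
  have "sat (e0((1,Nat) := y, (0,Nat) := i)) (Rc Nat \<cdot> v 1 Nat \<cdot> ?l \<cdot> (Succ \<cdot> v 0 Nat) \<^bold>=
     Rc Nat \<cdot> (snd_c \<cdot> v 1 Nat) \<cdot> ?l \<cdot> v 0 Nat)"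
    by (rule sat_ind) (use assms in \<open>simp_all del: Rc_Succ Rc_Zero add: snds_su\<close>)
  then show ?thesis using assms by (simp del: Rc_Succ Rc_Zero)
qed

lemma snds_tail:
  assumes "i \<in> N" "n \<in> N" "h \<in> D (Nat \<rightarrow>\<^sub>t Nat)" "lt i n"
  shows "cl fst_c \<bullet> snds (cl tail_c \<bullet> n \<bullet> h) i = h \<bullet> i"
proof -
  let ?l = "\<^bold>\<lambda>2:Nat. \<^bold>\<lambda>3:Nat. snd_c \<cdot> v 2 Nat" and ?h = "(2, Nat \<rightarrow>\<^sub>t Nat)"
  \<comment> \<open>Length and sequence are quantified inside the formula, since the step from
    \<open>i\<close> to \<open>i + 1\<close> replaces them by the predecessor and by
    \<open>shift h\<close>.\<close>
  let ?F = "Forall (1,Nat) (Forall ?h (monus_c \<cdot> (Succ \<cdot> v 0 Nat) \<cdot> v 1 Nat \<^bold>= Zero \<^bold>\<longrightarrow>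
     fst_c \<cdot> (Rc Nat \<cdot> (tail_c \<cdot> v 1 Nat \<cdot> Var ?h) \<cdot> ?l \<cdot> v 0 Nat) \<^bold>= Var ?h \<cdot> v 0 Nat))"
  have "eval e ?l = cl ?l" for e by (rule eval_closed) simp
  note [simp] = this snds_def[symmetric]
  have F: "sat (e0((0,Nat) := i)) ?F \<longleftrightarrow> (\<forall>n\<in>N. \<forall>h \<in> D (Nat \<rightarrow>\<^sub>t Nat). lt i n \<longrightarrow>
     cl fst_c \<bullet> snds (cl tail_c \<bullet> n \<bullet> h) i = h \<bullet> i)" for i by simp
  have "sat (e0((0,Nat) := i)) ?F"
  proof (rule sat_ind)
    show "sat (e0((0,Nat) := ze)) ?F" unfolding F
    proof (intro ballI impI)
      fix n h assume *: "n \<in> N" "h \<in> D (Nat \<rightarrow>\<^sub>t Nat)" "lt ze n"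
      show "cl fst_c \<bullet> snds (cl tail_c \<bullet> n \<bullet> h) ze = h \<bullet> ze"
        using *(1) by (cases rule: nat_cases) (use * in simp_all)
    qed
  next
    fix i assume i: "i \<in> N" and IH: "sat (e0((0,Nat) := i)) ?F"
    show "sat (e0((0,Nat) := su i)) ?F" unfolding F
    proof (intro ballI impI)
      fix n h assume *: "n \<in> N" "h \<in> D (Nat \<rightarrow>\<^sub>t Nat)" "lt (su i) n"
      show "cl fst_c \<bullet> snds (cl tail_c \<bullet> n \<bullet> h) (su i) = h \<bullet> (su i)"
        using *(1)
      proof (cases rule: nat_cases)
        case (2 m)
        have "cl fst_c \<bullet> snds (cl tail_c \<bullet> m \<bullet> shift h) i = shift h \<bullet> i"
          using IH[unfolded F, rule_format, of m "shift h"] 2 * i by simp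
        then show ?thesis using 2 * i by simp
      qed (use * i in simp_all)
    qed
  qed (use assms in simp_all)
  then show ?thesis using F assms by blast
qed

abbreviation len where "len \<sigma> y \<equiv> cl (len_c \<sigma>) \<bullet> y"
abbreviation proj where "proj \<sigma> y i \<equiv> cl (proj_c \<sigma>) \<bullet> y \<bullet> i"
abbreviation seq where "seq \<sigma> n h \<equiv> cl (seq_c \<sigma>) \<bullet> n \<bullet> h"

lemma proj_Nat: "y \<in> N \<Longrightarrow> i \<in> N \<Longrightarrow> proj Nat y i = cl fst_c \<bullet> snds (cl snd_c \<bullet> y) i"
proof -
  assume *: "y \<in> N" "i \<in> N"
  let ?l = "\<^bold>\<lambda>2:Nat. \<^bold>\<lambda>3:Nat. snd_c \<cdot> v 2 Nat"
  have "eval e ?l = cl ?l" for e by (rule eval_closed) simp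
  with * show ?thesis by (simp add: cl_eq[OF proj_c_Nat] snds_def)
qed

text \<open>By induction on the type. At a function type every value of the code is itself a code of
  the sequence of values, always of length \<open>n\<close>; so the length may be read at the zero
  argument, and extensionality reassembles the components.\<close>

lemma seq_correct:
  "n \<in> N \<Longrightarrow> h \<in> D (Nat \<rightarrow>\<^sub>t \<sigma>) \<Longrightarrow>
    len \<sigma> (seq \<sigma> n h) = n \<and> (\<forall>i\<in>N. lt i n \<longrightarrow> proj \<sigma> (seq \<sigma> n h) i = h \<bullet> i)"
proof (induction \<sigma> arbitrary: n h)
  case Nat
  then show ?case by (simp add: proj_Nat snds_tail cl_eq[OF seq_c_Nat] len_c_Nat)
next
  case (Fn \<sigma> \<tau>)
  define h' where "h' s = eval (e0((1, Nat \<rightarrow>\<^sub>t \<sigma> \<rightarrow>\<^sub>t \<tau>) := h, (2,\<sigma>) := s))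
    (\<^bold>\<lambda>3:Nat. v 1 (Nat \<rightarrow>\<^sub>t \<sigma> \<rightarrow>\<^sub>t \<tau>) \<cdot> v 3 Nat \<cdot> v 2 \<sigma>)" for s
  have seq: "seq (\<sigma> \<rightarrow>\<^sub>t \<tau>) n h \<bullet> s = seq \<tau> n (h' s)" if "s \<in> D \<sigma>" for s
  proof -
    have "eval e (\<^bold>\<lambda>3:Nat. v 1 (Nat \<rightarrow>\<^sub>t \<sigma> \<rightarrow>\<^sub>t \<tau>) \<cdot> v 3 Nat \<cdot> v 2 \<sigma>) = h' s"
      if "e (1, Nat \<rightarrow>\<^sub>t \<sigma> \<rightarrow>\<^sub>t \<tau>) = h" "e (2,\<sigma>) = s" for e
      unfolding h'_def by (rule eval_cong) (use that in auto)
    then show ?thesis using that Fn.prems by (simp add: cl_eq[OF seq_c_Fn])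
  qed
  have h: "h' s \<in> D (Nat \<rightarrow>\<^sub>t \<tau>)" and h': "\<And>i. i \<in> N \<Longrightarrow> h' s \<bullet> i = h \<bullet> i \<bullet> s" if "s \<in> D \<sigma>" for s
    using that Fn.prems by (simp_all add: h'_def)
  have "proj (\<sigma> \<rightarrow>\<^sub>t \<tau>) (seq (\<sigma> \<rightarrow>\<^sub>t \<tau>) n h) i = h \<bullet> i" if "i \<in> N" "lt i n" for i
  proof (rule ext)
    fix s assume s: "s \<in> D \<sigma>"
    have "proj (\<sigma> \<rightarrow>\<^sub>t \<tau>) (seq (\<sigma> \<rightarrow>\<^sub>t \<tau>) n h) i \<bullet> s = proj \<tau> (seq (\<sigma> \<rightarrow>\<^sub>t \<tau>) n h \<bullet> s) i"
      using that s Fn.prems by (simp add: cl_eq[OF proj_c_Fn])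
    then show "proj (\<sigma> \<rightarrow>\<^sub>t \<tau>) (seq (\<sigma> \<rightarrow>\<^sub>t \<tau>) n h) i \<bullet> s = h \<bullet> i \<bullet> s"
      using Fn.IH(2)[OF Fn.prems(1) h[OF s]] that seq[OF s] h' s Fn.prems by simp
  qed (use that Fn.prems in simp_all)
  moreover have "len (\<sigma> \<rightarrow>\<^sub>t \<tau>) (seq (\<sigma> \<rightarrow>\<^sub>t \<tau>) n h) = len \<tau> (seq (\<sigma> \<rightarrow>\<^sub>t \<tau>) n h \<bullet> zr \<sigma>)"
    using Fn.prems by (simp add: cl_eq[OF len_c_Fn])
  ultimately show ?case using Fn.IH(2)[OF Fn.prems(1) h[of "zr \<sigma>"]] seq[of "zr \<sigma>"] by simp
qed

lemma len_seq [simp]: "n \<in> N \<Longrightarrow> h \<in> D (Nat \<rightarrow>\<^sub>t \<sigma>) \<Longrightarrow> len \<sigma> (seq \<sigma> n h) = n"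
  and proj_seq [simp]: "n \<in> N \<Longrightarrow> h \<in> D (Nat \<rightarrow>\<^sub>t \<sigma>) \<Longrightarrow> i \<in> N \<Longrightarrow> lt i n \<Longrightarrow> proj \<sigma> (seq \<sigma> n h) i = h \<bullet> i"
  using seq_correct by blast+

definition memM :: "ty \<Rightarrow> 'a \<Rightarrow> 'a \<Rightarrow> bool" where
  "memM \<sigma> a y \<longleftrightarrow> (\<exists>i\<in>N. lt i (len \<sigma> y) \<and> a = proj \<sigma> y i)"

lemma sat_mem [simp]:
  assumes "env e" "wt s" "wt t" shows "sat e (mem s t) \<longleftrightarrow> memM (tyof t) (eval e s) (eval e t)"
proof -
  let ?i = "LEAST n. (n, Nat) \<notin> fvt s \<union> fvt t"
  have "finite (fst ` (fvt s \<union> fvt t))" by simp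
  then obtain n where "n \<notin> fst ` (fvt s \<union> fvt t)"
    using ex_new_if_finite[OF infinite_UNIV_nat] by blast
  then have "(n, Nat) \<notin> fvt s \<union> fvt t" by force
  then have i: "(?i, Nat) \<notin> fvt s \<union> fvt t" by (rule LeastI)
  then show ?thesis using assms by (simp add: mem_def memM_def Let_def le_def)
qed

lemma memM_seq: "n \<in> N \<Longrightarrow> h \<in> D (Nat \<rightarrow>\<^sub>t \<sigma>) \<Longrightarrow> i \<in> N \<Longrightarrow> lt i n \<Longrightarrow> memM \<sigma> (h \<bullet> i) (seq \<sigma> n h)"
  unfolding memM_def by (intro bexI[of _ i]) auto

lemma memM_cat:
  assumes "a \<in> D \<sigma>" "b \<in> D \<sigma>" "memM \<sigma> c a \<or> memM \<sigma> c b" shows "memM \<sigma> c (cl (cat_c \<sigma>) \<bullet> a \<bullet> b)"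
proof -
  let ?m = "len \<sigma> a" and ?n = "len \<sigma> b"
  let ?e = "e0((0,\<sigma>) := a, (1,\<sigma>) := b)"
  let ?t = "cond_c \<sigma> \<cdot> (monus_c \<cdot> (Succ \<cdot> v 2 Nat) \<cdot> (len_c \<sigma> \<cdot> v 0 \<sigma>))
           \<cdot> (proj_c \<sigma> \<cdot> v 0 \<sigma> \<cdot> v 2 Nat)
           \<cdot> (proj_c \<sigma> \<cdot> v 1 \<sigma> \<cdot> (monus_c \<cdot> v 2 Nat \<cdot> (len_c \<sigma> \<cdot> v 0 \<sigma>)))"
  let ?h = "eval ?e (\<^bold>\<lambda>2:Nat. ?t)"
  have eq: "cl (cat_c \<sigma>) \<bullet> a \<bullet> b = seq \<sigma> (add ?m ?n) ?h"
    using assms by (simp add: cl_eq[OF cat_c_def] Let_def)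
  have h: "?h \<bullet> i = cl (cond_c \<sigma>) \<bullet> sub (su i) ?m \<bullet> proj \<sigma> a i \<bullet> proj \<sigma> b (sub i ?m)" if "i \<in> N" for i
    using assms that by simp
  have hD: "?h \<in> D (Nat \<rightarrow>\<^sub>t \<sigma>)" using assms by simp
  from assms(3) show ?thesis
  proof
    assume "memM \<sigma> c a"
    then obtain i where i: "i \<in> N" "lt i ?m" "c = proj \<sigma> a i" unfolding memM_def by blast
    obtain k where k: "k \<in> N" "?m = add (su i) k"
      by (rule sub_eq_ze[of "su i" "?m"]) (use i assms in auto)
    have "lt i (add ?m ?n)" using k i assms by (simp add: add_assoc del: add_sul)
    then have "memM \<sigma> (?h \<bullet> i) (cl (cat_c \<sigma>) \<bullet> a \<bullet> b)"
      unfolding eq using assms i hD by (intro memM_seq) auto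
    then show ?thesis using i assms h by simp
  next
    assume "memM \<sigma> c b"
    then obtain j where j: "j \<in> N" "lt j ?n" "c = proj \<sigma> b j" unfolding memM_def by blast
    obtain k where k: "k \<in> N" "?n = add (su j) k"
      by (rule sub_eq_ze[of "su j" "?n"]) (use j assms in auto)
    have "add ?m ?n = add (su (add ?m j)) k"
      using k j assms by (simp add: add_assoc)
    then have "lt (add ?m j) (add ?m ?n)" using k j assms by (simp del: add_sul add_su)
    then have "memM \<sigma> (?h \<bullet> add ?m j) (cl (cat_c \<sigma>) \<bullet> a \<bullet> b)"
      unfolding eq using assms j hD by (intro memM_seq) auto
    \<comment> \<open>The test of \<open>cond_c\<close> is a successor at index
      \<open>m + j\<close>, so the second sequence is selected there, and subtracting
      \<open>m\<close> recovers its index \<open>j\<close>.\<close>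
    moreover have "sub (su (add ?m j)) ?m = su j" using sub_add[of ?m "su j"] add_su[of ?m j] j assms by (simp del: sub_add)
    ultimately show ?thesis using j assms h[of "add ?m j"] by simp
  qed
qed

lemma memM_D: "memM \<sigma> a y \<Longrightarrow> y \<in> D \<sigma> \<Longrightarrow> ok a \<and> tp a = \<sigma>"
  unfolding memM_def by auto

text \<open>Adding the junk element \<open>zr \<sigma>\<close> keeps every response set nonempty.\<close>

definition set_of :: "ty \<Rightarrow> 'a \<Rightarrow> 'a set" where
  "set_of \<sigma> y = insert (zr \<sigma>) {a. memM \<sigma> a y}"

lemma zr_set_of [simp]: "zr \<sigma> \<in> set_of \<sigma> y"
  by (simp add: set_of_def)

lemma set_of_D: "a \<in> set_of \<sigma> y \<Longrightarrow> y \<in> D \<sigma> \<Longrightarrow> ok a \<and> tp a = \<sigma>"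
  by (auto simp: set_of_def memM_D)

end

section \<open>Operations on lists of responses\<close>

definition sing_c :: "ty \<Rightarrow> tm" where
  "sing_c \<sigma> = (\<^bold>\<lambda>0:\<sigma>. seq_c \<sigma> \<cdot> (Succ \<cdot> Zero) \<cdot> (\<^bold>\<lambda>1:Nat. v 0 \<sigma>))"

lemma sing_c [simp]: "wt (sing_c \<sigma>)" "tyof (sing_c \<sigma>) = \<sigma> \<rightarrow>\<^sub>t \<sigma>" "fvt (sing_c \<sigma>) = {}"
  by (auto simp: sing_c_def)

text \<open>The recursion starts with the value of the function at zero instead of the empty list,
  because \<open>set_of\<close> counts zero as a member of every list.\<close>

definition iter_c :: "ty \<Rightarrow> ty \<Rightarrow> tm" where
  "iter_c \<sigma> \<tau> = (\<^bold>\<lambda>0:\<sigma> \<rightarrow>\<^sub>t \<tau>. \<^bold>\<lambda>1:\<sigma>. Rc \<tau> \<cdot> (v 0 (\<sigma> \<rightarrow>\<^sub>t \<tau>) \<cdot> zero_c \<sigma>) \<cdot>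
     (\<^bold>\<lambda>2:\<tau>. \<^bold>\<lambda>3:Nat. cat_c \<tau> \<cdot> v 2 \<tau> \<cdot> (v 0 (\<sigma> \<rightarrow>\<^sub>t \<tau>) \<cdot> (proj_c \<sigma> \<cdot> v 1 \<sigma> \<cdot> v 3 Nat))))"

definition bind_c :: "ty \<Rightarrow> ty \<Rightarrow> tm" where
  "bind_c \<sigma> \<tau> = (\<^bold>\<lambda>0:\<sigma> \<rightarrow>\<^sub>t \<tau>. \<^bold>\<lambda>1:\<sigma>. iter_c \<sigma> \<tau> \<cdot> v 0 (\<sigma> \<rightarrow>\<^sub>t \<tau>) \<cdot> v 1 \<sigma> \<cdot> (len_c \<sigma> \<cdot> v 1 \<sigma>))"

lemma iter_c [simp]: "wt (iter_c \<sigma> \<tau>)" "tyof (iter_c \<sigma> \<tau>) = (\<sigma> \<rightarrow>\<^sub>t \<tau>) \<rightarrow>\<^sub>t \<sigma> \<rightarrow>\<^sub>t Nat \<rightarrow>\<^sub>t \<tau>" "fvt (iter_c \<sigma> \<tau>) = {}"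
  by (auto simp: iter_c_def)

lemma bind_c [simp]: "wt (bind_c \<sigma> \<tau>)" "tyof (bind_c \<sigma> \<tau>) = (\<sigma> \<rightarrow>\<^sub>t \<tau>) \<rightarrow>\<^sub>t \<sigma> \<rightarrow>\<^sub>t \<tau>" "fvt (bind_c \<sigma> \<tau>) = {}"
  by (auto simp: bind_c_def)

text \<open>The list \<open>0, ..., n\<close>; it is needed for the downward closure of
  standardness.\<close>

definition down_c :: tm where
  "down_c = (\<^bold>\<lambda>0:Nat. seq_c Nat \<cdot> (Succ \<cdot> v 0 Nat) \<cdot> (\<^bold>\<lambda>1:Nat. v 1 Nat))"

lemma down_c [simp]: "wt down_c" "tyof down_c = Nat \<rightarrow>\<^sub>t Nat" "fvt down_c = {}"
  by (auto simp: down_c_def)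

context model
begin

lemma eval_list_consts [simp]: "eval e (sing_c \<sigma>) = cl (sing_c \<sigma>)"
  "eval e (iter_c \<sigma> \<tau>) = cl (iter_c \<sigma> \<tau>)" "eval e (bind_c \<sigma> \<tau>) = cl (bind_c \<sigma> \<tau>)"
  "eval e down_c = cl down_c"
  by (simp_all add: eval_closed)

lemma memM_sing: "a \<in> D \<sigma> \<Longrightarrow> memM \<sigma> a (cl (sing_c \<sigma>) \<bullet> a)"
  using memM_seq[of "su ze" "eval (e0((0,\<sigma>) := a)) (\<^bold>\<lambda>1:Nat. v 0 \<sigma>)" \<sigma> ze]
  by (simp add: cl_eq[OF sing_c_def])

lemma set_sing: "a \<in> D \<sigma> \<Longrightarrow> a \<in> set_of \<sigma> (cl (sing_c \<sigma>) \<bullet> a)"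
  by (simp add: set_of_def memM_sing)

lemma set_cat:
  "a \<in> D \<sigma> \<Longrightarrow> b \<in> D \<sigma> \<Longrightarrow> c \<in> set_of \<sigma> a \<or> c \<in> set_of \<sigma> b \<Longrightarrow> c \<in> set_of \<sigma> (cl (cat_c \<sigma>) \<bullet> a \<bullet> b)"
  unfolding set_of_def using memM_cat by auto

lemma set_down:
  assumes "a \<in> N" "b \<in> N" "sub a b = ze" shows "a \<in> set_of Nat (cl down_c \<bullet> b)"
  using memM_seq[of "su b" "eval (e0((0,Nat) := b)) (\<^bold>\<lambda>1:Nat. v 1 Nat)" Nat a] assms
  by (simp add: cl_eq[OF down_c_def] set_of_def)

lemma iter_simps:
  assumes "f \<in> D (\<sigma> \<rightarrow>\<^sub>t \<tau>)" "y \<in> D \<sigma>"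
  shows "cl (iter_c \<sigma> \<tau>) \<bullet> f \<bullet> y \<bullet> ze = f \<bullet> zr \<sigma>"
    and "n \<in> N \<Longrightarrow> cl (iter_c \<sigma> \<tau>) \<bullet> f \<bullet> y \<bullet> su n =
      cl (cat_c \<tau>) \<bullet> (cl (iter_c \<sigma> \<tau>) \<bullet> f \<bullet> y \<bullet> n) \<bullet> (f \<bullet> proj \<sigma> y n)"
  using assms by (simp_all add: cl_eq[OF iter_c_def])

lemma set_bind:
  assumes f: "f \<in> D (\<sigma> \<rightarrow>\<^sub>t \<tau>)" and y: "y \<in> D \<sigma>" and a: "a \<in> set_of \<sigma> y" and b: "b \<in> set_of \<tau> (f \<bullet> a)"
  shows "b \<in> set_of \<tau> (cl (bind_c \<sigma> \<tau>) \<bullet> f \<bullet> y)"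
proof (cases "b = zr \<tau>")
  case False
  have bD: "b \<in> D \<tau>" using set_of_D[OF b] set_of_D[OF a] f y by simp
  let ?e = "e0((1,\<tau>) := b, (2,\<sigma> \<rightarrow>\<^sub>t \<tau>) := f, (3,\<sigma>) := y)"
  let ?f = "v 2 (\<sigma> \<rightarrow>\<^sub>t \<tau>)" and ?y = "v 3 \<sigma>" and ?b = "v 1 \<tau>"
  \<comment> \<open>The length of \<open>y\<close> may be nonstandard, so membership in the partial
    concatenations is proved by internal induction with \<open>b\<close>, \<open>f\<close> and
    \<open>y\<close> as parameters.\<close>
  let ?F = "mem ?b (?f \<cdot> zero_c \<sigma>) \<^bold>\<or> Exists (4,Nat) (le (Succ \<cdot> v 4 Nat) (v 0 Nat) \<^bold>\<and>
     mem ?b (?f \<cdot> (proj_c \<sigma> \<cdot> ?y \<cdot> v 4 Nat))) \<^bold>\<longrightarrow> mem ?b (iter_c \<sigma> \<tau> \<cdot> ?f \<cdot> ?y \<cdot> v 0 Nat)"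
  have wf: "wff ?F" "internal ?F" by (auto simp: mem_def Let_def le_def)
  have F: "sat (?e((0,Nat) := n)) ?F \<longleftrightarrow> (memM \<tau> b (f \<bullet> zr \<sigma>) \<or> (\<exists>i\<in>N. lt i n \<and> memM \<tau> b (f \<bullet> proj \<sigma> y i))
     \<longrightarrow> memM \<tau> b (cl (iter_c \<sigma> \<tau>) \<bullet> f \<bullet> y \<bullet> n))" if "n \<in> N" for n
    using that f y bD by (simp add: le_def)
  have *: "sat (?e((0,Nat) := len \<sigma> y)) ?F"
  proof (rule sat_ind[OF wf(2) wf(1)])
    show "sat (?e((0,Nat) := ze)) ?F"
      using f y by (subst F) (auto simp: iter_simps)
  next
    fix n assume n: "n \<in> N" and IH: "sat (?e((0,Nat) := n)) ?F"
    show "sat (?e((0,Nat) := su n)) ?F"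
    proof (subst F; (intro impI)?)
      assume *: "memM \<tau> b (f \<bullet> zr \<sigma>) \<or> (\<exists>i\<in>N. lt i (su n) \<and> memM \<tau> b (f \<bullet> proj \<sigma> y i))"
      then have "memM \<tau> b (cl (iter_c \<sigma> \<tau>) \<bullet> f \<bullet> y \<bullet> n) \<or> memM \<tau> b (f \<bullet> proj \<sigma> y n)"
        using IH[unfolded F[OF n]] lt_su[OF _ n] by blast
      then show "memM \<tau> b (cl (iter_c \<sigma> \<tau>) \<bullet> f \<bullet> y \<bullet> su n)"
        using n f y by (simp add: iter_simps memM_cat)
    qed (use n in simp)
  qed (use f y bD in auto)
  have len: "len \<sigma> y \<in> N" using y by simp
  have bb: "memM \<tau> b (f \<bullet> a)" using b False by (simp add: set_of_def)
  have "memM \<tau> b (f \<bullet> zr \<sigma>) \<or> (\<exists>i\<in>N. lt i (len \<sigma> y) \<and> memM \<tau> b (f \<bullet> proj \<sigma> y i))"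
    using a bb unfolding set_of_def memM_def[of \<sigma>] by auto
  then have "memM \<tau> b (cl (iter_c \<sigma> \<tau>) \<bullet> f \<bullet> y \<bullet> len \<sigma> y)"
    using *[unfolded F[OF len]] by blast
  then show ?thesis using f y by (simp add: cl_eq[OF bind_c_def] set_of_def)
qed simp

text \<open>For choice: a single list-valued function \<open>f\<close>, offered as the one-element
  sequence, already gives \<open>Y[a]\<close> all members of \<open>f a\<close>.\<close>

lemma memM_sapp_sing:
  assumes "f \<in> D (\<sigma> \<rightarrow>\<^sub>t \<tau>)" "a \<in> D \<sigma>" "memM \<tau> b (f \<bullet> a)"
  shows "memM \<tau> b (cl (sapp_c \<sigma> \<tau>) \<bullet> (cl (sing_c (\<sigma> \<rightarrow>\<^sub>t \<tau>)) \<bullet> f) \<bullet> a)"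
proof -
  let ?W = "cl (sing_c (\<sigma> \<rightarrow>\<^sub>t \<tau>)) \<bullet> f"
  have W: "len (\<sigma> \<rightarrow>\<^sub>t \<tau>) ?W = su ze" "proj (\<sigma> \<rightarrow>\<^sub>t \<tau>) ?W ze = f"
    using assms by (simp_all add: cl_eq[OF sing_c_def])
  have "cl (sapp_c \<sigma> \<tau>) \<bullet> ?W \<bullet> a = cl (cat_c \<tau>) \<bullet> cl (empty_c \<tau>) \<bullet> (f \<bullet> a)"
    using assms by (simp add: cl_eq[OF sapp_c_def] W)
  then show ?thesis using memM_cat[of "cl (empty_c \<tau>)" \<tau> "f \<bullet> a" b] assms by simp
qed

end

section \<open>Propositional completeness\<close>

text \<open>Instantiated both with the theorems of the internal calculus and with the realized
  formulas. Only falsity and implication are interpreted; every other formula behaves as a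
  propositional atom.\<close>

locale hilbert =
  fixes L :: "fm set" and V :: "fm set"
  assumes Bot_L: "Bot \<in> L"
    and Imp_L: "(a \<^bold>\<longrightarrow> b) \<in> L \<longleftrightarrow> a \<in> L \<and> b \<in> L"
    and V_L: "V \<subseteq> L"
    and V_K: "a \<in> L \<Longrightarrow> b \<in> L \<Longrightarrow> (a \<^bold>\<longrightarrow> b \<^bold>\<longrightarrow> a) \<in> V"
    and V_S: "a \<in> L \<Longrightarrow> b \<in> L \<Longrightarrow> c \<in> L \<Longrightarrow> ((a \<^bold>\<longrightarrow> b \<^bold>\<longrightarrow> c) \<^bold>\<longrightarrow> (a \<^bold>\<longrightarrow> b) \<^bold>\<longrightarrow> a \<^bold>\<longrightarrow> c) \<in> V"
    and V_DN: "a \<in> L \<Longrightarrow> (Neg (Neg a) \<^bold>\<longrightarrow> a) \<in> V"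
    and V_mp: "(a \<^bold>\<longrightarrow> b) \<in> V \<Longrightarrow> a \<in> V \<Longrightarrow> b \<in> V"
begin

definition theory_set :: "fm set \<Rightarrow> bool" where
  "theory_set X \<longleftrightarrow> V \<subseteq> X \<and> X \<subseteq> L \<and> (\<forall>a b. (a \<^bold>\<longrightarrow> b) \<in> X \<longrightarrow> a \<in> X \<longrightarrow> b \<in> X)"

lemma theory_setD:
  assumes "theory_set X"
  shows "V \<subseteq> X" "X \<subseteq> L" "(a \<^bold>\<longrightarrow> b) \<in> X \<Longrightarrow> a \<in> X \<Longrightarrow> b \<in> X"
  using assms unfolding theory_set_def by blast+

lemma theory_set_extend:
  assumes X: "theory_set X" and a: "a \<in> L"
  shows "theory_set {b. (a \<^bold>\<longrightarrow> b) \<in> X}" "X \<subseteq> {b. (a \<^bold>\<longrightarrow> b) \<in> X}" "(a \<^bold>\<longrightarrow> a) \<in> X"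
proof -
  have K: "(a \<^bold>\<longrightarrow> b) \<in> X" if "b \<in> X" for b
    using theory_setD[OF X] V_K[of b a] a that by blast
  show "X \<subseteq> {b. (a \<^bold>\<longrightarrow> b) \<in> X}" using K by blast
  have "(a \<^bold>\<longrightarrow> c) \<in> X" if "(a \<^bold>\<longrightarrow> b \<^bold>\<longrightarrow> c) \<in> X" "(a \<^bold>\<longrightarrow> b) \<in> X" for b c
    using theory_setD[OF X] V_S[of a b c] Imp_L that by blast
  then show "theory_set {b. (a \<^bold>\<longrightarrow> b) \<in> X}"
    using K theory_setD[OF X] Imp_L unfolding theory_set_def by blast
  have "((a \<^bold>\<longrightarrow> (a \<^bold>\<longrightarrow> a) \<^bold>\<longrightarrow> a) \<^bold>\<longrightarrow> (a \<^bold>\<longrightarrow> a \<^bold>\<longrightarrow> a) \<^bold>\<longrightarrow> a \<^bold>\<longrightarrow> a) \<in> V"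
    "(a \<^bold>\<longrightarrow> (a \<^bold>\<longrightarrow> a) \<^bold>\<longrightarrow> a) \<in> V" "(a \<^bold>\<longrightarrow> a \<^bold>\<longrightarrow> a) \<in> V"
    using V_S[of a "a \<^bold>\<longrightarrow> a" a] V_K[of a "a \<^bold>\<longrightarrow> a"] V_K[of a a] a Imp_L by blast+
  then show "(a \<^bold>\<longrightarrow> a) \<in> X" using theory_setD(1)[OF X] V_mp by blast
qed

text \<open>Membership in a maximal consistent theory is a Boolean valuation, so every propositional
  consequence of \<open>V\<close> lies in \<open>V\<close>.\<close>

theorem taut:
  assumes "\<phi> \<in> L"
    and val: "\<And>h. \<not> h Bot \<Longrightarrow> (\<And>a b. a \<in> L \<Longrightarrow> b \<in> L \<Longrightarrow> h (a \<^bold>\<longrightarrow> b) = (h a \<longrightarrow> h b))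
      \<Longrightarrow> (\<And>a. a \<in> V \<Longrightarrow> h a) \<Longrightarrow> h \<phi>"
  shows "\<phi> \<in> V"
proof (rule ccontr)
  assume nV: "\<phi> \<notin> V"
  have thV: "theory_set V" using V_L V_mp unfolding theory_set_def by blast
  have nL: "Neg \<phi> \<in> L" using assms(1) Bot_L Imp_L by blast
  define A where "A = {X. theory_set X \<and> Bot \<notin> X}"
  \<comment> \<open>The consequences of \<open>Neg \<phi>\<close>. They do not contain
    \<open>Bot\<close>, since otherwise double negation elimination would put \<open>\<phi>\<close>
    into \<open>V\<close>.\<close>
  define X0 where "X0 = {b. (Neg \<phi> \<^bold>\<longrightarrow> b) \<in> V}"
  have "Bot \<notin> X0" using V_DN[OF assms(1)] V_mp nV unfolding X0_def by blast
  then have X0: "X0 \<in> A" using theory_set_extend[OF thV nL] unfolding A_def X0_def by blast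
  have "\<exists>M\<in>{X \<in> A. X0 \<subseteq> X}. \<forall>X\<in>{X \<in> A. X0 \<subseteq> X}. M \<subseteq> X \<longrightarrow> X = M"
  proof (rule subset_Zorn_nonempty)
    show "{X \<in> A. X0 \<subseteq> X} \<noteq> {}" using X0 by blast
  next
    fix C assume C: "C \<noteq> {}" "subset.chain {X \<in> A. X0 \<subseteq> X} C"
    then have th: "theory_set X" "Bot \<notin> X" "X0 \<subseteq> X" if "X \<in> C" for X
      using that unfolding subset_chain_def A_def by blast+
    have "b \<in> \<Union>C" if ab: "(a \<^bold>\<longrightarrow> b) \<in> \<Union>C" "a \<in> \<Union>C" for a b
    proof -
      obtain X Y where XY: "X \<in> C" "Y \<in> C" "(a \<^bold>\<longrightarrow> b) \<in> X" "a \<in> Y" using ab by blast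
      then have "X \<subseteq> Y \<or> Y \<subseteq> X" using C unfolding subset_chain_def by blast
      then show ?thesis using XY theory_setD(3)[OF th(1)] by blast
    qed
    then have "theory_set (\<Union>C)" using C(1) theory_setD(1,2)[OF th(1)] unfolding theory_set_def by blast
    then show "\<Union>C \<in> {X \<in> A. X0 \<subseteq> X}" using th C(1) unfolding A_def by blast
  qed
  then obtain M where "M \<in> {X \<in> A. X0 \<subseteq> X}" "\<forall>X\<in>{X \<in> A. X0 \<subseteq> X}. M \<subseteq> X \<longrightarrow> X = M" by blast
  then obtain M where M: "theory_set M" "Bot \<notin> M" "X0 \<subseteq> M"
    and max: "\<And>X. theory_set X \<Longrightarrow> Bot \<notin> X \<Longrightarrow> M \<subseteq> X \<Longrightarrow> X = M"
    unfolding A_def by simp (metis order.trans)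
  note M' = theory_setD[OF M(1)]
  have neg: "Neg a \<in> M" if "a \<in> L" "a \<notin> M" for a
  proof (rule ccontr)
    assume "Neg a \<notin> M"
    \<comment> \<open>Without \<open>Neg a\<close> the theory generated by \<open>M\<close> and
      \<open>a\<close> is consistent, so it equals \<open>M\<close> by maximality, although it
      contains \<open>a\<close>.\<close>
    then have "{b. (a \<^bold>\<longrightarrow> b) \<in> M} = M"
      using max[of "{b. (a \<^bold>\<longrightarrow> b) \<in> M}"] theory_set_extend[OF M(1) that(1)] by blast
    then show False using theory_set_extend(3)[OF M(1) that(1)] that(2) by blast
  qed
  have EFQ: "b \<in> {b. (a \<^bold>\<longrightarrow> b) \<in> M}" if "Neg a \<in> M" "b \<in> L" for a b
  proof -
    have a: "a \<in> L" using that M'(2) Imp_L by blast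
    note E = theory_setD[OF theory_set_extend(1)[OF M(1) a]]
    \<comment> \<open>Ex falso is no assumption of the locale: \<open>V_K\<close> yields the double
      negation of \<open>b\<close> from \<open>Bot\<close>, and \<open>V_DN\<close> removes
      it.\<close>
    have "(Bot \<^bold>\<longrightarrow> Neg b \<^bold>\<longrightarrow> Bot) \<in> V" using V_K[of Bot "Neg b"] Bot_L that(2) Imp_L by blast
    moreover have "(Neg (Neg b) \<^bold>\<longrightarrow> b) \<in> V" using V_DN[OF that(2)] .
    moreover have "Bot \<in> {b. (a \<^bold>\<longrightarrow> b) \<in> M}" using that by blast
    ultimately show ?thesis using E(1,3) by blast
  qed
  have "\<phi> \<in> M"
  proof (rule val[of "\<lambda>a. a \<in> M"])
    fix a b assume ab: "a \<in> L" "b \<in> L"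
    have "(a \<^bold>\<longrightarrow> b) \<in> M" if "b \<in> M"
      using M' V_K[OF ab(2,1)] that by blast
    then show "((a \<^bold>\<longrightarrow> b) \<in> M) = (a \<in> M \<longrightarrow> b \<in> M)"
      using M'(3) neg[OF ab(1)] EFQ[of a b] ab by blast
  qed (use M M' in auto)
  moreover have "Neg \<phi> \<in> M" using theory_set_extend(3)[OF thV nL] M(3) unfolding X0_def by blast
  ultimately show False using M'(3) M(2) by blast
qed

end

section \<open>The interpretation\<close>

text \<open>The product of two types, coded by a type. Its codes are pairs only up to projections.\<close>

fun pr :: "ty \<Rightarrow> ty \<Rightarrow> ty" where
  "pr (\<sigma> \<rightarrow>\<^sub>t \<tau>) \<rho> = \<sigma> \<rightarrow>\<^sub>t pr \<tau> \<rho>"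
| "pr Nat (\<sigma> \<rightarrow>\<^sub>t \<tau>) = \<sigma> \<rightarrow>\<^sub>t pr Nat \<tau>"
| "pr Nat Nat = Nat \<rightarrow>\<^sub>t Nat"

text \<open>The pair collects the arguments of both components and finally takes a number selecting
  between them. A projection therefore feeds zero functionals for the arguments of the other
  component.\<close>

fun mk_c :: "ty \<Rightarrow> ty \<Rightarrow> tm" where
  "mk_c (\<sigma> \<rightarrow>\<^sub>t \<tau>) \<rho> = (\<^bold>\<lambda>0:\<sigma> \<rightarrow>\<^sub>t \<tau>. \<^bold>\<lambda>1:\<rho>. \<^bold>\<lambda>2:\<sigma>. mk_c \<tau> \<rho> \<cdot> (v 0 (\<sigma> \<rightarrow>\<^sub>t \<tau>) \<cdot> v 2 \<sigma>) \<cdot> v 1 \<rho>)"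
| "mk_c Nat (\<sigma> \<rightarrow>\<^sub>t \<tau>) = (\<^bold>\<lambda>0:Nat. \<^bold>\<lambda>1:\<sigma> \<rightarrow>\<^sub>t \<tau>. \<^bold>\<lambda>2:\<sigma>. mk_c Nat \<tau> \<cdot> v 0 Nat \<cdot> (v 1 (\<sigma> \<rightarrow>\<^sub>t \<tau>) \<cdot> v 2 \<sigma>))"
| "mk_c Nat Nat = (\<^bold>\<lambda>0:Nat. \<^bold>\<lambda>1:Nat. \<^bold>\<lambda>2:Nat. cond_c Nat \<cdot> v 2 Nat \<cdot> v 0 Nat \<cdot> v 1 Nat)"

fun fs_c :: "ty \<Rightarrow> ty \<Rightarrow> tm" where
  "fs_c (\<sigma> \<rightarrow>\<^sub>t \<tau>) \<rho> = (\<^bold>\<lambda>0:\<sigma> \<rightarrow>\<^sub>t pr \<tau> \<rho>. \<^bold>\<lambda>1:\<sigma>. fs_c \<tau> \<rho> \<cdot> (v 0 (\<sigma> \<rightarrow>\<^sub>t pr \<tau> \<rho>) \<cdot> v 1 \<sigma>))"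
| "fs_c Nat (\<sigma> \<rightarrow>\<^sub>t \<tau>) = (\<^bold>\<lambda>0:\<sigma> \<rightarrow>\<^sub>t pr Nat \<tau>. fs_c Nat \<tau> \<cdot> (v 0 (\<sigma> \<rightarrow>\<^sub>t pr Nat \<tau>) \<cdot> zero_c \<sigma>))"
| "fs_c Nat Nat = (\<^bold>\<lambda>0:Nat \<rightarrow>\<^sub>t Nat. v 0 (Nat \<rightarrow>\<^sub>t Nat) \<cdot> Zero)"

fun sn_c :: "ty \<Rightarrow> ty \<Rightarrow> tm" where
  "sn_c (\<sigma> \<rightarrow>\<^sub>t \<tau>) \<rho> = (\<^bold>\<lambda>0:\<sigma> \<rightarrow>\<^sub>t pr \<tau> \<rho>. sn_c \<tau> \<rho> \<cdot> (v 0 (\<sigma> \<rightarrow>\<^sub>t pr \<tau> \<rho>) \<cdot> zero_c \<sigma>))"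
| "sn_c Nat (\<sigma> \<rightarrow>\<^sub>t \<tau>) = (\<^bold>\<lambda>0:\<sigma> \<rightarrow>\<^sub>t pr Nat \<tau>. \<^bold>\<lambda>1:\<sigma>. sn_c Nat \<tau> \<cdot> (v 0 (\<sigma> \<rightarrow>\<^sub>t pr Nat \<tau>) \<cdot> v 1 \<sigma>))"
| "sn_c Nat Nat = (\<^bold>\<lambda>0:Nat \<rightarrow>\<^sub>t Nat. v 0 (Nat \<rightarrow>\<^sub>t Nat) \<cdot> (Succ \<cdot> Zero))"

lemma mk_c [simp]: "wt (mk_c \<sigma> \<tau>)" "tyof (mk_c \<sigma> \<tau>) = \<sigma> \<rightarrow>\<^sub>t \<tau> \<rightarrow>\<^sub>t pr \<sigma> \<tau>" "fvt (mk_c \<sigma> \<tau>) = {}"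
  by (induction \<sigma> \<tau> rule: mk_c.induct) auto

lemma fs_c [simp]: "wt (fs_c \<sigma> \<tau>)" "tyof (fs_c \<sigma> \<tau>) = pr \<sigma> \<tau> \<rightarrow>\<^sub>t \<sigma>" "fvt (fs_c \<sigma> \<tau>) = {}"
  by (induction \<sigma> \<tau> rule: fs_c.induct) auto

lemma sn_c [simp]: "wt (sn_c \<sigma> \<tau>)" "tyof (sn_c \<sigma> \<tau>) = pr \<sigma> \<tau> \<rightarrow>\<^sub>t \<tau>" "fvt (sn_c \<sigma> \<tau>) = {}"
  by (induction \<sigma> \<tau> rule: sn_c.induct) auto

lemmas mk_eqs = mk_c.simps and fs_eqs = fs_c.simps and sn_eqs = sn_c.simps
declare pr.simps [simp del] mk_c.simps [simp del] fs_c.simps [simp del] sn_c.simps [simp del]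

abbreviation sing :: "tm \<Rightarrow> tm" where "sing t \<equiv> sing_c (tyof t) \<cdot> t"
abbreviation mk :: "tm \<Rightarrow> tm \<Rightarrow> tm" where "mk s t \<equiv> mk_c (tyof s) (tyof t) \<cdot> s \<cdot> t"

definition bind :: "var \<Rightarrow> tm \<Rightarrow> tm \<Rightarrow> tm" where
  "bind x s t = bind_c (snd x) (tyof t) \<cdot> lam x t \<cdot> s"

lemma bind_simps [simp]: "tyof (bind x s t) = tyof t" "fvt (bind x s t) = fvt s \<union> (fvt t - {x})"
  "wt s \<Longrightarrow> wt t \<Longrightarrow> tyof s = snd x \<Longrightarrow> wt (bind x s t)"
  by (auto simp: bind_def)

text \<open>The types of challenges and of responses. They are only meaningful for the connectives \<open>=\<close>, \<open>\<bottom>\<close>,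
  \<open>\<longrightarrow>\<close>, \<open>\<forall>\<close> and \<open>st\<close>, to which \<open>tr\<close> below reduces the others.\<close>

fun cty :: "fm \<Rightarrow> ty" and rty :: "fm \<Rightarrow> ty" where
  "cty (\<phi> \<^bold>\<longrightarrow> \<psi>) = pr (cty \<phi> \<rightarrow>\<^sub>t rty \<phi>) (cty \<psi>)"
| "cty (Forall x \<phi>) = cty \<phi>"
| "cty _ = Nat"
| "rty (St t) = tyof t"
| "rty (\<phi> \<^bold>\<longrightarrow> \<psi>) = pr (cty \<phi>) (rty \<psi>)"
| "rty (Forall x \<phi>) = rty \<phi>"
| "rty _ = Nat"

abbreviation aty :: "fm \<Rightarrow> ty" where "aty \<phi> \<equiv> cty \<phi> \<rightarrow>\<^sub>t rty \<phi>"

lemma cty_subst [simp]: "cty (subst x r \<phi>) = cty \<phi>"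
  and rty_subst [simp]: "rty (subst x r \<phi>) = rty \<phi>" if "tyof r = snd x"
  using that by (induction \<phi>) auto

context model
begin

lemma eval_pair_consts [simp]: "eval e (mk_c \<sigma> \<tau>) = cl (mk_c \<sigma> \<tau>)"
  "eval e (fs_c \<sigma> \<tau>) = cl (fs_c \<sigma> \<tau>)" "eval e (sn_c \<sigma> \<tau>) = cl (sn_c \<sigma> \<tau>)"
  by (simp_all add: eval_closed)

lemma mk_app:
  "a \<in> D (\<sigma> \<rightarrow>\<^sub>t \<tau>) \<Longrightarrow> b \<in> D \<rho> \<Longrightarrow> c \<in> D \<sigma> \<Longrightarrow>
    cl (mk_c (\<sigma> \<rightarrow>\<^sub>t \<tau>) \<rho>) \<bullet> a \<bullet> b \<bullet> c = cl (mk_c \<tau> \<rho>) \<bullet> (a \<bullet> c) \<bullet> b"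
  "m \<in> N \<Longrightarrow> a \<in> D (\<sigma> \<rightarrow>\<^sub>t \<tau>) \<Longrightarrow> c \<in> D \<sigma> \<Longrightarrow>
    cl (mk_c Nat (\<sigma> \<rightarrow>\<^sub>t \<tau>)) \<bullet> m \<bullet> a \<bullet> c = cl (mk_c Nat \<tau>) \<bullet> m \<bullet> (a \<bullet> c)"
  "m \<in> N \<Longrightarrow> n \<in> N \<Longrightarrow> k \<in> N \<Longrightarrow> cl (mk_c Nat Nat) \<bullet> m \<bullet> n \<bullet> k = cl (cond_c Nat) \<bullet> k \<bullet> m \<bullet> n"
  by (simp_all add: pr.simps cl_eq[OF mk_eqs(1)] cl_eq[OF mk_eqs(2)] cl_eq[OF mk_eqs(3)])

lemma fs_app:
  "p \<in> D (\<sigma> \<rightarrow>\<^sub>t pr \<tau> \<rho>) \<Longrightarrow> c \<in> D \<sigma> \<Longrightarrow> cl (fs_c (\<sigma> \<rightarrow>\<^sub>t \<tau>) \<rho>) \<bullet> p \<bullet> c = cl (fs_c \<tau> \<rho>) \<bullet> (p \<bullet> c)"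
  "p \<in> D (\<sigma> \<rightarrow>\<^sub>t pr Nat \<tau>) \<Longrightarrow> cl (fs_c Nat (\<sigma> \<rightarrow>\<^sub>t \<tau>)) \<bullet> p = cl (fs_c Nat \<tau>) \<bullet> (p \<bullet> zr \<sigma>)"
  "p \<in> D (Nat \<rightarrow>\<^sub>t Nat) \<Longrightarrow> cl (fs_c Nat Nat) \<bullet> p = p \<bullet> ze"
  by (simp_all add: pr.simps cl_eq[OF fs_eqs(1)] cl_eq[OF fs_eqs(2)] cl_eq[OF fs_eqs(3)])

lemma sn_app:
  "p \<in> D (\<sigma> \<rightarrow>\<^sub>t pr \<tau> \<rho>) \<Longrightarrow> cl (sn_c (\<sigma> \<rightarrow>\<^sub>t \<tau>) \<rho>) \<bullet> p = cl (sn_c \<tau> \<rho>) \<bullet> (p \<bullet> zr \<sigma>)"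
  "p \<in> D (\<sigma> \<rightarrow>\<^sub>t pr Nat \<tau>) \<Longrightarrow> c \<in> D \<sigma> \<Longrightarrow> cl (sn_c Nat (\<sigma> \<rightarrow>\<^sub>t \<tau>)) \<bullet> p \<bullet> c = cl (sn_c Nat \<tau>) \<bullet> (p \<bullet> c)"
  "p \<in> D (Nat \<rightarrow>\<^sub>t Nat) \<Longrightarrow> cl (sn_c Nat Nat) \<bullet> p = p \<bullet> su ze"
  by (simp_all add: pr.simps cl_eq[OF sn_eqs(1)] cl_eq[OF sn_eqs(2)] cl_eq[OF sn_eqs(3)])

lemma fs_mk [simp]: "a \<in> D \<sigma> \<Longrightarrow> b \<in> D \<tau> \<Longrightarrow> cl (fs_c \<sigma> \<tau>) \<bullet> (cl (mk_c \<sigma> \<tau>) \<bullet> a \<bullet> b) = a"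
proof (induction \<sigma> \<tau> arbitrary: a b rule: pr.induct)
  case (1 \<sigma> \<tau> \<rho>)
  show ?case
    by (rule ext[of _ \<sigma> \<tau>]) (use 1 in \<open>simp_all add: fs_app mk_app pr.simps\<close>)
qed (simp_all add: fs_app mk_app pr.simps)

lemma sn_mk [simp]: "a \<in> D \<sigma> \<Longrightarrow> b \<in> D \<tau> \<Longrightarrow> cl (sn_c \<sigma> \<tau>) \<bullet> (cl (mk_c \<sigma> \<tau>) \<bullet> a \<bullet> b) = b"
proof (induction \<sigma> \<tau> arbitrary: a b rule: pr.induct)
  case (2 \<sigma> \<tau>)
  show ?case
    by (rule ext[of _ \<sigma> \<tau>]) (use 2 in \<open>simp_all add: sn_app mk_app pr.simps\<close>)
qed (simp_all add: sn_app mk_app pr.simps)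

lemma in_sing: "env e \<Longrightarrow> wt t \<Longrightarrow> tyof t = \<sigma> \<Longrightarrow> a = eval e t \<Longrightarrow> a \<in> set_of \<sigma> (eval e (sing t))"
  using set_sing[of "eval e t" \<sigma>] by simp

lemma in_cat:
  assumes "a \<in> set_of \<sigma> (eval e s) \<or> a \<in> set_of \<sigma> (eval e t)"
    and "env e" "wt s" "wt t" "tyof s = \<sigma>" "tyof t = \<sigma>"
  shows "a \<in> set_of \<sigma> (eval e (cat_c \<sigma> \<cdot> s \<cdot> t))"
  using set_cat[of "eval e s" \<sigma> "eval e t" a] assms by simp

lemma in_bind:
  assumes "a \<in> set_of (snd x) (eval e s)" "b \<in> set_of \<tau> (eval (e(x := a)) t)"
    and "env e" "wt s" "wt t" "tyof s = snd x" "tyof t = \<tau>"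
  shows "b \<in> set_of \<tau> (eval e (bind x s t))"
proof -
  have "ok a \<and> tp a = snd x" using assms by (intro set_of_D) auto
  then show ?thesis using set_bind[of "eval e (lam x t)" "snd x" \<tau> "eval e s" a b] assms
    by (simp add: bind_def)
qed

text \<open>For embedding a list of single components into a list of tuples: \<open>t\<close> pads a
  component to a tuple and \<open>F\<close> projects it back.\<close>

lemma set_of_subset_bind:
  assumes "env e" "wt s" "wt t" "tyof s = snd x" "tyof t = \<rho>"
    and "\<And>a. a \<in> D (snd x) \<Longrightarrow> F (eval (e(x := a)) t) = a"
  shows "set_of (snd x) (eval e s) \<subseteq> F ` set_of \<rho> (eval e (bind x s (sing t)))"
proof
  fix a assume a: "a \<in> set_of (snd x) (eval e s)"
  have aD: "ok a \<and> tp a = snd x" by (rule set_of_D[OF a]) (use assms in simp)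
  have "eval (e(x := a)) t \<in> set_of \<rho> (eval e (bind x s (sing t)))"
    by (rule in_bind[OF a], rule in_sing) (use assms aD in simp_all)
  then show "a \<in> F ` set_of \<rho> (eval e (bind x s (sing t)))"
    using assms(6)[of a] aD by (metis imageI in_D)
qed

text \<open>\<open>R \<phi> e x S\<close>: one of the responses in \<open>S\<close> answers the challenge \<open>x\<close> to \<open>\<phi>\<close>. A challenge to an
  implication is a pair of a function answering all challenges to the premise and a challenge to the
  conclusion; a response is a challenge to the premise together with a response for the conclusion.\<close>

fun R :: "fm \<Rightarrow> (var \<Rightarrow> 'a) \<Rightarrow> 'a \<Rightarrow> 'a set \<Rightarrow> bool" where
  "R (s \<^bold>= t) e x S \<longleftrightarrow> eval e s = eval e t"
| "R Bot e x S \<longleftrightarrow> False"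
| "R (St t) e x S \<longleftrightarrow> eval e t \<in> S"
| "R (\<phi> \<^bold>\<longrightarrow> \<psi>) e x S \<longleftrightarrow>
     (\<forall>z\<in>S. R \<phi> e (cl (fs_c (cty \<phi>) (rty \<psi>)) \<bullet> z) (set_of (rty \<phi>)
        (cl (fs_c (aty \<phi>) (cty \<psi>)) \<bullet> x \<bullet> (cl (fs_c (cty \<phi>) (rty \<psi>)) \<bullet> z)))) \<longrightarrow>
     R \<psi> e (cl (sn_c (aty \<phi>) (cty \<psi>)) \<bullet> x) ((\<lambda>z. cl (sn_c (cty \<phi>) (rty \<psi>)) \<bullet> z) ` S)"
| "R (Forall y \<phi>) e x S \<longleftrightarrow> (\<forall>a \<in> D (snd y). R \<phi> (e(y := a)) x S)"
| "R _ e x S \<longleftrightarrow> True"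

definition realizes :: "'a \<Rightarrow> fm \<Rightarrow> bool" where
  "realizes T \<phi> \<longleftrightarrow> ok T \<and> tp T = aty \<phi> \<and>
     (\<forall>e. env e \<longrightarrow> (\<forall>x \<in> D (cty \<phi>). R \<phi> e x (set_of (rty \<phi>) (T \<bullet> x))))"

definition V :: "fm set" where "V = {\<phi>. \<exists>T. realizes T \<phi>}"

text \<open>In an implication a larger set strengthens the hypothesis about the premise and enlarges
  the set of responses for the conclusion, so both sides move in the right direction.\<close>

lemma R_mono: "R \<phi> e x S \<Longrightarrow> S \<subseteq> S' \<Longrightarrow> R \<phi> e x S'"
proof (induction \<phi> arbitrary: e x S S')
  case (Imp \<phi> \<psi>)
  then show ?case
    using Imp.IH(2)[OF _ image_mono[OF Imp.prems(2)]] by (auto simp only: R.simps subset_iff)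
next
  case (Forall y \<phi>)
  then show ?case by (auto simp only: R.simps)
qed auto

lemma R_cong: "(\<And>x. x \<in> fv \<phi> \<Longrightarrow> e x = e' x) \<Longrightarrow> R \<phi> e p S = R \<phi> e' p S"
proof (induction \<phi> arbitrary: e e' p S)
  case (Eq s t)
  then show ?case using eval_cong[of s e e'] eval_cong[of t e e'] by simp
next
  case (St t)
  then show ?case using eval_cong[of t e e'] by simp
next
  case (Imp \<phi> \<psi>)
  have "R \<phi> e p S = R \<phi> e' p S" "R \<psi> e p S = R \<psi> e' p S" for p S
    by (rule Imp.IH; use Imp.prems in simp)+
  then show ?case by (simp only: R.simps)
next
  case (Forall x \<phi>)
  have "R \<phi> (e(x := a)) p S = R \<phi> (e'(x := a)) p S" for a
    by (rule Forall.IH) (use Forall.prems in auto)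
  then show ?case by (simp only: R.simps)
qed simp_all

lemma R_upd_fresh: "x \<notin> fv \<phi> \<Longrightarrow> R \<phi> (e(x := a)) p S = R \<phi> e p S"
  by (rule R_cong) auto

lemma R_subst: "free_for x r \<phi> \<Longrightarrow> tyof r = snd x \<Longrightarrow> R (subst x r \<phi>) e p S = R \<phi> (e(x := eval e r)) p S"
proof (induction \<phi> arbitrary: e p S)
  case (Forall y \<phi>)
  show ?case
  proof (cases "x \<in> fv \<phi> - {y}")
    case False
    then have x: "x \<notin> fv (Forall y \<phi>)" by simp
    show ?thesis unfolding subst_fresh[OF x] by (rule R_upd_fresh[OF x, symmetric])
  next
    case True
    then have "y \<notin> fvt r" "free_for x r \<phi>" using Forall.prems by auto
    then have "R (subst x r \<phi>) (e(y := a)) p S = R \<phi> (e(x := eval e r, y := a)) p S" for a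
    proof -
      have "R (subst x r \<phi>) (e(y := a)) p S = R \<phi> (e(y := a, x := eval (e(y := a)) r)) p S"
        by (rule Forall.IH) fact+
      also have "e(y := a, x := eval (e(y := a)) r) = e(x := eval e r, y := a)"
        using True \<open>y \<notin> fvt r\<close> by (subst fun_upd_twist) auto
      finally show ?thesis .
    qed
    then show ?thesis using True by (simp only: subst.simps R.simps Diff_iff singleton_iff if_False simp_thms)
  qed
next
  case (Imp \<phi> \<psi>)
  then show ?case by (simp only: subst.simps R.simps cty_subst rty_subst free_for.simps simp_thms)
qed (auto simp: eval_substt)

text \<open>Realizers may use parameters from \<open>M\<close>: they are values of variables in
  \<open>e'\<close>, while variable 0 receives the challenge.\<close>

lemma V_intro:
  assumes "env e'" "wt t" "tyof t = rty \<phi>" "\<And>e x. env e \<Longrightarrow> x \<in> D (cty \<phi>) \<Longrightarrow>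
    R \<phi> e x (set_of (rty \<phi>) (eval (e'((0, cty \<phi>) := x)) t))"
  shows "\<phi> \<in> V"
proof -
  have "realizes (eval e' (lam (0, cty \<phi>) t)) \<phi>"
    unfolding realizes_def using assms by simp
  then show ?thesis unfolding V_def by blast
qed

section \<open>Strategies tested on lists of challenges, and rules for implications\<close>

abbreviation Fs where "Fs \<sigma> \<tau> \<equiv> ap (cl (fs_c \<sigma> \<tau>))"
abbreviation Sn where "Sn \<sigma> \<tau> \<equiv> ap (cl (sn_c \<sigma> \<tau>))"

text \<open>The strategy \<open>f\<close> meets the challenges in \<open>C\<close>. This is the
  premise in the reading of an implication, where a strategy is tested only against the challenges
  listed in the response.\<close>

definition H :: "fm \<Rightarrow> (var \<Rightarrow> 'a) \<Rightarrow> 'a \<Rightarrow> 'a set \<Rightarrow> bool" where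
  "H \<phi> e f C \<longleftrightarrow> (\<forall>c\<in>C. R \<phi> e c (set_of (rty \<phi>) (f \<bullet> c)))"

lemma H_mono: "H \<phi> e f C \<Longrightarrow> C' \<subseteq> C \<Longrightarrow> H \<phi> e f C'"
  unfolding H_def by blast

lemma HD: "H \<phi> e f C \<Longrightarrow> c \<in> C \<Longrightarrow> R \<phi> e c (set_of (rty \<phi>) (f \<bullet> c))"
  unfolding H_def by blast

lemma R_Imp: "R (\<phi> \<^bold>\<longrightarrow> \<psi>) e x S \<longleftrightarrow>
  (H \<phi> e (cl (fs_c (aty \<phi>) (cty \<psi>)) \<bullet> x) (Fs (cty \<phi>) (rty \<psi>) ` S) \<longrightarrow>
   R \<psi> e (cl (sn_c (aty \<phi>) (cty \<psi>)) \<bullet> x) (Sn (cty \<phi>) (rty \<psi>) ` S))"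
  unfolding H_def by simp

declare R.simps(4) [simp del]

lemma R_Imp_mk:
  assumes "f \<in> D (aty \<phi>)" "x \<in> D (cty \<psi>)"
  shows "R (\<phi> \<^bold>\<longrightarrow> \<psi>) e (cl (mk_c (aty \<phi>) (cty \<psi>)) \<bullet> f \<bullet> x) S \<longleftrightarrow>
    (H \<phi> e f (Fs (cty \<phi>) (rty \<psi>) ` S) \<longrightarrow> R \<psi> e x (Sn (cty \<phi>) (rty \<psi>) ` S))"
  using assms by (simp add: R_Imp)

text \<open>The implication is challenged with the pair of the realizer \<open>a\<close> and the
  given challenge \<open>x\<close>. Since \<open>a\<close> meets every challenge to the premise, the
  second components of the responses answer \<open>x\<close>.\<close>

lemma V_mp:
  assumes "(\<phi> \<^bold>\<longrightarrow> \<psi>) \<in> V" "\<phi> \<in> V" shows "\<psi> \<in> V"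
proof -
  let ?I = "\<phi> \<^bold>\<longrightarrow> \<psi>"
  obtain F a where F: "realizes F ?I" and a: "realizes a \<phi>" using assms unfolding V_def by blast
  let ?e = "e0((1, aty ?I) := F, (2, aty \<phi>) := a)"
  let ?s = "v 1 (aty ?I) \<cdot> mk (v 2 (aty \<phi>)) (v 0 (cty \<psi>))"
  let ?t = "bind (3, rty ?I) ?s (sing (sn_c (cty \<phi>) (rty \<psi>) \<cdot> v 3 (rty ?I)))"
  have tp: "ok F" "tp F = aty ?I" "ok a" "tp a = aty \<phi>"
    using F a unfolding realizes_def by auto
  show ?thesis
  proof (rule V_intro[of ?e ?t])
    fix e x assume ex: "env e" "x \<in> D (cty \<psi>)"
    let ?e' = "?e((0, cty \<psi>) := x)"
    let ?p = "cl (mk_c (aty \<phi>) (cty \<psi>)) \<bullet> a \<bullet> x"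
    let ?S = "set_of (rty ?I) (F \<bullet> ?p)"
    have p: "ok ?p" "tp ?p = cty ?I" using ex tp by simp_all
    have "R ?I e ?p ?S" using F p ex unfolding realizes_def by simp
    moreover have "H \<phi> e a (Fs (cty \<phi>) (rty \<psi>) ` ?S)"
    proof -
      have "Fs (cty \<phi>) (rty \<psi>) ` ?S \<subseteq> D (cty \<phi>)"
        using set_of_D[of _ "rty ?I" "F \<bullet> ?p"] p tp by auto
      then show ?thesis using a ex unfolding realizes_def H_def by blast
    qed
    ultimately have R: "R \<psi> e x (Sn (cty \<phi>) (rty \<psi>) ` ?S)"
      using R_Imp_mk[of a \<phi> x \<psi> e ?S] tp ex by simp
    have "Sn (cty \<phi>) (rty \<psi>) ` ?S \<subseteq> set_of (rty \<psi>) (eval ?e' ?t)"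
    proof (rule image_subsetI)
      fix z assume z: "z \<in> ?S"
      then have "ok z" "tp z = rty ?I" using set_of_D[OF z] p tp by simp_all
      then show "cl (sn_c (cty \<phi>) (rty \<psi>)) \<bullet> z \<in> set_of (rty \<psi>) (eval ?e' ?t)"
        by (intro in_bind[where a = z] in_sing) (use z tp ex in simp_all)
    qed
    then show "R \<psi> e x (set_of (rty \<psi>) (eval ?e' ?t))" by (rule R_mono[OF R])
  qed (use tp in simp_all)
qed

text \<open>The closed realizer is assembled from lists \<open>tA\<close>, \<open>tB\<close>, \<open>tC\<close> of challenges to the hypotheses and a
  response \<open>tE\<close> to the challenge (variable 13); the variables 10, 11, 12 stand for the answers to the
  hypotheses.\<close>

lemma V_intro3:
  fixes A B C E :: fm
  defines "vf \<equiv> (10, aty A)" and "vg \<equiv> (11, aty B)" and "vh \<equiv> (12, aty C)"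
    and "vx \<equiv> (13, cty E)"
  assumes wt: "wt tA" "wt tB" "wt tC" "wt tE"
    and ty: "tyof tA = cty A" "tyof tB = cty B" "tyof tC = cty C" "tyof tE = rty E"
    and main: "\<And>e f g h x e'. env e \<Longrightarrow> ok f \<Longrightarrow> tp f = aty A \<Longrightarrow> ok g \<Longrightarrow> tp g = aty B \<Longrightarrow>
      ok h \<Longrightarrow> tp h = aty C \<Longrightarrow> ok x \<Longrightarrow> tp x = cty E \<Longrightarrow> env e' \<Longrightarrow>
      e' vf = f \<Longrightarrow> e' vg = g \<Longrightarrow> e' vh = h \<Longrightarrow> e' vx = x \<Longrightarrow>
      H A e f (set_of (cty A) (eval e' tA)) \<Longrightarrow> H B e g (set_of (cty B) (eval e' tB)) \<Longrightarrow>
      H C e h (set_of (cty C) (eval e' tC)) \<Longrightarrow> R E e x (set_of (rty E) (eval e' tE))"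
  shows "(A \<^bold>\<longrightarrow> B \<^bold>\<longrightarrow> C \<^bold>\<longrightarrow> E) \<in> V"
proof -
  let ?CE = "C \<^bold>\<longrightarrow> E" let ?BE = "B \<^bold>\<longrightarrow> ?CE" let ?F = "A \<^bold>\<longrightarrow> ?BE"
  \<comment> \<open>A response to the nested implication is a tuple of three challenges and a
    response. Because \<open>R\<close> sees the coordinates only through images, the four lists can
    be padded with zeros and concatenated; the zeros merely add further challenges and
    responses.\<close>
  let ?q = "\<lambda>a b c d. mk a (mk b (mk c d))"
  let ?zA = "zero_c (cty A)" and ?zB = "zero_c (cty B)" and ?zC = "zero_c (cty C)" and ?zE = "zero_c (rty E)"
  let ?sA = "bind (20, cty A) tA (sing (?q (v 20 (cty A)) ?zB ?zC ?zE))"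
  let ?sB = "bind (20, cty B) tB (sing (?q ?zA (v 20 (cty B)) ?zC ?zE))"
  let ?sC = "bind (20, cty C) tC (sing (?q ?zA ?zB (v 20 (cty C)) ?zE))"
  let ?sE = "bind (20, rty E) tE (sing (?q ?zA ?zB ?zC (v 20 (rty E))))"
  let ?cat = "\<lambda>s t. cat_c (rty ?F) \<cdot> s \<cdot> t"
  let ?s = "?cat ?sA (?cat ?sB (?cat ?sC ?sE))"
  let ?p = "Var (0, cty ?F)"
  let ?p1 = "sn_c (aty A) (cty ?BE) \<cdot> ?p"
  let ?p2 = "sn_c (aty B) (cty ?CE) \<cdot> ?p1"
  let ?f = "fs_c (aty A) (cty ?BE) \<cdot> ?p"
  let ?g = "fs_c (aty B) (cty ?CE) \<cdot> ?p1"
  let ?h = "fs_c (aty C) (cty E) \<cdot> ?p2"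
  let ?x = "sn_c (aty C) (cty E) \<cdot> ?p2"
  \<comment> \<open>The challenge has the form \<open>(f, (g, (h, x)))\<close>. Binding its parts to
    variables 10 to 13 lets the terms \<open>tA\<close>, \<open>tB\<close>, \<open>tC\<close>,
    \<open>tE\<close> be written without reference to the coding.\<close>
  let ?t = "lam vf (lam vg (lam vh (lam vx ?s))) \<cdot> ?f \<cdot> ?g \<cdot> ?h \<cdot> ?x"
  note defs = vf_def vg_def vh_def vx_def
  show ?thesis
  proof (rule V_intro[of e0 ?t])
    fix e p assume e: "env e" and p: "p \<in> D (cty ?F)"
    let ?e = "e0((0, cty ?F) := p)"
    define f g h x where "f = eval ?e ?f" and "g = eval ?e ?g" and "h = eval ?e ?h" and "x = eval ?e ?x"
    have ok: "ok f" "ok g" "ok h" "ok x" "tp f = aty A" "tp g = aty B"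
      "tp h = aty C" "tp x = cty E"
      using p by (simp_all add: f_def g_def h_def x_def)
    define e' where "e' = ?e(vf := f, vg := g, vh := h, vx := x)"
    have e': "env e'" "e' vf = f" "e' vg = g" "e' vh = h" "e' vx = x"
      unfolding e'_def using p ok by (simp_all add: defs)
    define S where "S = set_of (rty ?F) (eval e' ?s)"
    have "eval ?e ?t = eval e' ?s"
    proof -
      have "eval ?e ?t = eval ?e (lam vf (lam vg (lam vh (lam vx ?s)))) \<bullet> f \<bullet> g \<bullet> h \<bullet> x"
        by (simp only: eval.simps f_def g_def h_def x_def)
      also have "\<dots> = eval (?e(vf := f)) (lam vg (lam vh (lam vx ?s))) \<bullet> g \<bullet> h \<bullet> x"
        using p ok wt ty by (subst beta) (simp_all add: defs)
      also have "\<dots> = eval (?e(vf := f, vg := g)) (lam vh (lam vx ?s)) \<bullet> h \<bullet> x"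
        using p ok wt ty by (subst beta) (simp_all add: defs)
      also have "\<dots> = eval (?e(vf := f, vg := g, vh := h)) (lam vx ?s) \<bullet> x"
        using p ok wt ty by (subst beta) (simp_all add: defs)
      also have "\<dots> = eval e' ?s"
        unfolding e'_def using p ok wt ty by (subst beta) (simp_all add: defs)
      finally show ?thesis .
    qed
    then have S: "S = set_of (rty ?F) (eval ?e ?t)" by (simp add: S_def)
    let ?fA = "Fs (cty A) (rty ?BE)" and ?sn1 = "Sn (cty A) (rty ?BE)"
    let ?fB = "Fs (cty B) (rty ?CE)" and ?sn2 = "Sn (cty B) (rty ?CE)"
    let ?fC = "Fs (cty C) (rty E)" and ?sn3 = "Sn (cty C) (rty E)"
    have wts: "wt ?sA" "wt ?sB" "wt ?sC" "wt ?sE" "tyof ?sA = rty ?F" "tyof ?sB = rty ?F"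
      "tyof ?sC = rty ?F" "tyof ?sE = rty ?F"
      using wt ty by simp_all
    have Scat: "z \<in> S" if "z \<in> set_of (rty ?F) (eval e' ?sA) \<or> z \<in> set_of (rty ?F) (eval e' ?sB) \<or>
        z \<in> set_of (rty ?F) (eval e' ?sC) \<or> z \<in> set_of (rty ?F) (eval e' ?sE)" for z
    proof -
      have c: "wt (?cat ?sC ?sE)" "tyof (?cat ?sC ?sE) = rty ?F" "wt (?cat ?sB (?cat ?sC ?sE))"
        "tyof (?cat ?sB (?cat ?sC ?sE)) = rty ?F"
        using wts by simp_all
      show ?thesis unfolding S_def using that e'(1) wts c by (blast intro: in_cat)
    qed
    have subA: "set_of (cty A) (eval e' tA) \<subseteq> ?fA ` S"
    proof -
      have "set_of (snd (20::nat, cty A)) (eval e' tA) \<subseteq> (\<lambda>z. ?fA z) ` set_of (rty ?F) (eval e' ?sA)"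
        by (rule set_of_subset_bind) (use wt ty e' in simp_all)
      then show ?thesis using Scat unfolding image_image snd_conv by blast
    qed
    have subB: "set_of (cty B) (eval e' tB) \<subseteq> ?fB ` ?sn1 ` S"
    proof -
      have "set_of (snd (20::nat, cty B)) (eval e' tB) \<subseteq> (\<lambda>z. ?fB (?sn1 z)) ` set_of (rty ?F) (eval e' ?sB)"
        by (rule set_of_subset_bind) (use wt ty e' in simp_all)
      then show ?thesis using Scat unfolding image_image snd_conv by blast
    qed
    have subC: "set_of (cty C) (eval e' tC) \<subseteq> ?fC ` ?sn2 ` ?sn1 ` S"
    proof -
      have "set_of (snd (20::nat, cty C)) (eval e' tC) \<subseteq> (\<lambda>z. ?fC (?sn2 (?sn1 z))) ` set_of (rty ?F) (eval e' ?sC)"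
        by (rule set_of_subset_bind) (use wt ty e' in simp_all)
      then show ?thesis using Scat unfolding image_image snd_conv by blast
    qed
    have subE: "set_of (rty E) (eval e' tE) \<subseteq> ?sn3 ` ?sn2 ` ?sn1 ` S"
    proof -
      have "set_of (snd (20::nat, rty E)) (eval e' tE) \<subseteq> (\<lambda>z. ?sn3 (?sn2 (?sn1 z))) ` set_of (rty ?F) (eval e' ?sE)"
        by (rule set_of_subset_bind) (use wt ty e' in simp_all)
      then show ?thesis using Scat unfolding image_image snd_conv by blast
    qed
    have "R E e x (?sn3 ` ?sn2 ` ?sn1 ` S)"
      if "H A e f (?fA ` S)" "H B e g (?fB ` ?sn1 ` S)" "H C e h (?fC ` ?sn2 ` ?sn1 ` S)"
      by (rule R_mono[OF main[OF e ok(1,5,2,6,3,7,4,8) e'] subE])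
        (rule H_mono[OF that(1) subA] H_mono[OF that(2) subB] H_mono[OF that(3) subC])+
    then have "R ?F e p S" unfolding R_Imp f_def g_def h_def x_def by simp
    then show "R ?F e p (set_of (rty ?F) (eval ?e ?t))" by (simp only: S)
  qed (use wt ty in \<open>simp_all add: defs\<close>)
qed

end

text \<open>The clauses for the external quantifiers are the translations of the right-hand sides in
  \<open>EQ_ax\<close>; this explains the double negation under \<open>ExistsSt\<close> and makes
  those axioms tautologies after translation.\<close>

fun tr :: "fm \<Rightarrow> fm" where
  "tr (\<phi> \<^bold>\<and> \<psi>) = Neg (tr \<phi> \<^bold>\<longrightarrow> Neg (tr \<psi>))"
| "tr (\<phi> \<^bold>\<or> \<psi>) = (Neg (tr \<phi>) \<^bold>\<longrightarrow> tr \<psi>)"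
| "tr (\<phi> \<^bold>\<longrightarrow> \<psi>) = (tr \<phi> \<^bold>\<longrightarrow> tr \<psi>)"
| "tr (Forall x \<phi>) = Forall x (tr \<phi>)"
| "tr (Exists x \<phi>) = Neg (Forall x (Neg (tr \<phi>)))"
| "tr (ForallSt x \<phi>) = Forall x (St (Var x) \<^bold>\<longrightarrow> tr \<phi>)"
| "tr (ExistsSt x \<phi>) = Neg (Forall x (Neg (Neg (St (Var x) \<^bold>\<longrightarrow> Neg (tr \<phi>)))))"
| "tr \<phi> = \<phi>"

lemma tr_subst: "tr (subst x r \<phi>) = subst x r (tr \<phi>)"
  by (induction \<phi>) auto

lemma fv_tr [simp]: "fv (tr \<phi>) = fv \<phi>"
  by (induction \<phi>) auto

lemma free_for_tr [simp]: "free_for x r (tr \<phi>) = free_for x r \<phi>"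
  by (induction \<phi>) auto

lemma fv_subst_notin: "x \<notin> fvt r \<Longrightarrow> x \<notin> fv (subst x r \<phi>)"
proof (induction \<phi>)
  case (Eq s t)
  have "x \<notin> fvt (substt x r t)" if "x \<notin> fvt r" for t using that by (induction t) auto
  then show ?case using Eq by auto
next
  case (St s)
  have "x \<notin> fvt (substt x r t)" if "x \<notin> fvt r" for t using that by (induction t) auto
  then show ?case using St by auto
qed auto

lemma substt_Var [simp]: "substt x (Var x) t = t"
  by (induction t) auto

lemma subst_Var [simp]: "subst x (Var x) \<phi> = \<phi>"
  by (induction \<phi>) auto

context model
begin

text \<open>Without \<open>St\<close> nothing in \<open>R\<close> looks at a response. Nonemptiness
  matters in implications, where an empty \<open>S\<close> would make the condition on the premise
  vacuous.\<close>

lemma R_internal: "internal \<phi> \<Longrightarrow> S \<noteq> {} \<Longrightarrow> R (tr \<phi>) e x S \<longleftrightarrow> sat e \<phi>"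
proof (induction \<phi> arbitrary: e x S)
  case (And \<phi> \<psi>)
  then show ?case by (auto simp: R_Imp H_def set_of_def)
next
  case (Or \<phi> \<psi>)
  then show ?case by (auto simp: R_Imp H_def set_of_def)
next
  case (Imp \<phi> \<psi>)
  then show ?case by (auto simp: R_Imp H_def set_of_def)
next
  case (Exists y \<phi>)
  then show ?case by (auto simp: R_Imp H_def set_of_def)
qed auto

lemma set_of_nonempty [simp]: "set_of \<sigma> y \<noteq> {}"
  by (auto simp: set_of_def)

lemma V_internal:
  assumes "internal \<phi>" "\<And>e. env e \<Longrightarrow> sat e \<phi>" shows "tr \<phi> \<in> V"
  by (rule V_intro[of e0 "zero_c (rty (tr \<phi>))"]) (simp_all add: R_internal assms)

text \<open>Fills the remaining premises when \<open>V_intro3\<close> is specialized to fewer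
  hypotheses.\<close>

lemma V_Top: "Neg Bot \<in> V"
  using V_internal[of "Neg Bot"] by simp

lemma H_internal: "internal \<phi> \<Longrightarrow> C \<noteq> {} \<Longrightarrow> H (tr \<phi>) e f C \<longleftrightarrow> sat e \<phi>"
  unfolding H_def by (auto simp: R_internal)

lemma V_intro2:
  fixes B C E :: fm
  defines "vg \<equiv> (11, aty B)" and "vh \<equiv> (12, aty C)" and "vx \<equiv> (13, cty E)"
  assumes "wt tB" "wt tC" "wt tE" "tyof tB = cty B" "tyof tC = cty C" "tyof tE = rty E"
    and main: "\<And>e g h x e'. env e \<Longrightarrow> ok g \<Longrightarrow> tp g = aty B \<Longrightarrow>
      ok h \<Longrightarrow> tp h = aty C \<Longrightarrow> ok x \<Longrightarrow> tp x = cty E \<Longrightarrow> env e' \<Longrightarrow>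
      e' vg = g \<Longrightarrow> e' vh = h \<Longrightarrow> e' vx = x \<Longrightarrow> H B e g (set_of (cty B) (eval e' tB)) \<Longrightarrow>
      H C e h (set_of (cty C) (eval e' tC)) \<Longrightarrow> R E e x (set_of (rty E) (eval e' tE))"
  shows "(B \<^bold>\<longrightarrow> C \<^bold>\<longrightarrow> E) \<in> V"
proof (rule V_mp[OF V_intro3 V_Top])
  fix e f g h x e'
  assume "env e" "ok g" "tp g = aty B" "ok h" "tp h = aty C" "ok x" "tp x = cty E" "env e'"
    "e' (11, aty B) = g" "e' (12, aty C) = h" "e' (13, cty E) = x"
    "H B e g (set_of (cty B) (eval e' tB))" "H C e h (set_of (cty C) (eval e' tC))"
  then show "R E e x (set_of (rty E) (eval e' tE))" unfolding vg_def[symmetric] vh_def[symmetric] vx_def[symmetric] by (rule main)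
qed (fact assms wt_zero_c tyof_zero_c)+

lemma V_intro1:
  fixes C E :: fm
  defines "vh \<equiv> (12, aty C)" and "vx \<equiv> (13, cty E)"
  assumes "wt tC" "wt tE" "tyof tC = cty C" "tyof tE = rty E"
    and main: "\<And>e h x e'. env e \<Longrightarrow> 
      ok h \<Longrightarrow> tp h = aty C \<Longrightarrow> ok x \<Longrightarrow> tp x = cty E \<Longrightarrow> env e' \<Longrightarrow> e' vh = h \<Longrightarrow> e' vx = x \<Longrightarrow>
      H C e h (set_of (cty C) (eval e' tC)) \<Longrightarrow> R E e x (set_of (rty E) (eval e' tE))"
  shows "(C \<^bold>\<longrightarrow> E) \<in> V"
proof (rule V_mp[OF V_intro2 V_Top])
  fix e g h x e'
  assume "env e" "ok h" "tp h = aty C" "ok x" "tp x = cty E" "env e'"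
    "e' (12, aty C) = h" "e' (13, cty E) = x" "H C e h (set_of (cty C) (eval e' tC))"
  then show "R E e x (set_of (rty E) (eval e' tE))" unfolding vh_def[symmetric] vx_def[symmetric] by (rule main)
qed (fact assms wt_zero_c tyof_zero_c)+

section \<open>Realizers for classical logic\<close>

lemma V_K: "(\<phi> \<^bold>\<longrightarrow> \<psi> \<^bold>\<longrightarrow> \<phi>) \<in> V"
proof (rule V_intro2[where tB = "sing (v 13 (cty \<phi>))" and tC = "zero_c (cty \<psi>)"
      and tE = "v 11 (aty \<phi>) \<cdot> v 13 (cty \<phi>)"])
  fix e g x e'
  assume *: "env e'" "e' (11, aty \<phi>) = g" "e' (13, cty \<phi>) = x" "ok x" "tp x = cty \<phi>"
    and H: "H \<phi> e g (set_of (cty \<phi>) (eval e' (sing (v 13 (cty \<phi>)))))"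
  have "x \<in> set_of (cty \<phi>) (eval e' (sing (v 13 (cty \<phi>))))" by (rule in_sing) (use * in simp_all)
  then show "R \<phi> e x (set_of (rty \<phi>) (eval e' (v 11 (aty \<phi>) \<cdot> v 13 (cty \<phi>))))"
    using HD[OF H] * by simp
qed simp_all

lemma V_inst:
  assumes t: "wt t" "tyof t = snd x" "free_for x t \<phi>"
  shows "(Forall x \<phi> \<^bold>\<longrightarrow> subst x t \<phi>) \<in> V"
proof (rule V_intro1[where tC = "sing (v 13 (cty \<phi>))" and tE = "v 12 (aty \<phi>) \<cdot> v 13 (cty \<phi>)"])
  fix e g p e'
  assume *: "env e" "env e'" "e' (12, aty (Forall x \<phi>)) = g" "e' (13, cty (subst x t \<phi>)) = p"
     "ok p" "tp p = cty (subst x t \<phi>)"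
    and H: "H (Forall x \<phi>) e g (set_of (cty (Forall x \<phi>)) (eval e' (sing (v 13 (cty \<phi>)))))"
  have "p \<in> set_of (cty \<phi>) (eval e' (sing (v 13 (cty \<phi>))))" by (rule in_sing) (use * t in simp_all)
  then have "R (Forall x \<phi>) e p (set_of (rty \<phi>) (g \<bullet> p))"
    using HD[OF H] by simp
  then show "R (subst x t \<phi>) e p (set_of (rty (subst x t \<phi>)) (eval e' (v 12 (aty \<phi>) \<cdot> v 13 (cty \<phi>))))"
    using * t by (simp add: R_subst)
qed (use t in simp_all)

text \<open>The same realizer works: \<open>Forall\<close> leaves the types of challenges and
  responses unchanged, and realizers are uniform in the environment.\<close>

lemma V_gen:
  assumes "(\<phi> \<^bold>\<longrightarrow> \<psi>) \<in> V" "x \<notin> fv \<phi>" shows "(\<phi> \<^bold>\<longrightarrow> Forall x \<psi>) \<in> V"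
proof -
  obtain T where T: "realizes T (\<phi> \<^bold>\<longrightarrow> \<psi>)" using assms unfolding V_def by blast
  have "R (\<phi> \<^bold>\<longrightarrow> Forall x \<psi>) e p (set_of (pr (cty \<phi>) (rty \<psi>)) (T \<bullet> p))"
    if "env e" "p \<in> D (pr (aty \<phi>) (cty \<psi>))" for e p
  proof -
    have "R (\<phi> \<^bold>\<longrightarrow> \<psi>) (e(x := a)) p (set_of (pr (cty \<phi>) (rty \<psi>)) (T \<bullet> p))" if "a \<in> D (snd x)" for a
      using T that \<open>env e\<close> \<open>p \<in> _\<close> unfolding realizes_def by simp
    moreover have "H \<phi> (e(x := a)) f C = H \<phi> e f C" for f C a
      unfolding H_def by (simp add: R_upd_fresh assms(2))
    ultimately show ?thesis unfolding R_Imp by simp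
  qed
  then have "realizes T (\<phi> \<^bold>\<longrightarrow> Forall x \<psi>)" using T unfolding realizes_def by simp
  then show ?thesis unfolding V_def by blast
qed

text \<open>Given a challenge \<open>x\<close> to \<open>\<phi>\<close>, let \<open>G\<close> defend
  \<open>Neg \<phi>\<close> by always asking \<open>x\<close>. The reply of \<open>h\<close> to
  \<open>G\<close> lists strategies for \<open>\<phi>\<close>, one of which must answer
  \<open>x\<close>. As it is not known which one, the answers of all of them to \<open>x\<close> are
  collected.\<close>

lemma V_DN: "(Neg (Neg \<phi>) \<^bold>\<longrightarrow> \<phi>) \<in> V"
proof -
  let ?N = "Neg \<phi>" and ?NN = "Neg (Neg \<phi>)"
  let ?h = "v 12 (aty ?NN)" and ?x = "v 13 (cty \<phi>)"
  let ?G = "lam (1, cty ?N) (sing (mk ?x Zero))"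
  let ?ch = "mk ?G Zero"
  let ?t = "bind (2, rty ?NN) (?h \<cdot> ?ch) (fs_c (aty \<phi>) Nat \<cdot> (fs_c (cty ?N) Nat \<cdot> v 2 (rty ?NN)) \<cdot> ?x)"
  show ?thesis
  proof (rule V_intro1[where tC = "sing ?ch" and tE = ?t])
    fix e h x e'
    assume *: "env e" "ok h" "tp h = aty ?NN" "ok x" "tp x = cty \<phi>" "env e'"
      "e' (12, aty ?NN) = h" "e' (13, cty \<phi>) = x"
      and H: "H ?NN e h (set_of (cty ?NN) (eval e' (sing ?ch)))"
    define G where "G = eval e' ?G"
    let ?c = "cl (mk_c (aty ?N) Nat) \<bullet> G \<bullet> ze"
    have G: "ok G" "tp G = aty ?N" using * by (simp_all add: G_def)
    have "?c \<in> set_of (cty ?NN) (eval e' (sing ?ch))"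
      by (rule in_sing) (use * in \<open>simp_all add: G_def\<close>)
    then have "R ?NN e ?c (set_of (rty ?NN) (h \<bullet> ?c))" by (rule HD[OF H])
    \<comment> \<open>\<open>G\<close> fails on some challenge \<open>?u\<close> listed by
      \<open>h\<close>. Failing to defend \<open>Neg \<phi>\<close> there means that the strategy
      contained in \<open>?u\<close> does answer \<open>x\<close>.\<close>
    then have "\<not> H ?N e G (Fs (cty ?N) Nat ` set_of (rty ?NN) (h \<bullet> ?c))"
      using R_Imp_mk[of G ?N ze Bot e] G by simp
    then obtain w where w: "w \<in> set_of (rty ?NN) (h \<bullet> ?c)"
      and nR: "\<not> R ?N e (cl (fs_c (cty ?N) Nat) \<bullet> w) (set_of (rty ?N) (G \<bullet> (cl (fs_c (cty ?N) Nat) \<bullet> w)))"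
      unfolding H_def by blast
    have wD: "ok w \<and> tp w = rty ?NN" using set_of_D[OF w] * G by simp
    let ?u = "cl (fs_c (cty ?N) Nat) \<bullet> w"
    have "cl (mk_c (cty \<phi>) Nat) \<bullet> x \<bullet> ze \<in> set_of (rty ?N) (G \<bullet> ?u)"
    proof -
      have "G \<bullet> ?u = eval (e'((1, cty ?N) := ?u)) (sing (mk ?x Zero))"
        using * wD unfolding G_def by (subst beta) simp_all
      then show ?thesis using * wD by (simp only:) (rule in_sing, simp_all)
    qed
    moreover have "cl (fs_c (cty \<phi>) Nat) \<bullet> (cl (mk_c (cty \<phi>) Nat) \<bullet> x \<bullet> ze) = x" using * by simp
    ultimately have "x \<in> Fs (cty \<phi>) Nat ` set_of (rty ?N) (G \<bullet> ?u)" by (metis imageI)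
    then have R: "R \<phi> e x (set_of (rty \<phi>) (cl (fs_c (aty \<phi>) Nat) \<bullet> ?u \<bullet> x))"
      using nR unfolding R_Imp H_def by auto
    show "R \<phi> e x (set_of (rty \<phi>) (eval e' ?t))"
    proof (rule R_mono[OF R], rule subsetI)
      fix a assume "a \<in> set_of (rty \<phi>) (cl (fs_c (aty \<phi>) Nat) \<bullet> ?u \<bullet> x)"
      then show "a \<in> set_of (rty \<phi>) (eval e' ?t)"
        by (intro in_bind[where a = w]) (use * w wD in \<open>simp_all add: G_def\<close>)
    qed
  qed simp_all
qed

text \<open>Strategies compose: \<open>g\<close> and \<open>h\<close> combine to a strategy
  \<open>Z\<close> for \<open>\<psi>\<close>, and \<open>f\<close> is asked with \<open>h\<close>,
  \<open>Z\<close> and the challenge \<open>x\<close>. The difficulty is to list in advance all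
  challenges that this composition raises.\<close>

lemma V_S: "((\<phi> \<^bold>\<longrightarrow> \<psi> \<^bold>\<longrightarrow> \<chi>) \<^bold>\<longrightarrow> (\<phi> \<^bold>\<longrightarrow> \<psi>) \<^bold>\<longrightarrow> \<phi> \<^bold>\<longrightarrow> \<chi>) \<in> V"
proof -
  let ?A = "\<phi> \<^bold>\<longrightarrow> \<psi> \<^bold>\<longrightarrow> \<chi>" and ?B = "\<phi> \<^bold>\<longrightarrow> \<psi>" and ?C = "\<psi> \<^bold>\<longrightarrow> \<chi>"
  let ?f = "v 10 (aty ?A)" and ?g = "v 11 (aty ?B)" and ?h = "v 12 (aty \<phi>)"
    and ?x = "v 13 (cty \<chi>)"
  let ?Z = "lam (1, cty \<psi>) (bind (2, rty ?B) (?g \<cdot> mk ?h (v 1 (cty \<psi>))) (sing (sn_c (cty \<phi>) (rty \<psi>) \<cdot> v 2 (rty ?B))))"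
  let ?ch = "mk ?h (mk ?Z ?x)"
  let ?Q = "?f \<cdot> ?ch" and ?z = "v 3 (rty ?A)"
  let ?a = "fs_c (cty \<phi>) (rty ?C) \<cdot> ?z"
  let ?b = "fs_c (cty \<psi>) (rty \<chi>) \<cdot> (sn_c (cty \<phi>) (rty ?C) \<cdot> ?z)"
  let ?d = "sn_c (cty \<psi>) (rty \<chi>) \<cdot> (sn_c (cty \<phi>) (rty ?C) \<cdot> ?z)"
  let ?b3 = "\<lambda>t. bind (3, rty ?A) ?Q t"
  let ?tA = "sing ?ch" and ?tB = "?b3 (sing (mk ?h ?b))"
  let ?tC1 = "?b3 (sing ?a)"
  \<comment> \<open>The premise \<open>\<phi>\<close> is challenged twice over: directly by the
    reply of \<open>f\<close>, and by \<open>g\<close> whenever \<open>f\<close> challenges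
    \<open>\<psi>\<close> through \<open>Z\<close>.\<close>
  let ?tC2 = "?b3 (bind (4, rty ?B) (?g \<cdot> mk ?h ?b) (sing (fs_c (cty \<phi>) (rty \<psi>) \<cdot> v 4 (rty ?B))))"
  let ?tC = "cat_c (cty \<phi>) \<cdot> ?tC1 \<cdot> ?tC2"
  let ?tE = "?b3 (sing ?d)"
  show ?thesis
  proof (rule V_intro3[where tA = ?tA and tB = ?tB and tC = ?tC and tE = ?tE])
    fix e f g h x e'
    assume *: "env e" "ok f" "tp f = aty ?A" "ok g" "tp g = aty ?B"
      "ok h" "tp h = aty \<phi>" "ok x" "tp x = cty \<chi>" "env e'"
      "e' (10, aty ?A) = f" "e' (11, aty ?B) = g"
      "e' (12, aty \<phi>) = h" "e' (13, cty \<chi>) = x"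
      and HA: "H ?A e f (set_of (cty ?A) (eval e' ?tA))"
      and HB: "H ?B e g (set_of (cty ?B) (eval e' ?tB))"
      and HC: "H \<phi> e h (set_of (cty \<phi>) (eval e' ?tC))"
    define Z where "Z = eval e' ?Z"
    define ch where "ch = cl (mk_c (aty \<phi>) (cty ?C)) \<bullet> h \<bullet> (cl (mk_c (aty \<psi>) (cty \<chi>)) \<bullet> Z \<bullet> x)"
    define Q where "Q = set_of (rty ?A) (f \<bullet> ch)"
    let ?fa = "Fs (cty \<phi>) (rty ?C)" and ?sa = "Sn (cty \<phi>) (rty ?C)"
    let ?fb = "Fs (cty \<psi>) (rty \<chi>)" and ?sb = "Sn (cty \<psi>) (rty \<chi>)"
    let ?mb = "\<lambda>b. cl (mk_c (aty \<phi>) (cty \<psi>)) \<bullet> h \<bullet> b"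
    have Z: "ok Z" "tp Z = aty \<psi>" using * by (simp_all add: Z_def)
    have ch: "eval e' ?ch = ch" "ok ch" "tp ch = cty ?A" using * Z by (simp_all add: ch_def Z_def)
    have Q: "Q = set_of (snd (3, rty ?A)) (eval e' ?Q)" using * unfolding Q_def ch(1)[symmetric] by simp
    have QD: "ok z \<and> tp z = rty ?A" if "z \<in> Q" for z
      using set_of_D[of z "rty ?A" "f \<bullet> ch"] that * ch unfolding Q_def by simp
    have inQ: "z \<in> set_of (snd (3, rty ?A)) (eval e' ?Q)" if "z \<in> Q" for z
      using that by (subst Q[symmetric])
    have Z_app: "w \<in> set_of (rty \<psi>) (Z \<bullet> b)"
      if "b \<in> D (cty \<psi>)" "u \<in> set_of (rty ?B) (g \<bullet> ?mb b)" "w = cl (sn_c (cty \<phi>) (rty \<psi>)) \<bullet> u" for b u w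
    proof -
      have u: "ok u \<and> tp u = rty ?B" using set_of_D[OF that(2)] * that(1) by simp
      have "Z \<bullet> b = eval (e'((1, cty \<psi>) := b)) (bind (2, rty ?B) (?g \<cdot> mk ?h (v 1 (cty \<psi>))) (sing (sn_c (cty \<phi>) (rty \<psi>) \<cdot> v 2 (rty ?B))))"
        using * that unfolding Z_def by (subst beta) simp_all
      moreover have "w \<in> set_of (rty \<psi>) \<dots>"
        by (intro in_bind[where a = u] in_sing) (use * that u in simp_all)
      ultimately show ?thesis by simp
    qed
    have inE: "?sb (?sa z) \<in> set_of (rty \<chi>) (eval e' ?tE)" if "z \<in> Q" for z
      by (intro in_bind[where a = z, OF inQ[OF that]] in_sing) (use * QD[OF that] in simp_all)
    have inC1: "?fa z \<in> set_of (cty \<phi>) (eval e' ?tC)" if "z \<in> Q" for z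
      by (rule in_cat, rule disjI1, intro in_bind[where a = z, OF inQ[OF that]] in_sing)
        (use * QD[OF that] in simp_all)
    have inB: "?mb (?fb (?sa z)) \<in> set_of (cty ?B) (eval e' ?tB)" if "z \<in> Q" for z
      by (intro in_bind[where a = z, OF inQ[OF that]] in_sing) (use * QD[OF that] in simp_all)
    have inC2: "cl (fs_c (cty \<phi>) (rty \<psi>)) \<bullet> u \<in> set_of (cty \<phi>) (eval e' ?tC)"
      if "z \<in> Q" "u \<in> set_of (rty ?B) (g \<bullet> ?mb (?fb (?sa z)))" for z u
    proof -
      have u: "ok u \<and> tp u = rty ?B" using set_of_D[OF that(2)] * QD[OF that(1)] by simp
      show ?thesis
        by (rule in_cat, rule disjI2, intro in_bind[where a = z, OF inQ[OF that(1)]] in_bind[where a = u] in_sing)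
          (use * QD[OF that(1)] that u in simp_all)
    qed
    have "ch \<in> set_of (cty ?A) (eval e' ?tA)"
      by (rule in_sing) (use * ch in simp_all)
    then have "R ?A e ch Q" unfolding Q_def by (rule HD[OF HA])
    then have RA: "H \<phi> e h (?fa ` Q) \<longrightarrow> H \<psi> e Z (?fb ` ?sa ` Q) \<longrightarrow> R \<chi> e x (?sb ` ?sa ` Q)"
      unfolding ch_def using R_Imp_mk[of h \<phi> _ ?C e Q] R_Imp_mk[of Z \<psi> x \<chi> e "?sa ` Q"] * Z by simp
    have "H \<psi> e Z (?fb ` ?sa ` Q)"
      unfolding H_def
    proof clarify
      fix z assume z: "z \<in> Q"
      let ?b = "?fb (?sa z)" let ?U = "set_of (rty ?B) (g \<bullet> ?mb (?fb (?sa z)))"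
      have bD: "?b \<in> D (cty \<psi>)" using QD[OF z] by simp
      have "H \<phi> e h (Fs (cty \<phi>) (rty \<psi>) ` ?U)"
        by (rule H_mono[OF HC]) (use inC2[OF z] in blast)
      then have "R \<psi> e ?b (Sn (cty \<phi>) (rty \<psi>) ` ?U)"
        using HD[OF HB inB[OF z]] R_Imp_mk[of h \<phi> ?b \<psi> e ?U] * bD by simp
      then show "R \<psi> e ?b (set_of (rty \<psi>) (Z \<bullet> ?b))"
        by (rule R_mono) (use Z_app[OF bD] in blast)
    qed
    moreover have "H \<phi> e h (?fa ` Q)" by (rule H_mono[OF HC]) (use inC1 in blast)
    ultimately have "R \<chi> e x (?sb ` ?sa ` Q)" using RA by blast
    then show "R \<chi> e x (set_of (rty \<chi>) (eval e' ?tE))"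
      by (rule R_mono) (use inE in blast)
  qed simp_all
qed

interpretation V: hilbert UNIV V
  by unfold_locales (use V_K V_S V_DN V_mp in auto)

lemma V_taut:
  assumes "\<And>h. \<not> h Bot \<Longrightarrow> (\<And>a b. h (a \<^bold>\<longrightarrow> b) = (h a \<longrightarrow> h b)) \<Longrightarrow> (\<And>a. a \<in> V \<Longrightarrow> h a) \<Longrightarrow> h \<phi>"
  shows "\<phi> \<in> V"
  by (rule V.taut) (use assms in auto)

lemma V_taut1:
  assumes "\<psi> \<in> V" "\<And>h. \<not> h Bot \<Longrightarrow> (\<And>a b. h (a \<^bold>\<longrightarrow> b) = (h a \<longrightarrow> h b)) \<Longrightarrow> h \<psi> \<Longrightarrow> h \<phi>"
  shows "\<phi> \<in> V"
  by (rule V_taut) (use assms in auto)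

lemma logic_V: "\<phi> \<in> logic_ax \<Longrightarrow> wff \<phi> \<Longrightarrow> tr \<phi> \<in> V"
proof (induction rule: logic_ax.cases)
  case (11 t x \<phi>')
  then show ?case using V_inst[of t x "tr \<phi>'"] by (simp add: tr_subst)
next
  \<comment> \<open>Existence is translated as a negated universal, so this axiom is the
    contrapositive of an instance of \<open>V_inst\<close> for the negated formula.\<close>
  case (12 t x \<phi>')
  then have "(Forall x (Neg (tr \<phi>')) \<^bold>\<longrightarrow> Neg (tr (subst x t \<phi>'))) \<in> V"
    using V_inst[of t x "Neg (tr \<phi>')"] by (simp add: tr_subst)
  from V_taut1[OF this, of "tr \<phi>"] show ?case using 12 by auto
qed (auto intro!: V_taut)

lemma provable_V:
  assumes "provable EPA_st_lang Ax \<phi>" and "\<And>\<psi>. \<psi> \<in> Ax \<Longrightarrow> wff \<psi> \<Longrightarrow> tr \<psi> \<in> V"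
  shows "wff \<phi> \<and> tr \<phi> \<in> V"
  using assms(1)
proof induction
  case (mp \<phi> \<psi>)
  then show ?case using V_mp[of "tr \<phi>" "tr \<psi>"] by simp
next
  case (gen_Forall \<phi> \<psi> x)
  then show ?case using V_gen[of "tr \<phi>" "tr \<psi>" x] by simp
next
  case (gen_Exists \<psi> \<phi> x)
  then have "(tr \<psi> \<^bold>\<longrightarrow> tr \<phi>) \<in> V" by simp
  from V_taut1[OF this, of "Neg (tr \<phi>) \<^bold>\<longrightarrow> Neg (tr \<psi>)"]
  have "(Neg (tr \<phi>) \<^bold>\<longrightarrow> Neg (tr \<psi>)) \<in> V" by auto
  then have "(Neg (tr \<phi>) \<^bold>\<longrightarrow> Forall x (Neg (tr \<psi>))) \<in> V" using gen_Exists by (intro V_gen) auto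
  from V_taut1[OF this, of "tr (Exists x \<psi> \<^bold>\<longrightarrow> \<phi>)"]
  show ?case using gen_Exists by auto
qed (use logic_V assms(2) in auto)

end

lemma internal_Foralls [simp]: "internal (Foralls xs \<phi>) = internal \<phi>"
  and internal_Existss [simp]: "internal (Existss xs \<phi>) = internal \<phi>"
  by (induction xs) auto

lemma fv_Foralls: "fv (Foralls xs \<phi>) = fv \<phi> - set xs" and fv_ForallSts: "fv (ForallSts xs \<phi>) = fv \<phi> - set xs"
  by (induction xs) auto

lemma wff_Foralls [simp]: "wff (Foralls xs \<phi>) = wff \<phi>"
  and wff_Existss [simp]: "wff (Existss xs \<phi>) = wff \<phi>"
  by (induction xs) auto

section \<open>The nonlogical axioms except external induction\<close>

lemma EPA_ax_internal: "\<phi> \<in> EPA_ax \<Longrightarrow> internal \<phi>"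
  by (induction rule: EPA_ax.induct) auto

lemma internal_le [simp]: "internal (le s t)" and internal_mem [simp]: "internal (mem s t)"
  by (auto simp: le_def mem_def Let_def)

lemma tr_le [simp]: "tr (le s t) = le s t"
  by (simp add: le_def)

context model
begin

lemma zr_app [simp]: "a \<in> D \<sigma> \<Longrightarrow> zr (\<sigma> \<rightarrow>\<^sub>t \<tau>) \<bullet> a = zr \<tau>"
  by (simp add: zr_simps)

text \<open>The zero element added to a list of pairs projects to zero, so zero is among the
  challenges that such a list tests.\<close>

lemma fs_zr [simp]: "cl (fs_c \<sigma> \<tau>) \<bullet> zr (pr \<sigma> \<tau>) = zr \<sigma>"
proof (induction \<sigma> \<tau> rule: pr.induct)
  case (1 \<sigma> \<tau> \<rho>)
  show ?case
    by (rule ext[of _ \<sigma> \<tau>]) (use 1 in \<open>simp_all add: fs_app pr.simps\<close>)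
qed (simp_all add: fs_app pr.simps zr_simps(1))

lemma zr_Nat [simp]: "zr Nat = ze"
  by (simp add: zr_simps)

lemma EPA_ax_V: "\<phi> \<in> EPA_ax \<Longrightarrow> wff \<phi> \<Longrightarrow> tr \<phi> \<in> V"
  using sat_ax EPA_ax_internal by (intro V_internal) auto

lemma EQ_ax_V: "\<phi> \<in> EQ_ax \<Longrightarrow> tr \<phi> \<in> V"
  by (induction rule: EQ_ax.induct) (auto intro!: V_taut)

section \<open>Standardness as membership in lists\<close>

lemma V_curry: "(\<phi> \<^bold>\<longrightarrow> \<psi> \<^bold>\<longrightarrow> \<chi>) \<in> V \<Longrightarrow> (Neg (\<phi> \<^bold>\<longrightarrow> Neg \<psi>) \<^bold>\<longrightarrow> \<chi>) \<in> V"
  by (rule V_taut1) auto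

lemma H_St: "H (St t) e f C \<longleftrightarrow> (\<forall>c\<in>C. eval e t \<in> set_of (tyof t) (f \<bullet> c))"
  unfolding H_def by simp

text \<open>Every list of numbers counts \<open>ze\<close> among its members, so the list of
  candidates can always be taken at \<open>ze\<close>.\<close>

lemma H_St_ze: "H (St t) e f (set_of Nat y) \<Longrightarrow> eval e t \<in> set_of (tyof t) (f \<bullet> ze)"
  using zr_set_of[of Nat y] unfolding H_St by auto

lemma St_eq_V: 
  assumes "tyof s = tyof t" shows "(St s \<^bold>\<longrightarrow> s \<^bold>= t \<^bold>\<longrightarrow> St t) \<in> V"
proof (rule V_intro2[where tB = Zero and tC = Zero and tE = "v 11 (Nat \<rightarrow>\<^sub>t tyof t) \<cdot> Zero"])
  fix e g h x e'
  assume *: "e' (11, aty (St s)) = g" "H (St s) e g (set_of (cty (St s)) (eval e' Zero))"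
    "H (s \<^bold>= t) e h (set_of (cty (s \<^bold>= t)) (eval e' Zero))"
  then have "eval e s = eval e t" unfolding H_def set_of_def by auto
  then show "R (St t) e x (set_of (rty (St t)) (eval e' (v 11 (Nat \<rightarrow>\<^sub>t tyof t) \<cdot> Zero)))"
    using H_St_ze[of s e g] * assms by simp
qed (use assms in auto)

lemma St_closed_V:
  assumes "wt t" "fvt t = {}" shows "St t \<in> V"
proof (rule V_intro[of e0 "sing t"])
  fix e x assume x: "env e" "x \<in> D (cty (St t))"
  have "eval e t = eval (e0((0, cty (St t)) := x)) t"
    by (rule eval_cong) (simp add: assms)
  then have "eval e t \<in> set_of (tyof t) (eval (e0((0, cty (St t)) := x)) (sing t))"
    using x assms by (intro in_sing) auto
  then show "R (St t) e x (set_of (rty (St t)) (eval (e0((0, cty (St t)) := x)) (sing t)))" by simp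
qed (use assms in simp_all)

text \<open>If \<open>s\<close> and \<open>t\<close> occur in two lists, then their application
  occurs in the list of all applications of members of the first to members of the second.\<close>

lemma St_App_V:
  assumes "wt (s \<cdot> t)" shows "(St s \<^bold>\<longrightarrow> St t \<^bold>\<longrightarrow> St (s \<cdot> t)) \<in> V"
proof -
  obtain \<tau> where ty: "tyof s = tyof t \<rightarrow>\<^sub>t \<tau>" "wt s" "wt t" using assms by auto
  let ?g = "v 11 (Nat \<rightarrow>\<^sub>t tyof s)" and ?h = "v 12 (Nat \<rightarrow>\<^sub>t tyof t)"
  let ?t = "bind (1, tyof s) (?g \<cdot> Zero) (bind (2, tyof t) (?h \<cdot> Zero) (sing (v 1 (tyof s) \<cdot> v 2 (tyof t))))"
  show ?thesis
  proof (rule V_intro2[where tB = Zero and tC = Zero and tE = ?t])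
    fix e g h x e'
    assume *: "env e" "env e'" "e' (11, aty (St s)) = g" "e' (12, aty (St t)) = h"
      "ok g" "tp g = aty (St s)" "ok h" "tp h = aty (St t)"
      "H (St s) e g (set_of (cty (St s)) (eval e' Zero))"
      "H (St t) e h (set_of (cty (St t)) (eval e' Zero))"
    have "eval e s \<in> set_of (tyof s) (g \<bullet> ze)" "eval e t \<in> set_of (tyof t) (h \<bullet> ze)"
      using H_St_ze[of s e g] H_St_ze[of t e h] * by simp_all
    then have "eval e (s \<cdot> t) \<in> set_of \<tau> (eval e' ?t)"
      by (intro in_bind[where a = "eval e s"] in_bind[where a = "eval e t"] in_sing) (use * ty in simp_all)
    then show "R (St (s \<cdot> t)) e x (set_of (rty (St (s \<cdot> t))) (eval e' ?t))" using ty by simp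
  qed (use ty in simp_all)
qed

lemma St_le_V:
  assumes "wff (le t s)" shows "(St s \<^bold>\<longrightarrow> le t s \<^bold>\<longrightarrow> St t) \<in> V"
proof -
  have ty: "tyof s = Nat" "tyof t = Nat" "wt s" "wt t" using assms by (auto simp: le_def)
  let ?g = "v 11 (Nat \<rightarrow>\<^sub>t Nat)"
  \<comment> \<open>Every candidate for \<open>s\<close> is replaced by all numbers up to
    it.\<close>
  let ?t = "bind (1, Nat) (?g \<cdot> Zero) (down_c \<cdot> v 1 Nat)"
  have cr: "cty (le t s) = Nat" "rty (le t s) = Nat" by (simp_all add: le_def)
  show ?thesis
  proof (rule V_intro2[where tB = Zero and tC = Zero and tE = ?t])
    fix e g h x e'
    assume *: "env e" "env e'" "e' (11, aty (St s)) = g"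
      "ok g" "tp g = aty (St s)"
      "H (St s) e g (set_of (cty (St s)) (eval e' Zero))"
      "H (le t s) e h (set_of (cty (le t s)) (eval e' Zero))"
    have s: "eval e s \<in> set_of Nat (g \<bullet> ze)"
      using H_St_ze[of s e g] * ty by simp
    have "sat e (le t s)" using H_internal[of "le t s" "set_of (cty (le t s)) (eval e' Zero)" e h] * by simp
    then have le: "sub (eval e t) (eval e s) = ze" by (simp add: le_def)
    have "eval e t \<in> set_of Nat (eval e' ?t)"
      by (intro in_bind[where a = "eval e s"]) (use s le * ty set_down[of "eval e t" "eval e s"] in simp_all)
    then show "R (St t) e x (set_of (rty (St t)) (eval e' ?t))" using ty by simp
  qed (use ty cr in simp_all)
qed

lemma T_st_ax_V: "\<phi> \<in> T_st_ax \<Longrightarrow> wff \<phi> \<Longrightarrow> tr \<phi> \<in> V"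
  by (induction rule: T_st_ax.induct) (auto intro!: V_curry St_eq_V St_closed_V St_App_V St_le_V)

text \<open>Prepending zero turns the convention of \<open>set_of\<close> into genuine membership,
  which is what the relation \<open>mem\<close> in the axioms refers to.\<close>

lemma memM_cat_sing: "a \<in> set_of \<sigma> y \<Longrightarrow> y \<in> D \<sigma> \<Longrightarrow> memM \<sigma> a (cl (cat_c \<sigma>) \<bullet> (cl (sing_c \<sigma>) \<bullet> zr \<sigma>) \<bullet> y)"
  using memM_sing[of "zr \<sigma>" \<sigma>] by (intro memM_cat) (auto simp: set_of_def)

text \<open>A challenge to an external universal carries a list of candidates for the variable. If
  it is not met and the matrix is internal, a counterexample occurs in that list; this is how
  witnesses are extracted.\<close>

lemma not_R_ForallSt:
  assumes "\<not> R (Forall y (St (Var y) \<^bold>\<longrightarrow> tr \<phi>)) e z (set_of (pr Nat (rty (tr \<phi>))) s)" "internal \<phi>"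
  obtains b where "b \<in> D (snd y)" "b \<in> set_of (snd y) (cl (fs_c (Nat \<rightarrow>\<^sub>t snd y) (cty (tr \<phi>))) \<bullet> z \<bullet> ze)"
    "\<not> sat (e(y := b)) \<phi>"
proof -
  let ?S = "set_of (pr Nat (rty (tr \<phi>))) s"
  obtain b where b: "b \<in> D (snd y)" "\<not> R (St (Var y) \<^bold>\<longrightarrow> tr \<phi>) (e(y := b)) z ?S"
    using assms(1) by (simp only: R.simps) blast
  then have *: "H (St (Var y)) (e(y := b)) (cl (fs_c (Nat \<rightarrow>\<^sub>t snd y) (cty (tr \<phi>))) \<bullet> z) (Fs Nat (rty (tr \<phi>)) ` ?S)"
    and n: "\<not> sat (e(y := b)) \<phi>"
    using assms(2) by (simp_all add: R_Imp R_internal)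
  have "cl (fs_c Nat (rty (tr \<phi>))) \<bullet> zr (pr Nat (rty (tr \<phi>))) = ze" by simp
  then have "ze \<in> Fs Nat (rty (tr \<phi>)) ` ?S" by (metis imageI zr_set_of)
  then have "b \<in> set_of (snd y) (cl (fs_c (Nat \<rightarrow>\<^sub>t snd y) (cty (tr \<phi>))) \<bullet> z \<bullet> ze)"
    using * unfolding H_St by auto
  then show ?thesis using that b(1) n by blast
qed

text \<open>Any element \<open>b\<close> of \<open>M\<close> can be substituted for a standard
  variable, by challenging with lists that contain \<open>b\<close>.\<close>

lemma R_ForallSt_inst:
  assumes "R (Forall y (St (Var y) \<^bold>\<longrightarrow> \<phi>)) e (cl (mk_c (Nat \<rightarrow>\<^sub>t \<sigma>) (cty \<phi>)) \<bullet> n \<bullet> u) S"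
    and "ok n" "tp n = Nat \<rightarrow>\<^sub>t \<sigma>" "ok u" "tp u = cty \<phi>" "b \<in> D (\<sigma>)" "S \<subseteq> D (pr Nat (rty \<phi>))"
    and n: "\<And>c. c \<in> N \<Longrightarrow> b \<in> set_of (\<sigma>) (n \<bullet> c)"
    and "snd y = \<sigma>"
  shows "R \<phi> (e(y := b)) u (Sn Nat (rty \<phi>) ` S)"
proof -
  have "R (St (Var y) \<^bold>\<longrightarrow> \<phi>) (e(y := b)) (cl (mk_c (Nat \<rightarrow>\<^sub>t \<sigma>) (cty \<phi>)) \<bullet> n \<bullet> u) S"
    using assms(1,6,9) by (simp only: R.simps) blast
  moreover have "H (St (Var y)) (e(y := b)) n (Fs Nat (rty \<phi>) ` S)"
    unfolding H_St using n assms(2,3,7,9) by auto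
  ultimately show ?thesis using R_Imp_mk[of n "St (Var y)" u \<phi> "e(y := b)" S] assms(2-5,9) by simp
qed

text \<open>The reply of \<open>h\<close> to one fixed challenge does not depend on
  \<open>x\<close>. Joining all candidate lists in it gives a sequence \<open>Y\<close> containing,
  for every \<open>x\<close>, some \<open>y\<close> that violates \<open>\<phi>\<close>. The
  hypothesis \<open>g\<close>, challenged with the list consisting of \<open>Y\<close>, provides an
  \<open>x\<close> for which no member of \<open>Y\<close> does, a contradiction.\<close>

lemma I_V:
  assumes "internal \<phi>" "snd y' = snd y" "distinct [x, y, y']" "y' \<notin> fv \<phi>"
  shows "tr (ForallSt y' (Exists x (Forall y (mem (Var y) (Var y') \<^bold>\<longrightarrow> \<phi>)))
      \<^bold>\<longrightarrow> Exists x (ForallSt y \<phi>)) \<in> V"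
proof -
  let ?\<sigma> = "snd y"
  let ?\<psi> = "Exists x (Forall y (mem (Var y) (Var y') \<^bold>\<longrightarrow> \<phi>))"
  let ?HF = "Forall y' (St (Var y') \<^bold>\<longrightarrow> tr ?\<psi>)"
  let ?G = "Forall y (St (Var y) \<^bold>\<longrightarrow> tr \<phi>)"
  let ?CF = "Forall x (Neg ?G)"
  let ?h = "v 12 (aty ?CF)"
  \<comment> \<open>Since \<open>\<phi>\<close> is internal, an arbitrary strategy may be offered
    for \<open>?G\<close>; only the challenges listed in the reply matter.\<close>
  let ?chC = "mk (zero_c (aty ?G)) Zero"
  let ?Y' = "bind (1, rty ?CF) (?h \<cdot> ?chC) (fs_c (Nat \<rightarrow>\<^sub>t ?\<sigma>) (cty (tr \<phi>)) \<cdot> (fs_c (cty ?G) Nat \<cdot> v 1 (rty ?CF)) \<cdot> Zero)"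
  let ?Y = "cat_c ?\<sigma> \<cdot> (sing_c ?\<sigma> \<cdot> zero_c ?\<sigma>) \<cdot> ?Y'"
  let ?n = "lam (2, Nat) (sing ?Y)"
  let ?chH = "mk ?n (zero_c (cty (tr ?\<psi>)))"
  have "(?HF \<^bold>\<longrightarrow> ?CF \<^bold>\<longrightarrow> Bot) \<in> V"
  proof (rule V_intro2[where tB = "sing ?chH" and tC = "sing ?chC" and tE = Zero])
    fix e g h u e'
    assume *: "env e" "env e'" "ok g" "tp g = aty ?HF" "ok h" "tp h = aty ?CF"
      "e' (12, aty ?CF) = h"
      and HH: "H ?HF e g (set_of (cty ?HF) (eval e' (sing ?chH)))"
      and HC: "H ?CF e h (set_of (cty ?CF) (eval e' (sing ?chC)))"
    let ?zz = "zr (aty ?G)"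
    let ?c = "cl (mk_c (aty ?G) Nat) \<bullet> ?zz \<bullet> ze"
    let ?S = "set_of (rty ?CF) (h \<bullet> ?c)"
    define Y where "Y = eval e' ?Y"
    define n where "n = eval e' ?n"
    have YD: "ok Y" "tp Y = ?\<sigma>" "ok n" "tp n = Nat \<rightarrow>\<^sub>t ?\<sigma>" using * assms(2) by (simp_all add: Y_def n_def)
    have "?c \<in> set_of (cty ?CF) (eval e' (sing ?chC))" by (rule in_sing) (use * in simp_all)
    then have RC: "R ?CF e ?c ?S" by (rule HD[OF HC])
    have ex: "\<exists>b\<in>D ?\<sigma>. memM ?\<sigma> b Y \<and> \<not> sat (e(x := a, y := b)) \<phi>" if a: "a \<in> D (snd x)" for a
    proof -
      have "R (Neg ?G) (e(x := a)) ?c ?S" using RC a by (simp only: R.simps) blast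
      then have "\<not> H ?G (e(x := a)) ?zz (Fs (cty ?G) Nat ` ?S)"
        using R_Imp_mk[of ?zz ?G ze Bot] by simp
      then obtain z where z: "z \<in> ?S" and nR: "\<not> R ?G (e(x := a)) (cl (fs_c (cty ?G) Nat) \<bullet> z)
          (set_of (rty ?G) (?zz \<bullet> (cl (fs_c (cty ?G) Nat) \<bullet> z)))"
        unfolding H_def by blast
      have zD: "ok z \<and> tp z = rty ?CF" using set_of_D[OF z] * by simp
      obtain b where b: "b \<in> D ?\<sigma>" "\<not> sat (e(x := a, y := b)) \<phi>"
        and bz: "b \<in> set_of ?\<sigma> (cl (fs_c (Nat \<rightarrow>\<^sub>t ?\<sigma>) (cty (tr \<phi>))) \<bullet> (cl (fs_c (cty ?G) Nat) \<bullet> z) \<bullet> ze)"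
        by (rule not_R_ForallSt[of y \<phi>]) (use nR assms(1) in simp_all)
      have "b \<in> set_of ?\<sigma> (eval e' ?Y')"
        by (intro in_bind[where a = z]) (use z zD bz * in simp_all)
      then have "memM ?\<sigma> b Y" using memM_cat_sing[of b ?\<sigma> "eval e' ?Y'"] * by (simp add: Y_def)
      then show ?thesis using b by blast
    qed
    let ?c = "cl (mk_c (Nat \<rightarrow>\<^sub>t ?\<sigma>) (cty (tr ?\<psi>))) \<bullet> n \<bullet> zr (cty (tr ?\<psi>))"
    have cD: "ok ?c" "tp ?c = cty ?HF" using YD assms(2) by simp_all
    have "?c \<in> set_of (cty ?HF) (eval e' (sing ?chH))"
      by (rule in_sing) (use * assms(2) in \<open>simp_all add: n_def\<close>)
    then have "R ?HF e ?c (set_of (rty ?HF) (g \<bullet> ?c))" by (rule HD[OF HH])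
    then have "R (tr ?\<psi>) (e(y' := Y)) (zr (cty (tr ?\<psi>))) (Sn Nat (rty (tr ?\<psi>)) ` set_of (rty ?HF) (g \<bullet> ?c))"
    proof (rule R_ForallSt_inst[where n = n and \<sigma> = ?\<sigma>])
      fix c assume c: "c \<in> N"
      then have "n \<bullet> c = eval (e'((2, Nat) := c)) (sing ?Y)" using * unfolding n_def by (subst beta) simp_all
      moreover have "Y \<in> set_of ?\<sigma> \<dots>" by (rule in_sing) (use * c in \<open>simp_all add: Y_def\<close>)
      ultimately show "Y \<in> set_of ?\<sigma> (n \<bullet> c)" by simp
    qed (use YD assms(2) cD * set_of_D[of _ "rty ?HF" "g \<bullet> ?c"] in \<open>auto\<close>)
    then have "sat (e(y' := Y)) ?\<psi>" using assms(1) by (subst (asm) R_internal) auto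
    then obtain a where a: "a \<in> D (snd x)"
      and "\<And>b. b \<in> D ?\<sigma> \<Longrightarrow> sat (e(y' := Y, x := a, y := b)) (mem (Var y) (Var y')) \<Longrightarrow> sat (e(y' := Y, x := a, y := b)) \<phi>"
      by auto
    moreover have "e(y' := Y, x := a, y := b) = e(x := a, y := b, y' := Y)" for b
      using assms(3) by (auto simp: fun_eq_iff)
    ultimately have "\<And>b. b \<in> D ?\<sigma> \<Longrightarrow> memM ?\<sigma> b Y \<Longrightarrow> sat (e(x := a, y := b)) \<phi>"
      using YD assms(2,3,4) * by (simp add: sat_upd_fresh)
    then show "R Bot e u (set_of (rty Bot) (eval e' Zero))" using ex[OF a] by blast
  qed (use assms(2) in simp_all)
  then show ?thesis by simp
qed

lemma I_ax_V: "\<phi> \<in> I_ax \<Longrightarrow> tr \<phi> \<in> V"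
  by (induction rule: I_ax.induct) (rule I_V)

text \<open>\<open>F\<close> maps \<open>x\<close> to the candidates for \<open>y\<close> found in
  the reply of \<open>g\<close> to the list \<open>[x]\<close>, and the sequence \<open>[F]\<close>
  is offered as \<open>Y\<close>. The reply of \<open>h\<close> contains a list of candidates
  \<open>x\<close>, at one of which \<open>\<psi>\<close> would fail. The hypothesis behind
  \<open>g\<close> is used only at these \<open>x\<close>, and it puts a suitable \<open>y\<close>
  into \<open>F x\<close>.\<close>

lemma HAC_core_V:
  assumes "internal \<phi>" "snd Y = snd x \<rightarrow>\<^sub>t snd y" "distinct [x, y, Y]" "Y \<notin> fv \<phi>"
  defines "\<psi> \<equiv> Exists y (mem (Var y) (sapp_c (snd x) (snd y) \<cdot> Var Y \<cdot> Var x) \<^bold>\<and> \<phi>)"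
  shows "(Forall x (St (Var x) \<^bold>\<longrightarrow> Neg (Forall y (St (Var y) \<^bold>\<longrightarrow> tr (Neg \<phi>)))) \<^bold>\<longrightarrow>
    Forall Y (St (Var Y) \<^bold>\<longrightarrow> Neg (Forall x (St (Var x) \<^bold>\<longrightarrow> tr \<psi>))) \<^bold>\<longrightarrow> Bot) \<in> V"
proof -
  let ?\<sigma> = "snd x" and ?\<tau> = "snd y"
  let ?G1 = "Forall y (St (Var y) \<^bold>\<longrightarrow> tr (Neg \<phi>))" and ?G2 = "Forall x (St (Var x) \<^bold>\<longrightarrow> tr \<psi>)"
  let ?HF = "Forall x (St (Var x) \<^bold>\<longrightarrow> Neg ?G1)" and ?CF = "Forall Y (St (Var Y) \<^bold>\<longrightarrow> Neg ?G2)"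
  let ?g = "v 11 (aty ?HF)" and ?h = "v 12 (aty ?CF)"
  let ?oG1 = "mk (zero_c (aty ?G1)) Zero" and ?oG2 = "mk (zero_c (aty ?G2)) Zero"
  let ?a = "v 6 ?\<sigma>"
  let ?n = "lam (5, Nat) (sing ?a)"
  let ?chH = "mk ?n ?oG1"
  \<comment> \<open>The candidates for \<open>y\<close> when \<open>x\<close> is the value of
    variable 6: each response of \<open>g\<close> contains a challenge to \<open>?G1\<close>, and
    that challenge carries a list.\<close>
  let ?F' = "bind (7, rty ?HF) (?g \<cdot> ?chH) (fs_c (Nat \<rightarrow>\<^sub>t ?\<tau>) (cty (tr (Neg \<phi>))) \<cdot>
    (fs_c (cty ?G1) Nat \<cdot> (sn_c Nat (rty (Neg ?G1)) \<cdot> v 7 (rty ?HF))) \<cdot> Zero)"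
  let ?F = "lam (6, ?\<sigma>) (cat_c ?\<tau> \<cdot> (sing_c ?\<tau> \<cdot> zero_c ?\<tau>) \<cdot> ?F')"
  let ?W = "sing ?F"
  let ?m = "lam (8, Nat) (sing ?W)"
  let ?chC = "mk ?m ?oG2"
  \<comment> \<open>The places at which \<open>h\<close> tests the offered choice sequence;
    \<open>g\<close> will be challenged at each of them.\<close>
  let ?X = "bind (9, rty ?CF) (?h \<cdot> ?chC) (fs_c (Nat \<rightarrow>\<^sub>t ?\<sigma>) (cty (tr \<psi>)) \<cdot>
    (fs_c (cty ?G2) Nat \<cdot> (sn_c Nat (rty (Neg ?G2)) \<cdot> v 9 (rty ?CF))) \<cdot> Zero)"
  show "(?HF \<^bold>\<longrightarrow> ?CF \<^bold>\<longrightarrow> Bot) \<in> V"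
  proof (rule V_intro2[where tB = "bind (6, ?\<sigma>) ?X (sing ?chH)" and tC = "sing ?chC" and tE = Zero])
    fix e g h u e'
    assume *: "env e" "env e'" "ok g" "tp g = aty ?HF" "ok h" "tp h = aty ?CF"
      "e' (11, aty ?HF) = g" "e' (12, aty ?CF) = h"
      and HH: "H ?HF e g (set_of (cty ?HF) (eval e' (bind (6, ?\<sigma>) ?X (sing ?chH))))"
      and HC: "H ?CF e h (set_of (cty ?CF) (eval e' (sing ?chC)))"
    let ?z1 = "zr (aty ?G1)" and ?z2 = "zr (aty ?G2)"
    let ?o1 = "cl (mk_c (aty ?G1) Nat) \<bullet> ?z1 \<bullet> ze" and ?o2 = "cl (mk_c (aty ?G2) Nat) \<bullet> ?z2 \<bullet> ze"
    define F W m where "F = eval e' ?F" and "W = eval e' ?W" and "m = eval e' ?m"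
    have D[simp]: "ok F" "tp F = ?\<sigma> \<rightarrow>\<^sub>t ?\<tau>" "ok W" "tp W = ?\<sigma> \<rightarrow>\<^sub>t ?\<tau>" "ok m" "tp m = Nat \<rightarrow>\<^sub>t ?\<sigma> \<rightarrow>\<^sub>t ?\<tau>"
      using * by (simp_all add: F_def W_def m_def)
    have W: "W = cl (sing_c (?\<sigma> \<rightarrow>\<^sub>t ?\<tau>)) \<bullet> F" by (simp add: W_def F_def)
    let ?c2 = "cl (mk_c (Nat \<rightarrow>\<^sub>t ?\<sigma> \<rightarrow>\<^sub>t ?\<tau>) (cty (Neg ?G2))) \<bullet> m \<bullet> ?o2"
    let ?S2 = "set_of (rty ?CF) (h \<bullet> ?c2)"
    have c2D: "ok ?c2" "tp ?c2 = cty ?CF" using assms(2) by simp_all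
    have S2D: "?S2 \<subseteq> D (pr Nat (rty (Neg ?G2)))"
      using c2D * set_of_D[of _ "rty ?CF" "h \<bullet> ?c2"] by auto
    have "?c2 \<in> set_of (cty ?CF) (eval e' (sing ?chC))"
      by (rule in_sing) (use * assms(2) in \<open>simp_all add: m_def\<close>)
    then have "R ?CF e ?c2 ?S2" by (rule HD[OF HC])
    then have "R (Neg ?G2) (e(Y := W)) ?o2 (Sn Nat (rty (Neg ?G2)) ` ?S2)"
    proof (rule R_ForallSt_inst[where n = m and \<sigma> = "?\<sigma> \<rightarrow>\<^sub>t ?\<tau>"])
      fix c assume c: "c \<in> N"
      then have "m \<bullet> c = eval (e'((8, Nat) := c)) (sing ?W)" using * unfolding m_def by (subst beta) simp_all
      moreover have "W \<in> set_of (?\<sigma> \<rightarrow>\<^sub>t ?\<tau>) \<dots>" by (rule in_sing) (use * c in \<open>simp_all add: W_def\<close>)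
      ultimately show "W \<in> set_of (?\<sigma> \<rightarrow>\<^sub>t ?\<tau>) (m \<bullet> c)" by simp
    qed (use assms(2) S2D in simp_all)
    then have "\<not> H ?G2 (e(Y := W)) ?z2 (Fs (cty ?G2) Nat ` Sn Nat (rty (Neg ?G2)) ` ?S2)"
      using R_Imp_mk[of ?z2 ?G2 ze Bot] by simp
    then obtain w where w: "w \<in> ?S2"
      and nR2: "\<not> R ?G2 (e(Y := W)) (cl (fs_c (cty ?G2) Nat) \<bullet> (cl (sn_c Nat (rty (Neg ?G2))) \<bullet> w))
        (set_of (rty ?G2) (?z2 \<bullet> (cl (fs_c (cty ?G2) Nat) \<bullet> (cl (sn_c Nat (rty (Neg ?G2))) \<bullet> w))))"
      unfolding H_def by blast
    have wD: "ok w \<and> tp w = rty ?CF" using S2D w by auto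
    have "internal \<psi>" using assms(1) by (simp add: \<psi>_def)
    obtain a where aD: "a \<in> D ?\<sigma>" and n\<psi>: "\<not> sat (e(Y := W, x := a)) \<psi>"
      and aw: "a \<in> set_of ?\<sigma> (cl (fs_c (Nat \<rightarrow>\<^sub>t ?\<sigma>) (cty (tr \<psi>))) \<bullet> (cl (fs_c (cty ?G2) Nat) \<bullet>
         (cl (sn_c Nat (rty (Neg ?G2))) \<bullet> w)) \<bullet> ze)"
      by (rule not_R_ForallSt[of x \<psi>]) (use nR2 \<open>internal \<psi>\<close> in simp_all)
    have aX: "a \<in> set_of (snd (6, ?\<sigma>)) (eval e' ?X)"
      unfolding snd_conv by (intro in_bind[where a = w]) (use w wD aw * assms(2) in \<open>simp_all add: m_def\<close>)
    define n where "n = eval (e'((6, ?\<sigma>) := a)) ?n"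
    have nD[simp]: "ok n" "tp n = Nat \<rightarrow>\<^sub>t ?\<sigma>" using * aD by (simp_all add: n_def)
    let ?c1 = "cl (mk_c (Nat \<rightarrow>\<^sub>t ?\<sigma>) (cty (Neg ?G1))) \<bullet> n \<bullet> ?o1"
    let ?S1 = "set_of (rty ?HF) (g \<bullet> ?c1)"
    have c1D: "ok ?c1" "tp ?c1 = cty ?HF" by simp_all
    have S1D: "?S1 \<subseteq> D (pr Nat (rty (Neg ?G1)))"
      using c1D * set_of_D[of _ "rty ?HF" "g \<bullet> ?c1"] by auto
    have "?c1 \<in> set_of (cty ?HF) (eval e' (bind (6, ?\<sigma>) ?X (sing ?chH)))"
      by (rule in_bind[where a = a, OF aX], rule in_sing) (use * aD assms(2) in \<open>simp_all add: n_def\<close>)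
    then have "R ?HF e ?c1 ?S1" by (rule HD[OF HH])
    then have "R (Neg ?G1) (e(x := a)) ?o1 (Sn Nat (rty (Neg ?G1)) ` ?S1)"
    proof (rule R_ForallSt_inst[where n = n and \<sigma> = ?\<sigma>])
      fix c assume c: "c \<in> N"
      then have "n \<bullet> c = eval (e'((6, ?\<sigma>) := a, (5, Nat) := c)) (sing ?a)" using * aD unfolding n_def by (subst beta) simp_all
      moreover have "a \<in> set_of ?\<sigma> \<dots>" by (rule in_sing) (use * c aD in simp_all)
      ultimately show "a \<in> set_of ?\<sigma> (n \<bullet> c)" by simp
    qed (use S1D aD in simp_all)
    then have "\<not> H ?G1 (e(x := a)) ?z1 (Fs (cty ?G1) Nat ` Sn Nat (rty (Neg ?G1)) ` ?S1)"
      using R_Imp_mk[of ?z1 ?G1 ze Bot] by simp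
    then obtain w' where w': "w' \<in> ?S1"
      and nR1: "\<not> R ?G1 (e(x := a)) (cl (fs_c (cty ?G1) Nat) \<bullet> (cl (sn_c Nat (rty (Neg ?G1))) \<bullet> w'))
        (set_of (rty ?G1) (?z1 \<bullet> (cl (fs_c (cty ?G1) Nat) \<bullet> (cl (sn_c Nat (rty (Neg ?G1))) \<bullet> w'))))"
      unfolding H_def by blast
    have w'D: "ok w' \<and> tp w' = rty ?HF" using S1D w' by auto
    obtain b where bD: "b \<in> D ?\<tau>" and b: "\<not> sat (e(x := a, y := b)) (Neg \<phi>)"
      and bw: "b \<in> set_of ?\<tau> (cl (fs_c (Nat \<rightarrow>\<^sub>t ?\<tau>) (cty (tr (Neg \<phi>)))) \<bullet> (cl (fs_c (cty ?G1) Nat) \<bullet>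
         (cl (sn_c Nat (rty (Neg ?G1))) \<bullet> w')) \<bullet> ze)"
      by (rule not_R_ForallSt[of y "Neg \<phi>"]) (use nR1 assms(1) in simp_all)
    let ?e' = "e'((6, ?\<sigma>) := a)"
    have "b \<in> set_of ?\<tau> (eval ?e' ?F')"
      by (intro in_bind[where a = w']) (use w' w'D bw * aD in \<open>simp_all add: n_def\<close>)
    then have "memM ?\<tau> b (eval ?e' (cat_c ?\<tau> \<cdot> (sing_c ?\<tau> \<cdot> zero_c ?\<tau>) \<cdot> ?F'))"
      using memM_cat_sing[of b ?\<tau> "eval ?e' ?F'"] * aD by simp
    moreover have "F \<bullet> a = eval ?e' (cat_c ?\<tau> \<cdot> (sing_c ?\<tau> \<cdot> zero_c ?\<tau>) \<cdot> ?F')"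
      using * aD unfolding F_def by (subst beta) simp_all
    ultimately have "memM ?\<tau> b (F \<bullet> a)" by simp
    then have mem: "memM ?\<tau> b (cl (sapp_c ?\<sigma> ?\<tau>) \<bullet> W \<bullet> a)" unfolding W using aD by (intro memM_sapp_sing) simp_all
    have "e(Y := W, x := a, y := b) = e(x := a, y := b, Y := W)"
      using assms(3) by (auto simp: fun_eq_iff)
    then have "sat (e(Y := W, x := a, y := b)) \<phi>" using b assms(4) by (simp add: sat_upd_fresh)
    then have "sat (e(Y := W, x := a)) \<psi>" using mem assms(2,3) aD bD * unfolding \<psi>_def by auto
    then show "R Bot e u (set_of (rty Bot) (eval e' Zero))" using n\<psi> by blast
  qed (use assms(2) in simp_all)
qed

lemma set_of_subset: "y \<in> D \<sigma> \<Longrightarrow> set_of \<sigma> y \<subseteq> D \<sigma>"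
  using set_of_D[of _ \<sigma> y] by auto

lemma V_taut2:
  assumes "\<psi> \<in> V" "\<chi> \<in> V"
    "\<And>h. \<not> h Bot \<Longrightarrow> (\<And>a b. h (a \<^bold>\<longrightarrow> b) = (h a \<longrightarrow> h b)) \<Longrightarrow> h \<psi> \<Longrightarrow> h \<chi> \<Longrightarrow> h \<phi>"
  shows "\<phi> \<in> V"
  by (rule V_taut) (use assms in auto)

lemma V_Forall_mono:
  assumes "(\<phi> \<^bold>\<longrightarrow> \<psi>) \<in> V" shows "(Forall x \<phi> \<^bold>\<longrightarrow> Forall x \<psi>) \<in> V"
proof (rule V_gen)
  have "(Forall x \<phi> \<^bold>\<longrightarrow> \<phi>) \<in> V" using V_inst[of "Var x" x \<phi>] by simp
  then show "(Forall x \<phi> \<^bold>\<longrightarrow> \<psi>) \<in> V" by (rule V_taut2[OF assms]) simp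
qed simp

text \<open>It remains to reconcile \<open>HAC_core_V\<close> with the double negations that
  \<open>tr\<close> leaves under \<open>ExistsSt\<close>, by tautologies below universal
  quantifiers.\<close>

lemma HAC_int_ax_V: "\<phi> \<in> HAC_int_ax \<Longrightarrow> tr \<phi> \<in> V"
proof (induction rule: HAC_int_ax.induct)
  case (1 \<phi> Y x y)
  let ?\<psi> = "Exists y (mem (Var y) (sapp_c (snd x) (snd y) \<cdot> Var Y \<cdot> Var x) \<^bold>\<and> \<phi>)"
  let ?A = "St (Var y) \<^bold>\<longrightarrow> tr (Neg \<phi>)" and ?B = "Forall x (St (Var x) \<^bold>\<longrightarrow> tr ?\<psi>)"
  have "(Forall y ?A \<^bold>\<longrightarrow> Forall y (Neg (Neg ?A))) \<in> V"
    by (rule V_Forall_mono[OF V_taut]) auto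
  from V_taut1[OF this, of "(St (Var x) \<^bold>\<longrightarrow> Neg (Forall y (Neg (Neg ?A)))) \<^bold>\<longrightarrow> (St (Var x) \<^bold>\<longrightarrow> Neg (Forall y ?A))"]
  have "((St (Var x) \<^bold>\<longrightarrow> Neg (Forall y (Neg (Neg ?A)))) \<^bold>\<longrightarrow> (St (Var x) \<^bold>\<longrightarrow> Neg (Forall y ?A))) \<in> V" by auto
  then have "(Forall x (St (Var x) \<^bold>\<longrightarrow> Neg (Forall y (Neg (Neg ?A)))) \<^bold>\<longrightarrow> Forall x (St (Var x) \<^bold>\<longrightarrow> Neg (Forall y ?A))) \<in> V"
    by (rule V_Forall_mono)
  then have "(Forall x (St (Var x) \<^bold>\<longrightarrow> Neg (Forall y (Neg (Neg ?A)))) \<^bold>\<longrightarrow> Forall Y (St (Var Y) \<^bold>\<longrightarrow> Neg ?B) \<^bold>\<longrightarrow> Bot) \<in> V"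
    by (rule V_taut2[OF _ HAC_core_V[OF 1]]) simp
  moreover have "(Forall Y (Neg (Neg (St (Var Y) \<^bold>\<longrightarrow> Neg ?B))) \<^bold>\<longrightarrow> Forall Y (St (Var Y) \<^bold>\<longrightarrow> Neg ?B)) \<in> V"
    by (rule V_Forall_mono[OF V_taut]) auto
  ultimately show ?case by (rule V_taut2) auto
qed

text \<open>A counterexample in \<open>M\<close> becomes one challenge that no list of responses
  meets: at every quantifier the challenge offers the one-element list holding the counterexample.
  It serves as a response for \<open>PF_TP_ax\<close> and refutes alleged realizers in
  \<open>ForallSts_sat\<close>.\<close>

lemma not_R_ForallSts:
  assumes "internal \<phi>" "\<not> sat e (Foralls xs \<phi>)"
  shows "\<exists>u \<in> D (cty (tr (ForallSts xs \<phi>))). \<forall>S. S \<noteq> {} \<longrightarrow> S \<subseteq> D (rty (tr (ForallSts xs \<phi>))) \<longrightarrow>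
    \<not> R (tr (ForallSts xs \<phi>)) e u S"
  using assms(2)
proof (induction xs arbitrary: e)
  case Nil
  then show ?case using R_internal[OF assms(1)] by (intro bexI[of _ "zr (cty (tr \<phi>))"]) auto
next
  case (Cons x xs)
  let ?\<Phi> = "tr (ForallSts xs \<phi>)"
  obtain a where a: "a \<in> D (snd x)" "\<not> sat (e(x := a)) (Foralls xs \<phi>)" using Cons.prems by auto
  obtain u where u: "u \<in> D (cty ?\<Phi>)" and nR: "\<And>S. S \<noteq> {} \<Longrightarrow> S \<subseteq> D (rty ?\<Phi>) \<Longrightarrow> \<not> R ?\<Phi> (e(x := a)) u S"
    using Cons.IH[OF a(2)] by blast
  define n where "n = eval (e0((1, snd x) := a)) (lam (0, Nat) (sing (v 1 (snd x))))"
  have n: "ok n" "tp n = Nat \<rightarrow>\<^sub>t snd x" using a by (simp_all add: n_def)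
  have "a \<in> set_of (snd x) (n \<bullet> c)" if "c \<in> N" for c
    using that a set_sing[of a "snd x"] by (simp add: n_def)
  then have "\<not> R (tr (ForallSts (x # xs) \<phi>)) e (cl (mk_c (Nat \<rightarrow>\<^sub>t snd x) (cty ?\<Phi>)) \<bullet> n \<bullet> u) S"
    if S: "S \<noteq> {}" "S \<subseteq> D (pr Nat (rty ?\<Phi>))" for S
  proof -
    have "Sn Nat (rty ?\<Phi>) ` S \<subseteq> D (rty ?\<Phi>)" using S(2) by auto
    then show ?thesis
      using R_ForallSt_inst[of x ?\<Phi> e "snd x" n u S a] nR[of "Sn Nat (rty ?\<Phi>) ` S"] S a n u \<open>\<And>c. c \<in> N \<Longrightarrow> _\<close>
      by auto
  qed
  then show ?case
    using n u by (intro bexI[of _ "cl (mk_c (Nat \<rightarrow>\<^sub>t snd x) (cty ?\<Phi>)) \<bullet> n \<bullet> u"]) auto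
qed

lemma ForallSts_sat:
  assumes "internal \<phi>" "tr (ForallSts xs \<phi>) \<in> V" "env e" shows "sat e (Foralls xs \<phi>)"
proof (rule ccontr)
  assume "\<not> sat e (Foralls xs \<phi>)"
  then obtain u where u: "u \<in> D (cty (tr (ForallSts xs \<phi>)))"
    "\<And>S. S \<noteq> {} \<Longrightarrow> S \<subseteq> D (rty (tr (ForallSts xs \<phi>))) \<Longrightarrow> \<not> R (tr (ForallSts xs \<phi>)) e u S"
    using not_R_ForallSts[OF assms(1)] by blast
  obtain T where T: "realizes T (tr (ForallSts xs \<phi>))" using assms(2) unfolding V_def by blast
  then have "T \<bullet> u \<in> D (rty (tr (ForallSts xs \<phi>)))" using u(1) unfolding realizes_def by simp
  then have "set_of (rty (tr (ForallSts xs \<phi>))) (T \<bullet> u) \<subseteq> D (rty (tr (ForallSts xs \<phi>)))"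
    by (rule set_of_subset)
  then have "\<not> R (tr (ForallSts xs \<phi>)) e u (set_of (rty (tr (ForallSts xs \<phi>))) (T \<bullet> u))"
    by (rule u(2)[OF set_of_nonempty])
  then show False using T u(1) assms(3) unfolding realizes_def by blast
qed

lemma PF_TP_ax_V: "\<phi> \<in> PF_TP_ax \<Longrightarrow> tr \<phi> \<in> V"
proof (induction rule: PF_TP_ax.induct)
  case (1 \<phi> xs)
  let ?A = "tr (ForallSts xs \<phi>)" and ?B = "tr (Foralls xs \<phi>)"
  show ?case
  proof (cases "sat e0 (Foralls xs \<phi>)")
    case True
    \<comment> \<open>The axiom admits no parameters, so truth in one environment is truth in all;
      with parameters the case distinction would depend on the environment, which a realizer cannot
      see.\<close>
    have "sat e (Foralls xs \<phi>)" for e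
      using True sat_cong[of "Foralls xs \<phi>" e e0] 1 by (auto simp: fv_Foralls)
    then have "?B \<in> V" using 1 by (intro V_internal) auto
    then show ?thesis using V_taut1[of ?B "?A \<^bold>\<longrightarrow> ?B"] by auto
  next
    case False
    then obtain u where u: "u \<in> D (cty ?A)" and nR: "\<And>S. S \<noteq> {} \<Longrightarrow> S \<subseteq> D (rty ?A) \<Longrightarrow> \<not> R ?A e0 u S"
      using not_R_ForallSts[OF 1(1)] by blast
    \<comment> \<open>The realizer names the challenge \<open>u\<close> as a parameter, the value of
      variable 1.\<close>
    let ?e = "e0((1, cty ?A) := u)"
    have "(?A \<^bold>\<longrightarrow> ?B) \<in> V"
    proof (rule V_intro[of ?e "sing (mk (v 1 (cty ?A)) (zero_c (rty ?B)))"])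
      fix e p assume p: "env e" "p \<in> D (cty (?A \<^bold>\<longrightarrow> ?B))"
      let ?t = "sing (mk (v 1 (cty ?A)) (zero_c (rty ?B)))" and ?e' = "?e((0, cty (?A \<^bold>\<longrightarrow> ?B)) := p)"
      let ?S = "set_of (rty (?A \<^bold>\<longrightarrow> ?B)) (eval ?e' ?t)"
      let ?n = "cl (fs_c (aty ?A) (cty ?B)) \<bullet> p"
      have "cl (mk_c (cty ?A) (rty ?B)) \<bullet> u \<bullet> zr (rty ?B) \<in> ?S"
        by (rule in_sing) (use u p in simp_all)
      moreover have "cl (fs_c (cty ?A) (rty ?B)) \<bullet> (cl (mk_c (cty ?A) (rty ?B)) \<bullet> u \<bullet> zr (rty ?B)) = u"
        using u by simp
      ultimately have "u \<in> Fs (cty ?A) (rty ?B) ` ?S" by (metis imageI)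
      moreover have "set_of (rty ?A) (?n \<bullet> u) \<subseteq> D (rty ?A)" by (rule set_of_subset) (use u p in simp)
      then have "\<not> R ?A e u (set_of (rty ?A) (?n \<bullet> u))"
        using nR[of "set_of (rty ?A) (?n \<bullet> u)"] R_cong[of ?A e e0] 1 by (auto simp: fv_ForallSts)
      ultimately show "R (?A \<^bold>\<longrightarrow> ?B) e p ?S" unfolding R_Imp H_def by blast
    qed (use u in simp_all)
    then show ?thesis by simp
  qed
qed

end

section \<open>External induction\<close>

fun vars :: "fm \<Rightarrow> var set" where
  "vars (s \<^bold>= t) = fvt s \<union> fvt t"
| "vars Bot = {}"
| "vars (\<phi> \<^bold>\<and> \<psi>) = vars \<phi> \<union> vars \<psi>"
| "vars (\<phi> \<^bold>\<or> \<psi>) = vars \<phi> \<union> vars \<psi>"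
| "vars (\<phi> \<^bold>\<longrightarrow> \<psi>) = vars \<phi> \<union> vars \<psi>"
| "vars (Forall x \<phi>) = insert x (vars \<phi>)"
| "vars (Exists x \<phi>) = insert x (vars \<phi>)"
| "vars (St t) = fvt t"
| "vars (ForallSt x \<phi>) = insert x (vars \<phi>)"
| "vars (ExistsSt x \<phi>) = insert x (vars \<phi>)"

lemma fv_notin [simp]: "z \<notin> vars \<phi> \<Longrightarrow> z \<notin> fv \<phi>"
  by (induction \<phi>) auto

lemma finite_vars [simp]: "finite (vars \<phi>)"
  by (induction \<phi>) auto

lemma fv_vars: "fv \<phi> \<subseteq> vars \<phi>"
  by (induction \<phi>) auto

lemma fresh_name:
  assumes "finite (A :: var set)" obtains m where "\<And>n \<sigma>. m \<le> n \<Longrightarrow> (n, \<sigma>) \<notin> A"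
proof -
  obtain k where "\<forall>n \<in> fst ` A. n \<le> k"
    using assms finite_nat_set_iff_bounded_le[of "fst ` A"] by blast
  then show ?thesis using that[of "Suc k"] by force
qed

lemma wff_tr [simp]: "wff (tr \<phi>) = wff \<phi>"
  by (induction \<phi>) auto

lemma wff_le [simp]: "wt s \<Longrightarrow> wt t \<Longrightarrow> tyof s = Nat \<Longrightarrow> tyof t = Nat \<Longrightarrow> wff (le s t)"
  by (simp add: le_def)

lemma wff_mem [simp]: "wt s \<Longrightarrow> wt t \<Longrightarrow> tyof s = tyof t \<Longrightarrow> wff (mem s t)"
  by (simp add: mem_def Let_def)

section \<open>Internal definability\<close>

context model
begin

definition dfn :: "((var \<Rightarrow> 'a) \<Rightarrow> bool) \<Rightarrow> bool" where
  "dfn P \<longleftrightarrow> (\<exists>\<phi>. wff \<phi> \<and> internal \<phi> \<and> (\<forall>e. env e \<longrightarrow> sat e \<phi> = P e))"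

lemma dfnI: "wff \<phi> \<Longrightarrow> internal \<phi> \<Longrightarrow> (\<And>e. env e \<Longrightarrow> sat e \<phi> = P e) \<Longrightarrow> dfn P"
  unfolding dfn_def by blast

lemma dfn_cong: "dfn P \<Longrightarrow> (\<And>e. env e \<Longrightarrow> P e = Q e) \<Longrightarrow> dfn Q"
  unfolding dfn_def by metis

lemma dfn_imp: "dfn P \<Longrightarrow> dfn Q \<Longrightarrow> dfn (\<lambda>e. P e \<longrightarrow> Q e)"
  unfolding dfn_def by (metis wff.simps(5) internal.simps(5) sat.simps(5))

lemma dfn_all:
  assumes "dfn P" shows "dfn (\<lambda>e. \<forall>a\<in>D (snd y). P (e(y := a)))"
proof -
  obtain \<phi> where "wff \<phi>" "internal \<phi>" "\<And>e. env e \<Longrightarrow> sat e \<phi> = P e" using assms unfolding dfn_def by blast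
  then show ?thesis by (intro dfnI[of "Forall y \<phi>"]) auto
qed

text \<open>Substitution is expressed by quantifying over \<open>z\<close> with the premise
  \<open>z = t\<close>, which avoids renaming bound variables of the defining formula.\<close>

lemma dfn_subst:
  assumes "dfn P" "wt t" "tyof t = snd z" "z \<notin> fvt t" shows "dfn (\<lambda>e. P (e(z := eval e t)))"
proof -
  have "dfn (\<lambda>e. eval e (Var z) = eval e t \<longrightarrow> P e)"
    by (rule dfn_imp[OF _ assms(1)]) (rule dfnI[of "Var z \<^bold>= t"], use assms in auto)
  from dfn_all[OF this, of z] show ?thesis
    by (rule dfn_cong) (use assms in auto)
qed

text \<open>Induction in the model is available for internal formulas only, so \<open>R\<close> has to be internally
  definable; the element \<open>e (n3, _)\<close> absorbs the projections that \<open>R\<close> applies to response sets.\<close>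

lemma dfn_R:
  assumes "wff \<phi>" "\<And>\<sigma>. (n1, \<sigma>) \<notin> vars \<phi>" "\<And>\<sigma>. (n2, \<sigma>) \<notin> vars \<phi>" "\<And>\<sigma>. (n3, \<sigma>) \<notin> vars \<phi>"
    "distinct [n1, n2, n3]"
  shows "dfn (\<lambda>e. R \<phi> e (e (n1, cty \<phi>)) ((\<lambda>z. e (n3, \<rho> \<rightarrow>\<^sub>t rty \<phi>) \<bullet> z) ` set_of \<rho> (e (n2, \<rho>))))"
  using assms
proof (induction \<phi> arbitrary: n1 n2 n3 \<rho>)
  case (Eq s t)
  then show ?case by (intro dfnI[of "s \<^bold>= t"]) auto
next
  case Bot
  then show ?case by (intro dfnI[of Bot]) auto
next
  case (St t)
  obtain m where m: "\<And>\<sigma>. (m, \<sigma>) \<notin> fvt t \<union> {(n2, \<rho>), (n3, \<rho> \<rightarrow>\<^sub>t tyof t)}"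
    by (rule fresh_name[of "fvt t \<union> {(n2, \<rho>), (n3, \<rho> \<rightarrow>\<^sub>t tyof t)}"], simp, blast)
  \<comment> \<open>The disjunction is membership in \<open>set_of\<close>, written in the object
    language.\<close>
  let ?F = "Exists (m, \<rho>) ((mem (v m \<rho>) (v n2 \<rho>) \<^bold>\<or> v m \<rho> \<^bold>= zero_c \<rho>) \<^bold>\<and> t \<^bold>= v n3 (\<rho> \<rightarrow>\<^sub>t tyof t) \<cdot> v m \<rho>)"
  show ?case
  proof (rule dfnI[of ?F])
    fix e assume e: "env e"
    have "sat e ?F \<longleftrightarrow> (\<exists>a\<in>D \<rho>. a \<in> set_of \<rho> (e (n2, \<rho>)) \<and> eval e t = e (n3, \<rho> \<rightarrow>\<^sub>t tyof t) \<bullet> a)"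
      using e m[of \<rho>] by (auto simp: set_of_def)
    moreover have "a \<in> D \<rho>" if "a \<in> set_of \<rho> (e (n2, \<rho>))" for a
      using set_of_D[OF that] e by simp
    ultimately show "sat e ?F = R (St t) e (e (n1, cty (St t))) ((\<lambda>z. e (n3, \<rho> \<rightarrow>\<^sub>t rty (St t)) \<bullet> z) ` set_of \<rho> (e (n2, \<rho>)))"
      by auto
  qed (use St in auto)
next
  case (Imp \<phi> \<psi>)
  \<comment> \<open>The three pairs are there to keep the new names different from
    \<open>n1\<close>, \<open>n2\<close> and \<open>n3\<close>; the type in them is
    arbitrary.\<close>
  let ?A = "vars \<phi> \<union> vars \<psi> \<union> {(n1, Nat), (n2, Nat), (n3, Nat)}"
  obtain m1 where m: "\<And>n \<sigma>. m1 \<le> n \<Longrightarrow> (n, \<sigma>) \<notin> ?A" by (rule fresh_name[of ?A], simp, blast)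
  define m2 m3 m4 where "m2 = Suc m1" and "m3 = Suc m2" and "m4 = Suc m3"
  note m_defs = m2_def m3_def m4_def
  have ms: "m1 \<notin> {n1,n2,n3}" "m2 \<notin> {n1,n2,n3,m1}" "m3 \<notin> {n1,n2,n3,m1,m2}" "m4 \<notin> {n1,n2,n3,m1,m2,m3}"
    "n1 \<notin> {m1,m2,m3,m4}" "n2 \<notin> {m1,m2,m3,m4}" "n3 \<notin> {m1,m2,m3,m4}" "m1 \<notin> {m2,m3,m4}" "m2 \<notin> {m3,m4}" "m3 \<noteq> m4"
    using m[of m1 Nat] m[of m2 Nat] m[of m3 Nat] m[of m4 Nat] by (auto simp: m_defs)
  have fr: "(m, \<sigma>) \<notin> vars \<phi>" "(m, \<sigma>) \<notin> vars \<psi>" "(m, \<sigma>) \<notin> fv \<phi>" "(m, \<sigma>) \<notin> fv \<psi>" if "m \<in> {m1, m2, m3, m4}" for m \<sigma>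
    using that m[of m \<sigma>] fv_vars[of \<phi>] fv_vars[of \<psi>] by (auto simp: m_defs)
  let ?c1 = "cty \<phi>" and ?r1 = "rty \<phi>" and ?c2 = "cty \<psi>" and ?r2 = "rty \<psi>"
  let ?vx = "v n1 (pr (?c1 \<rightarrow>\<^sub>t ?r1) ?c2)" and ?vy = "v n2 \<rho>" and ?vg = "v n3 (\<rho> \<rightarrow>\<^sub>t pr ?c1 ?r2)"
  let ?tw = "fs_c ?c1 ?r2 \<cdot> (?vg \<cdot> v m4 \<rho>)"
  let ?ty = "fs_c (?c1 \<rightarrow>\<^sub>t ?r1) ?c2 \<cdot> ?vx \<cdot> ?tw"
  \<comment> \<open>The premise is evaluated at a full response list, so its absorbed projection is
    the identity, whereas for the conclusion \<open>?g2\<close> composes the given projection with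
    \<open>sn_c\<close>.\<close>
  let ?id = "lam (0, ?r1) (v 0 ?r1)"
  let ?g2 = "lam (m4, \<rho>) (sn_c ?c1 ?r2 \<cdot> (?vg \<cdot> v m4 \<rho>))"
  let ?x2 = "sn_c (?c1 \<rightarrow>\<^sub>t ?r1) ?c2 \<cdot> ?vx"
  have IH1: "dfn (\<lambda>e. R \<phi> e (e (m1, ?c1)) ((\<lambda>z. e (m3, ?r1 \<rightarrow>\<^sub>t ?r1) \<bullet> z) ` set_of ?r1 (e (m2, ?r1))))"
    by (rule Imp.IH(1)) (use Imp.prems ms fr in auto)
  have IH2: "dfn (\<lambda>e. R \<psi> e (e (m1, ?c2)) ((\<lambda>z. e (m3, \<rho> \<rightarrow>\<^sub>t ?r2) \<bullet> z) ` set_of \<rho> (e (m2, \<rho>))))"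
    by (rule Imp.IH(2)) (use Imp.prems ms fr in auto)
  have id: "(\<lambda>z. eval e ?id \<bullet> z) ` set_of ?r1 y = set_of ?r1 y" if "env e" "y \<in> D ?r1" for e y
    using that set_of_D[of _ ?r1 y] by (auto simp: image_iff)
  have 1: "dfn (\<lambda>e. R \<phi> e (eval e ?tw) (set_of ?r1 (eval e ?ty)))"
  proof (rule dfn_cong[OF dfn_subst[OF dfn_subst[OF dfn_subst[OF IH1, of ?id "(m3, ?r1 \<rightarrow>\<^sub>t ?r1)"], of ?ty "(m2, ?r1)"], of ?tw "(m1, ?c1)"]])
    fix e assume e: "env e"
    let ?e3 = "e((m1, ?c1) := eval e ?tw)" let ?e2 = "?e3((m2, ?r1) := eval ?e3 ?ty)"
    let ?e1 = "?e2((m3, ?r1 \<rightarrow>\<^sub>t ?r1) := eval ?e2 ?id)"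
    have "R \<phi> ?e1 p S = R \<phi> e p S" for p S using fr by (simp add: R_upd_fresh)
    moreover have "?e1 (m1, ?c1) = eval e ?tw" "?e1 (m2, ?r1) = eval e ?ty" "?e1 (m3, ?r1 \<rightarrow>\<^sub>t ?r1) = eval ?e2 ?id"
      using ms by auto
    moreover have "env ?e2" "eval e ?ty \<in> D ?r1" using e ms by simp_all
    ultimately show "R \<phi> ?e1 (?e1 (m1, ?c1)) ((\<lambda>z. ?e1 (m3, ?r1 \<rightarrow>\<^sub>t ?r1) \<bullet> z) ` set_of ?r1 (?e1 (m2, ?r1))) =
      R \<phi> e (eval e ?tw) (set_of ?r1 (eval e ?ty))"
      using id[of ?e2 "eval e ?ty"] by (simp only:)
  qed (use ms in simp_all)
  have 2: "dfn (\<lambda>e. R \<psi> e (eval e ?x2) ((\<lambda>z. eval e ?g2 \<bullet> z) ` set_of \<rho> (e (n2, \<rho>))))"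
  proof (rule dfn_cong[OF dfn_subst[OF dfn_subst[OF dfn_subst[OF IH2, of ?g2 "(m3, \<rho> \<rightarrow>\<^sub>t ?r2)"], of ?vy "(m2, \<rho>)"], of ?x2 "(m1, ?c2)"]])
    fix e assume e: "env e"
    let ?e3 = "e((m1, ?c2) := eval e ?x2)" let ?e2 = "?e3((m2, \<rho>) := eval ?e3 ?vy)"
    let ?e1 = "?e2((m3, \<rho> \<rightarrow>\<^sub>t ?r2) := eval ?e2 ?g2)"
    have "R \<psi> ?e1 p S = R \<psi> e p S" for p S using fr by (simp add: R_upd_fresh)
    moreover have "eval ?e2 ?g2 = eval e ?g2" by (rule eval_cong) (use ms in auto)
    ultimately show "R \<psi> ?e1 (?e1 (m1, ?c2)) ((\<lambda>z. ?e1 (m3, \<rho> \<rightarrow>\<^sub>t ?r2) \<bullet> z) ` set_of \<rho> (?e1 (m2, \<rho>))) =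
      R \<psi> e (eval e ?x2) ((\<lambda>z. eval e ?g2 \<bullet> z) ` set_of \<rho> (e (n2, \<rho>)))"
      using ms by simp
  qed (use ms in simp_all)
  let ?in = "mem (v m4 \<rho>) ?vy \<^bold>\<or> v m4 \<rho> \<^bold>= zero_c \<rho>"
  have 3: "dfn (\<lambda>e. \<forall>a\<in>D (snd (m4, \<rho>)). (\<lambda>e. sat e ?in \<longrightarrow> R \<phi> e (eval e ?tw) (set_of ?r1 (eval e ?ty))) (e((m4, \<rho>) := a)))"
    by (rule dfn_all, rule dfn_imp[OF _ 1], rule dfnI[of ?in]) simp_all
  show ?case
  proof (rule dfn_cong[OF dfn_imp[OF 3 2]])
    fix e assume e: "env e"
    let ?S = "set_of \<rho> (e (n2, \<rho>))" and ?g = "e (n3, \<rho> \<rightarrow>\<^sub>t pr ?c1 ?r2)" and ?x = "e (n1, pr (?c1 \<rightarrow>\<^sub>t ?r1) ?c2)"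
    have SD: "a \<in> D \<rho>" if "a \<in> ?S" for a using set_of_D[OF that] e by simp
    let ?L = "\<forall>a\<in>D \<rho>. sat (e((m4, \<rho>) := a)) ?in \<longrightarrow> R \<phi> (e((m4, \<rho>) := a)) (eval (e((m4, \<rho>) := a)) ?tw) (set_of ?r1 (eval (e((m4, \<rho>) := a)) ?ty))"
    have "?L
      \<longleftrightarrow> (\<forall>a\<in>D \<rho>. a \<in> ?S \<longrightarrow> R \<phi> e (cl (fs_c ?c1 ?r2) \<bullet> (?g \<bullet> a)) (set_of ?r1 (cl (fs_c (?c1 \<rightarrow>\<^sub>t ?r1) ?c2) \<bullet> ?x \<bullet> (cl (fs_c ?c1 ?r2) \<bullet> (?g \<bullet> a)))))"
      using e ms fr by (auto simp: R_upd_fresh set_of_def)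
    also have "\<dots> \<longleftrightarrow> H \<phi> e (cl (fs_c (?c1 \<rightarrow>\<^sub>t ?r1) ?c2) \<bullet> ?x) (Fs ?c1 ?r2 ` (\<lambda>z. ?g \<bullet> z) ` ?S)"
      unfolding H_def using SD by blast
    finally have h: "?L
      \<longleftrightarrow> H \<phi> e (cl (fs_c (?c1 \<rightarrow>\<^sub>t ?r1) ?c2) \<bullet> ?x) (Fs ?c1 ?r2 ` (\<lambda>z. ?g \<bullet> z) ` ?S)" .
    have "eval e ?g2 \<bullet> z = cl (sn_c ?c1 ?r2) \<bullet> (?g \<bullet> z)" if "z \<in> ?S" for z
      using SD[OF that] e ms by simp
    then have im: "(\<lambda>z. eval e ?g2 \<bullet> z) ` ?S = Sn ?c1 ?r2 ` (\<lambda>z. ?g \<bullet> z) ` ?S"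
      by (auto simp: image_iff)
    have x2: "eval e ?x2 = cl (sn_c (?c1 \<rightarrow>\<^sub>t ?r1) ?c2) \<bullet> ?x" by simp
    show "((\<forall>a\<in>D (snd (m4, \<rho>)). (\<lambda>e. sat e ?in \<longrightarrow> R \<phi> e (eval e ?tw) (set_of ?r1 (eval e ?ty))) (e((m4, \<rho>) := a))) \<longrightarrow>
        R \<psi> e (eval e ?x2) ((\<lambda>z. eval e ?g2 \<bullet> z) ` set_of \<rho> (e (n2, \<rho>)))) =
      R (\<phi> \<^bold>\<longrightarrow> \<psi>) e (e (n1, cty (\<phi> \<^bold>\<longrightarrow> \<psi>))) ((\<lambda>z. e (n3, \<rho> \<rightarrow>\<^sub>t rty (\<phi> \<^bold>\<longrightarrow> \<psi>)) \<bullet> z) ` set_of \<rho> (e (n2, \<rho>)))"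
      unfolding R_Imp snd_conv h im x2 cty.simps rty.simps ..
  qed
next
  case (Forall y \<phi>)
  have "dfn (\<lambda>e. R \<phi> e (e (n1, cty \<phi>)) ((\<lambda>z. e (n3, \<rho> \<rightarrow>\<^sub>t rty \<phi>) \<bullet> z) ` set_of \<rho> (e (n2, \<rho>))))"
    by (rule Forall.IH) (use Forall.prems in auto)
  from dfn_all[OF this, of y] show ?case
    by (rule dfn_cong) (use Forall.prems in auto)
qed (auto intro: dfnI[of "Neg Bot"])

text \<open>The realizer is obtained by primitive recursion from those of the base and the step.\<close>

lemma V_ind:
  assumes wff: "wff \<Theta>" and x: "snd x = Nat" and base: "subst x Zero \<Theta> \<in> V"
    and step: "(St (Var x) \<^bold>\<longrightarrow> \<Theta> \<^bold>\<longrightarrow> subst x (Succ \<cdot> Var x) \<Theta>) \<in> V"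
  shows "(St (Var x) \<^bold>\<longrightarrow> \<Theta>) \<in> V"
proof -
  let ?c = "cty \<Theta>" and ?r = "rty \<Theta>" and ?\<Theta>' = "subst x (Succ \<cdot> Var x) \<Theta>"
  let ?I = "St (Var x) \<^bold>\<longrightarrow> \<Theta> \<^bold>\<longrightarrow> ?\<Theta>'"
  obtain T0 where T0: "realizes T0 (subst x Zero \<Theta>)" using base unfolding V_def by blast
  obtain T1 where T1: "realizes T1 ?I" using step unfolding V_def by blast
  have c: "cty ?\<Theta>' = ?c" "rty ?\<Theta>' = ?r" "cty (subst x Zero \<Theta>) = ?c" "rty (subst x Zero \<Theta>) = ?r" using x by simp_all
  note [simp] = x c
  have D [simp]: "ok T0" "tp T0 = aty \<Theta>" "ok T1" "tp T1 = aty ?I"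
    using T0 T1 c unfolding realizes_def by simp_all
  let ?n = "lam (4, Nat) (sing (v 2 Nat))"
  \<comment> \<open>The challenge to the step formula: the list \<open>[k]\<close> shows that
    \<open>k\<close> is standard, variable 1 holds the strategy already built for \<open>k\<close>,
    and variable 3 holds the challenge for \<open>k + 1\<close>.\<close>
  let ?q = "mk ?n (mk (v 1 (aty \<Theta>)) (v 3 ?c))"
  let ?b = "bind (5, rty ?I) (v 11 (aty ?I) \<cdot> ?q) (sing (sn_c ?c ?r \<cdot> (sn_c Nat (pr ?c ?r) \<cdot> v 5 (rty ?I))))"
  let ?Z = "Rc (aty \<Theta>) \<cdot> v 10 (aty \<Theta>) \<cdot> (lam (1, aty \<Theta>) (lam (2, Nat) (lam (3, ?c) ?b)))"
  let ?e = "e0((10, aty \<Theta>) := T0, (11, aty ?I) := T1)"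
  define Z where "Z = eval ?e ?Z"
  have e: "env ?e" using D by simp
  have b: "wt ?b" "tyof ?b = ?r" using x by simp_all
  have ZD [simp]: "ok Z" "tp Z = Nat \<rightarrow>\<^sub>t aty \<Theta>" using e b by (simp_all add: Z_def)
  have Z0: "Z \<bullet> ze = T0" using D e b by (simp add: Z_def)
  have ZS: "Z \<bullet> su k \<bullet> u = eval (?e((1, aty \<Theta>) := Z \<bullet> k, (2, Nat) := k, (3, ?c) := u)) ?b"
    if "k \<in> N" "u \<in> D ?c" for k u
  proof -
    let ?l = "lam (1, aty \<Theta>) (lam (2, Nat) (lam (3, ?c) ?b))"
    have "Z \<bullet> su k = eval ?e ?l \<bullet> (Z \<bullet> k) \<bullet> k"
      unfolding Z_def eval.simps using that D e b by (subst Rc_Succ) simp_all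
    also have "\<dots> = eval (?e((1, aty \<Theta>) := Z \<bullet> k)) (lam (2, Nat) (lam (3, ?c) ?b)) \<bullet> k"
      using that e b by (subst beta) simp_all
    also have "\<dots> = eval (?e((1, aty \<Theta>) := Z \<bullet> k, (2, Nat) := k)) (lam (3, ?c) ?b)"
      using that e b by (subst beta) simp_all
    finally show ?thesis using that e b by (simp only:) (subst beta, simp_all)
  qed
  have ind0: "R \<Theta> (e(x := ze)) u (set_of ?r (Z \<bullet> ze \<bullet> u))" if "env e" "u \<in> D ?c" for e u
  proof -
    have "R (subst x Zero \<Theta>) e u (set_of ?r (T0 \<bullet> u))" using T0 that unfolding realizes_def by simp
    then show ?thesis using R_subst[of x Zero \<Theta> e] unfolding Z0 by simp
  qed
  have indS: "R \<Theta> (e(x := su k)) u (set_of ?r (Z \<bullet> su k \<bullet> u))"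
    if e': "env e" and u: "u \<in> D ?c" and k: "k \<in> N" and IH: "\<forall>u \<in> D ?c. R \<Theta> (e(x := k)) u (set_of ?r (Z \<bullet> k \<bullet> u))" for e u k
  proof -
    let ?e2 = "?e((1, aty \<Theta>) := Z \<bullet> k, (2, Nat) := k, (3, ?c) := u)"
    define n where "n = eval ?e2 ?n"
    have e2: "env ?e2" using e k u by simp
    have nD: "ok n" "tp n = Nat \<rightarrow>\<^sub>t Nat" using e2 e k u by (simp_all add: n_def)
    let ?q' = "cl (mk_c (aty \<Theta>) ?c) \<bullet> (Z \<bullet> k) \<bullet> u"
    let ?Q = "cl (mk_c (Nat \<rightarrow>\<^sub>t Nat) (pr (aty \<Theta>) ?c)) \<bullet> n \<bullet> ?q'"
    let ?S = "set_of (rty ?I) (T1 \<bullet> ?Q)"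
    have QD: "ok ?Q" "tp ?Q = cty ?I" using nD k u x by simp_all
    have SD: "?S \<subseteq> D (rty ?I)" by (rule set_of_subset) (use D QD in simp)
    have "R ?I (e(x := k)) ?Q ?S" using T1 e' k x QD unfolding realizes_def by simp
    moreover have "H (St (Var x)) (e(x := k)) n (Fs Nat (pr ?c ?r) ` ?S)"
      unfolding H_St
    proof clarify
      fix z assume "z \<in> ?S"
      then have z: "z \<in> D (rty ?I)" using SD by blast
      have *: "cl (fs_c Nat (pr ?c ?r)) \<bullet> z \<in> N" using z x by simp
      then have "n \<bullet> (cl (fs_c Nat (pr ?c ?r)) \<bullet> z) = cl (sing_c Nat) \<bullet> k"
        using e2 k unfolding n_def by (subst beta) simp_all
      then show "eval (e(x := k)) (Var x) \<in> set_of (tyof (Var x)) (n \<bullet> (cl (fs_c Nat (pr ?c ?r)) \<bullet> z))"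
        using set_sing[OF k] x by simp
    qed
    moreover have "H \<Theta> (e(x := k)) (Z \<bullet> k) (Fs ?c ?r ` Sn Nat (pr ?c ?r) ` ?S)"
    proof -
      have "Fs ?c ?r ` Sn Nat (pr ?c ?r) ` ?S \<subseteq> D ?c"
        using SD x by auto
      then show ?thesis unfolding H_def using IH by blast
    qed
    ultimately have R: "R ?\<Theta>' (e(x := k)) u (Sn ?c ?r ` Sn Nat (pr ?c ?r) ` ?S)"
      using R_Imp_mk[of n "St (Var x)" ?q' "\<Theta> \<^bold>\<longrightarrow> ?\<Theta>'" "e(x := k)" ?S]
        R_Imp_mk[of "Z \<bullet> k" \<Theta> u ?\<Theta>' "e(x := k)" "Sn Nat (pr ?c ?r) ` ?S"] nD k u x by simp
    have "Sn ?c ?r ` Sn Nat (pr ?c ?r) ` ?S \<subseteq> set_of ?r (eval ?e2 ?b)"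
    proof (clarify)
      fix z assume z: "z \<in> ?S"
      then have zD: "z \<in> D (rty ?I)" using SD by blast
      have "T1 \<bullet> ?Q = eval ?e2 (v 11 (aty ?I) \<cdot> ?q)" by (simp add: n_def)
      then have z': "z \<in> set_of (snd (5, rty ?I)) (eval ?e2 (v 11 (aty ?I) \<cdot> ?q))" using z by simp
      show "cl (sn_c ?c ?r) \<bullet> (cl (sn_c Nat (pr ?c ?r)) \<bullet> z) \<in> set_of ?r (eval ?e2 ?b)"
        by (rule in_bind[where a = z, OF z'], rule in_sing) (use e2 zD x in simp_all)
    qed
    then have "R ?\<Theta>' (e(x := k)) u (set_of ?r (Z \<bullet> su k \<bullet> u))" unfolding ZS[OF k u] by (rule R_mono[OF R])
    then show ?thesis using x by (simp add: R_subst)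
  qed
  \<comment> \<open>Correctness of \<open>Z\<close> at \<open>k\<close> against all challenges is
    definable by \<open>dfn_R\<close>, so the induction of \<open>M\<close> carries it to every
    \<open>k\<close>, nonstandard ones included. The parameters in \<open>e\<close> stay fixed, and
    \<open>Z\<close> is made the value of a fresh variable.\<close>
  have ind: "R \<Theta> (e(x := k)) u (set_of ?r (Z \<bullet> k \<bullet> u))" if e': "env e" and u: "u \<in> D ?c" and k: "k \<in> N" for e u k
  proof -
    let ?A = "insert x (vars \<Theta>)"
    obtain n1 where n: "\<And>n \<sigma>. n1 \<le> n \<Longrightarrow> (n, \<sigma>) \<notin> ?A" by (rule fresh_name[of ?A], simp, blast)
    define n2 n3 n4 where "n2 = Suc n1" and "n3 = Suc n2" and "n4 = Suc n3"
    note n_defs = n2_def n3_def n4_def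
    have ns: "n2 \<noteq> n1" "n3 \<noteq> n1" "n3 \<noteq> n2" "n4 \<noteq> n1" "n4 \<noteq> n2" "n4 \<noteq> n3"
      "n1 \<noteq> n2" "n1 \<noteq> n3" "n2 \<noteq> n3" "n1 \<noteq> n4" "n2 \<noteq> n4" "n3 \<noteq> n4"
      by (auto simp: n_defs)
    have xn: "x \<noteq> (k, \<sigma>)" "(k, \<sigma>) \<noteq> x" "(k, \<sigma>) \<notin> vars \<Theta>" "(k, \<sigma>) \<notin> fv \<Theta>" if "k \<in> {n1, n2, n3, n4}" for k \<sigma>
      using that n[of k \<sigma>] fv_vars[of \<Theta>] by (auto simp: n_defs)
    let ?vz = "(n4, Nat \<rightarrow>\<^sub>t aty \<Theta>)" and ?u = "(n1, ?c)"
    let ?y = "Var ?vz \<cdot> Var x \<cdot> Var ?u" and ?id = "lam (0, ?r) (v 0 ?r)"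
    have d0: "dfn (\<lambda>e. R \<Theta> e (e ?u) ((\<lambda>z. e (n3, ?r \<rightarrow>\<^sub>t ?r) \<bullet> z) ` set_of ?r (e (n2, ?r))))"
      by (rule dfn_R[OF wff]) (use xn ns in auto)
    have id: "(\<lambda>z. eval e ?id \<bullet> z) ` set_of ?r y = set_of ?r y" if "env e" "y \<in> D ?r" for e y
      using that set_of_D[of _ ?r y] by (auto simp: image_iff)
    have d1: "dfn (\<lambda>e. R \<Theta> e (e ?u) (set_of ?r (e ?vz \<bullet> e x \<bullet> e ?u)))"
    proof (rule dfn_cong[OF dfn_subst[OF dfn_subst[OF d0, of ?id "(n3, ?r \<rightarrow>\<^sub>t ?r)"], of ?y "(n2, ?r)"]])
      fix e assume e: "env e"
      let ?e2 = "e((n2, ?r) := eval e ?y)" let ?e1 = "?e2((n3, ?r \<rightarrow>\<^sub>t ?r) := eval ?e2 ?id)"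
      have "R \<Theta> ?e1 p S = R \<Theta> e p S" for p S using xn by (simp add: R_upd_fresh)
      moreover have "?e1 ?u = e ?u" "?e1 (n2, ?r) = eval e ?y" "?e1 (n3, ?r \<rightarrow>\<^sub>t ?r) = eval ?e2 ?id"
        using ns by auto
      moreover have "env ?e2" "eval e ?y \<in> D ?r" using e x by simp_all
      ultimately show "R \<Theta> ?e1 (?e1 ?u) ((\<lambda>z. ?e1 (n3, ?r \<rightarrow>\<^sub>t ?r) \<bullet> z) ` set_of ?r (?e1 (n2, ?r))) =
        R \<Theta> e (e ?u) (set_of ?r (e ?vz \<bullet> e x \<bullet> e ?u))"
        using id[of ?e2 "eval e ?y"] by (simp only: eval.simps)
    qed (use ns xn x in auto)
    obtain \<phi> where \<phi>: "wff \<phi>" "internal \<phi>"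
      and sat: "\<And>e. env e \<Longrightarrow> sat e \<phi> = (\<forall>a\<in>D ?c. R \<Theta> (e(?u := a)) a (set_of ?r (e ?vz \<bullet> e x \<bullet> a)))"
      using dfn_all[OF d1, of ?u] ns xn unfolding dfn_def by auto
    let ?e' = "e(?vz := Z)"
    have sat': "sat (?e'(x := k)) \<phi> = (\<forall>a\<in>D ?c. R \<Theta> (e(x := k)) a (set_of ?r (Z \<bullet> k \<bullet> a)))" if "k \<in> N" for k
    proof -
      have "e(?vz := Z, x := k) = e(x := k, ?vz := Z)" using xn by (intro fun_upd_twist) auto
      then have "R \<Theta> (?e'(x := k, ?u := a)) p S = R \<Theta> (e(x := k)) p S" for a p S
        using xn by (simp add: R_upd_fresh)
      moreover have "(?e'(x := k)) ?vz = Z" "(?e'(x := k)) x = k" using xn by auto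
      ultimately show ?thesis using sat[of "?e'(x := k)"] e' that x by simp
    qed
    have "sat (?e'(x := k)) \<phi>"
    proof (rule sat_ind[OF \<phi>(2,1) x])
      show "sat (?e'(x := ze)) \<phi>" using sat'[of ze] ind0[OF e'] by simp
      show "sat (?e'(x := su n)) \<phi>" if n: "n \<in> N" "sat (?e'(x := n)) \<phi>" for n
        using sat'[of "su n"] sat'[OF n(1)] n indS[OF e' _ n(1)] by auto
    qed (use e' k in simp_all)
    then show ?thesis using sat'[OF k] u by blast
  qed
  let ?F = "St (Var x) \<^bold>\<longrightarrow> \<Theta>" 
  let ?p = "v 0 (cty ?F)" and ?vZ = "v 1 (Nat \<rightarrow>\<^sub>t aty \<Theta>)"
  let ?e1 = "e0((1, Nat \<rightarrow>\<^sub>t aty \<Theta>) := Z)"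
  \<comment> \<open>The realizer does not see the value of \<open>x\<close>, only a list of
    candidates for it; the responses of \<open>Z\<close> at all candidates are collected.\<close>
  let ?t = "bind (6, Nat) (fs_c (Nat \<rightarrow>\<^sub>t Nat) ?c \<cdot> ?p \<cdot> Zero) (bind (7, ?r) (?vZ \<cdot> v 6 Nat \<cdot> (sn_c (Nat \<rightarrow>\<^sub>t Nat) ?c \<cdot> ?p)) (sing (mk Zero (v 7 ?r))))"
  show ?thesis
  proof (rule V_intro[of ?e1 ?t])
    fix e p assume e: "env e" and p: "p \<in> D (cty ?F)"
    let ?e2 = "?e1((0, cty ?F) := p)"
    let ?S = "set_of (rty ?F) (eval ?e2 ?t)"
    let ?n = "cl (fs_c (Nat \<rightarrow>\<^sub>t Nat) ?c) \<bullet> p" and ?u = "cl (sn_c (Nat \<rightarrow>\<^sub>t Nat) ?c) \<bullet> p"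
    have pD: "ok p" "tp p = pr (Nat \<rightarrow>\<^sub>t Nat) ?c" using p x by simp_all
    have inS: "cl (mk_c Nat ?r) \<bullet> ze \<bullet> d \<in> ?S" if k: "k \<in> set_of Nat (?n \<bullet> ze)" and d: "d \<in> set_of ?r (Z \<bullet> k \<bullet> ?u)" for k d
    proof -
      have kD: "ok k \<and> tp k = Nat" using set_of_D[OF k] pD by simp
      have dD: "ok d \<and> tp d = ?r" using set_of_D[OF d] kD pD by simp
      show ?thesis
        by (rule in_bind[where a = k], use k x in simp, rule in_bind[where a = d], use d x in simp, rule in_sing)
          (use kD dD pD x in simp_all)
    qed
    have fs: "cl (fs_c Nat ?r) \<bullet> (cl (mk_c Nat ?r) \<bullet> ze \<bullet> zr ?r) = ze" by simp
    have "ze \<in> Fs Nat ?r ` ?S"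
      using inS[OF zr_set_of zr_set_of] fs by (metis imageI)
    then have "R \<Theta> e ?u (Sn Nat ?r ` ?S)" if "H (St (Var x)) e ?n (Fs Nat ?r ` ?S)"
    proof -
      have ex: "e x \<in> set_of Nat (?n \<bullet> ze)" using that \<open>ze \<in> _\<close> x unfolding H_St by auto
      have "R \<Theta> (e(x := e x)) ?u (set_of ?r (Z \<bullet> e x \<bullet> ?u))" by (rule ind) (use e x pD in simp_all)
      then have "R \<Theta> e ?u (set_of ?r (Z \<bullet> e x \<bullet> ?u))" by simp
      then show ?thesis
      proof (rule R_mono, intro subsetI)
        fix d assume d: "d \<in> set_of ?r (Z \<bullet> e x \<bullet> ?u)"
        have "ok d \<and> tp d = ?r" using set_of_D[OF d] e x pD by simp
        then show "d \<in> Sn Nat ?r ` ?S" by (intro image_eqI[OF _ inS[OF ex d]]) simp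
      qed
    qed
    then show "R ?F e p ?S" unfolding R_Imp using x by simp
  qed (use x in simp_all)
qed

text \<open>\<open>V_ind\<close> is a rule for realized formulas. Moving both premises of the axiom
  into the induction formula \<open>?T\<close> turns the rule into the axiom; \<open>x\<close> is
  not free in them, so substitution reaches only the conclusion.\<close>

lemma IA_st_ax_V: "\<phi> \<in> IA_st_ax \<Longrightarrow> wff \<phi> \<Longrightarrow> tr \<phi> \<in> V"
proof (induction rule: IA_st_ax.induct)
  case (1 x \<Phi>)
  let ?P = "tr \<Phi>" and ?s = "Succ \<cdot> Var x"
  let ?A = "subst x Zero ?P" and ?B = "Forall x (St (Var x) \<^bold>\<longrightarrow> ?P \<^bold>\<longrightarrow> subst x ?s ?P)"
  let ?T = "?A \<^bold>\<longrightarrow> ?B \<^bold>\<longrightarrow> ?P"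
  have xA: "x \<notin> fv ?A" by (rule fv_subst_notin) simp
  have "(?B \<^bold>\<longrightarrow> (St (Var x) \<^bold>\<longrightarrow> ?P \<^bold>\<longrightarrow> subst x ?s ?P)) \<in> V"
    using V_inst[of "Var x" x "St (Var x) \<^bold>\<longrightarrow> ?P \<^bold>\<longrightarrow> subst x ?s ?P"] by simp
  then have "(St (Var x) \<^bold>\<longrightarrow> ?T \<^bold>\<longrightarrow> (?A \<^bold>\<longrightarrow> ?B \<^bold>\<longrightarrow> subst x ?s ?P)) \<in> V"
    by (rule V_taut1) auto
  then have "(St (Var x) \<^bold>\<longrightarrow> ?T \<^bold>\<longrightarrow> subst x ?s ?T) \<in> V" using subst_fresh[OF xA] by simp
  moreover have "subst x Zero ?T \<in> V"
    using V_taut[of "?A \<^bold>\<longrightarrow> ?B \<^bold>\<longrightarrow> ?A"] subst_fresh[OF xA] by simp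
  moreover have "wff ?T" using 1 by simp
  ultimately have "(St (Var x) \<^bold>\<longrightarrow> ?T) \<in> V" using V_ind[of ?T x] 1(1) by blast
  then have "(Neg (?A \<^bold>\<longrightarrow> Neg ?B) \<^bold>\<longrightarrow> St (Var x) \<^bold>\<longrightarrow> ?P) \<in> V" by (rule V_taut1) auto
  then have "(Neg (?A \<^bold>\<longrightarrow> Neg ?B) \<^bold>\<longrightarrow> Forall x (St (Var x) \<^bold>\<longrightarrow> ?P)) \<in> V" by (rule V_gen) (use xA in simp)
  then show ?case by (simp add: tr_subst)
qed

theorem soundness:
  assumes "EPA_st_I_HAC_PFTP_proves \<Phi>" shows "tr \<Phi> \<in> V"
proof -
  have "tr \<psi> \<in> V" if "\<psi> \<in> EPA_st_ax \<union> I_ax \<union> HAC_int_ax \<union> PF_TP_ax" "wff \<psi>" for \<psi>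
    using that EPA_ax_V EQ_ax_V T_st_ax_V IA_st_ax_V I_ax_V HAC_int_ax_V PF_TP_ax_V unfolding EPA_st_ax_def by blast
  then show ?thesis using provable_V assms by blast
qed

end

section \<open>Completeness\<close>

instance ty :: countable by countable_datatype
instance tm :: countable by countable_datatype
instance fm :: countable by countable_datatype

lemma EPA_proves_lang: "EPA_proves \<phi> \<Longrightarrow> wff \<phi> \<and> internal \<phi>"
  by (induction rule: provable.induct) auto

interpretation P: hilbert EPA_lang "{\<phi>. EPA_proves \<phi>}"
proof
  fix a b c
  show "Bot \<in> EPA_lang" "(a \<^bold>\<longrightarrow> b) \<in> EPA_lang \<longleftrightarrow> a \<in> EPA_lang \<and> b \<in> EPA_lang" by auto
  show "{\<phi>. EPA_proves \<phi>} \<subseteq> EPA_lang" using EPA_proves_lang by blast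
  assume a: "a \<in> EPA_lang"
  show "(Neg (Neg a) \<^bold>\<longrightarrow> a) \<in> {\<phi>. EPA_proves \<phi>}"
    using provable.logic[OF logic_ax.intros(10)[of a]] a by simp
  assume b: "b \<in> EPA_lang"
  show "(a \<^bold>\<longrightarrow> b \<^bold>\<longrightarrow> a) \<in> {\<phi>. EPA_proves \<phi>}"
    using provable.logic[OF logic_ax.intros(1)[of a b]] a b by simp
  assume c: "c \<in> EPA_lang"
  show "((a \<^bold>\<longrightarrow> b \<^bold>\<longrightarrow> c) \<^bold>\<longrightarrow> (a \<^bold>\<longrightarrow> b) \<^bold>\<longrightarrow> a \<^bold>\<longrightarrow> c) \<in> {\<phi>. EPA_proves \<phi>}"
    using provable.logic[OF logic_ax.intros(2)[of a b c]] a b c by simp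
next
  fix a b
  assume "(a \<^bold>\<longrightarrow> b) \<in> {\<phi>. EPA_proves \<phi>}" "a \<in> {\<phi>. EPA_proves \<phi>}"
  then show "b \<in> {\<phi>. EPA_proves \<phi>}" using provable.mp by blast
qed

section \<open>Propositional reasoning in the internal calculus\<close>

definition valuation :: "(fm \<Rightarrow> bool) \<Rightarrow> bool" where
  "valuation h \<longleftrightarrow> \<not> h Bot \<and> (\<forall>a\<in>EPA_lang. \<forall>b\<in>EPA_lang. h (a \<^bold>\<longrightarrow> b) = (h a \<longrightarrow> h b) \<and>
     h (a \<^bold>\<and> b) = (h a \<and> h b) \<and> h (a \<^bold>\<or> b) = (h a \<or> h b))"

lemma valuation_simps [simp]:
  assumes "valuation h"
  shows "\<not> h Bot"
    and "wff a \<Longrightarrow> internal a \<Longrightarrow> wff b \<Longrightarrow> internal b \<Longrightarrow> h (a \<^bold>\<longrightarrow> b) = (h a \<longrightarrow> h b)"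
    and "wff a \<Longrightarrow> internal a \<Longrightarrow> wff b \<Longrightarrow> internal b \<Longrightarrow> h (a \<^bold>\<and> b) = (h a \<and> h b)"
    and "wff a \<Longrightarrow> internal a \<Longrightarrow> wff b \<Longrightarrow> internal b \<Longrightarrow> h (a \<^bold>\<or> b) = (h a \<or> h b)"
  using assms unfolding valuation_def by blast+

text \<open>The axioms for conjunction and disjunction force the valuations supplied by
  \<open>P.taut\<close> to respect these connectives as well.\<close>

lemma EPA_taut:
  assumes "\<phi> \<in> EPA_lang"
    and "\<And>h. valuation h \<Longrightarrow>
      (\<And>a. EPA_proves a \<Longrightarrow> h a) \<Longrightarrow> h \<phi>"
  shows "EPA_proves \<phi>"
proof -
  have "\<phi> \<in> {\<phi>. EPA_proves \<phi>}"
  proof (rule P.taut[OF assms(1)])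
    fix h assume h: "\<not> h Bot" "\<And>a b. a \<in> EPA_lang \<Longrightarrow> b \<in> EPA_lang \<Longrightarrow> h (a \<^bold>\<longrightarrow> b) = (h a \<longrightarrow> h b)"
      "\<And>a. a \<in> {\<phi>. EPA_proves \<phi>} \<Longrightarrow> h a"
    have ax: "h a" if "a \<in> logic_ax" "a \<in> EPA_lang" for a using h(3)[of a] provable.logic that by auto
    have hA: "h (a \<^bold>\<and> b) = (h a \<and> h b)" if ab: "a \<in> EPA_lang" "b \<in> EPA_lang" for a b
    proof -
      have "h (a \<^bold>\<and> b) \<longrightarrow> h a"
        using ax[OF logic_ax.intros(3)[of a b]] h(2)[of "a \<^bold>\<and> b" a] ab by simp
      moreover have "h (a \<^bold>\<and> b) \<longrightarrow> h b"
        using ax[OF logic_ax.intros(4)[of a b]] h(2)[of "a \<^bold>\<and> b" b] ab by simp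
      moreover have "h a \<longrightarrow> h b \<longrightarrow> h (a \<^bold>\<and> b)"
        using ax[OF logic_ax.intros(5)[of a b]] h(2)[of a "b \<^bold>\<longrightarrow> a \<^bold>\<and> b"] h(2)[of b "a \<^bold>\<and> b"] ab by simp
      ultimately show ?thesis by blast
    qed
    have hO: "h (a \<^bold>\<or> b) = (h a \<or> h b)" if ab: "a \<in> EPA_lang" "b \<in> EPA_lang" for a b
    proof -
      have "h a \<longrightarrow> h (a \<^bold>\<or> b)"
        using ax[OF logic_ax.intros(6)[of a b]] h(2)[of a "a \<^bold>\<or> b"] ab by simp
      moreover have "h b \<longrightarrow> h (a \<^bold>\<or> b)"
        using ax[OF logic_ax.intros(7)[of b a]] h(2)[of b "a \<^bold>\<or> b"] ab by simp
      moreover have "\<not> h a \<longrightarrow> \<not> h b \<longrightarrow> \<not> h (a \<^bold>\<or> b)"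
        using ax[OF logic_ax.intros(8)[of a Bot b]] h(2)[of "Neg a" "Neg b \<^bold>\<longrightarrow> Neg (a \<^bold>\<or> b)"]
          h(2)[of "Neg b" "Neg (a \<^bold>\<or> b)"] h(2)[of "a \<^bold>\<or> b" Bot] h(2)[of a Bot] h(2)[of b Bot] h(1) ab by simp
      ultimately show ?thesis by blast
    qed
    show "h \<phi>"
    proof (rule assms(2))
      show "valuation h" unfolding valuation_def using h(1,2) hA hO by blast
    qed (use h(3) in simp)
  qed
  then show ?thesis by simp
qed

lemma EPA_taut1:
  assumes "EPA_proves \<psi>" "\<phi> \<in> EPA_lang"
    and "\<And>h. valuation h \<Longrightarrow> h \<psi> \<Longrightarrow> h \<phi>"
  shows "EPA_proves \<phi>"
  by (rule EPA_taut[OF assms(2)], rule assms(3)) (use assms(1) in simp_all)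

lemma EPA_taut2:
  assumes "EPA_proves \<psi>" "EPA_proves \<chi>" "\<phi> \<in> EPA_lang"
    and "\<And>h. valuation h \<Longrightarrow> h \<psi> \<Longrightarrow> h \<chi> \<Longrightarrow> h \<phi>"
  shows "EPA_proves \<phi>"
  by (rule EPA_taut[OF assms(3)], rule assms(4)) (use assms(1,2) in simp_all)

lemma EPA_gen:
  assumes "EPA_proves \<phi>" shows "EPA_proves (Forall x \<phi>)"
proof -
  have L: "\<phi> \<in> EPA_lang" using EPA_proves_lang[OF assms] by simp
  have "EPA_proves (Neg Bot \<^bold>\<longrightarrow> \<phi>)" by (rule EPA_taut1[OF assms]) (use L in auto)
  then have "EPA_proves (Neg Bot \<^bold>\<longrightarrow> Forall x \<phi>)" by (rule provable.gen_Forall) simp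
  then show ?thesis by (rule EPA_taut1) (use L in auto)
qed

lemma EPA_gens: "EPA_proves \<phi> \<Longrightarrow> EPA_proves (Foralls xs \<phi>)"
  by (induction xs) (auto intro: EPA_gen)

section \<open>Renaming by fresh variables\<close>

lemma free_for_Var: "z \<notin> vars \<phi> \<Longrightarrow> free_for x (Var z) \<phi>"
  by (induction \<phi>) auto

lemma substt_back: "z \<notin> fvt t \<Longrightarrow> substt z (Var x) (substt x (Var z) t) = t"
  by (induction t) auto

lemma subst_back: "z \<notin> vars \<phi> \<Longrightarrow> subst z (Var x) (subst x (Var z) \<phi>) = \<phi>"
  by (induction \<phi>) (simp_all add: substt_back subst_fresh)

lemma free_for_back: "z \<notin> vars \<phi> \<Longrightarrow> free_for z (Var x) (subst x (Var z) \<phi>)"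
  by (induction \<phi>) (simp_all add: free_for_not_fv)

lemma size_substt_Var: "size (substt x (Var z) t) = size t"
  by (induction t) auto

lemma size_subst_Var: "size (subst x (Var z) \<phi>) = size \<phi>"
  by (induction \<phi>) (auto simp: size_substt_Var)

text \<open>Witnesses are variables of the language itself, so no constants are added. Freshness
  with respect to \<open>vars\<close>, which includes bound variables, makes the substitution free
  of capture.\<close>

locale henkin =
  fixes G :: "fm set"
  assumes G_L: "G \<subseteq> EPA_lang"
    and G_prov: "EPA_proves \<phi> \<Longrightarrow> \<phi> \<in> G"
    and G_mp: "(\<phi> \<^bold>\<longrightarrow> \<psi>) \<in> G \<Longrightarrow> \<phi> \<in> G \<Longrightarrow> \<psi> \<in> G"
    and G_neg: "\<phi> \<in> EPA_lang \<Longrightarrow> Neg \<phi> \<in> G \<longleftrightarrow> \<phi> \<notin> G"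
    and G_wit: "Exists x \<phi> \<in> G \<Longrightarrow> \<exists>n. (\<forall>\<sigma>. (n, \<sigma>) \<notin> vars \<phi>) \<and> subst x (Var (n, snd x)) \<phi> \<in> G"
begin

lemma G_logic: "\<phi> \<in> logic_ax \<Longrightarrow> wff \<phi> \<Longrightarrow> internal \<phi> \<Longrightarrow> \<phi> \<in> G"
  and G_ax: "\<phi> \<in> EPA_ax \<Longrightarrow> wff \<phi> \<Longrightarrow> internal \<phi> \<Longrightarrow> \<phi> \<in> G"
  by (auto intro: G_prov provable.intros)

lemma G_D: "\<phi> \<in> G \<Longrightarrow> wff \<phi> \<and> internal \<phi>"
  using G_L by blast

lemma G_Bot: "Bot \<notin> G"
  using G_neg[of Bot] G_prov[OF EPA_taut[of "Neg Bot"]] by auto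

lemma G_Imp:
  assumes "\<phi> \<in> EPA_lang" "\<psi> \<in> EPA_lang" shows "(\<phi> \<^bold>\<longrightarrow> \<psi>) \<in> G \<longleftrightarrow> (\<phi> \<in> G \<longrightarrow> \<psi> \<in> G)"
proof -
  have "(\<psi> \<^bold>\<longrightarrow> \<phi> \<^bold>\<longrightarrow> \<psi>) \<in> G" "(Neg \<phi> \<^bold>\<longrightarrow> \<phi> \<^bold>\<longrightarrow> \<psi>) \<in> G"
    by (rule G_prov, rule EPA_taut; use assms in auto)+
  then show ?thesis using G_mp G_neg[OF assms(1)] by blast
qed

lemma G_And:
  assumes "\<phi> \<in> EPA_lang" "\<psi> \<in> EPA_lang" shows "(\<phi> \<^bold>\<and> \<psi>) \<in> G \<longleftrightarrow> \<phi> \<in> G \<and> \<psi> \<in> G"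
proof -
  have "(\<phi> \<^bold>\<and> \<psi> \<^bold>\<longrightarrow> \<phi>) \<in> G" "(\<phi> \<^bold>\<and> \<psi> \<^bold>\<longrightarrow> \<psi>) \<in> G" "(\<phi> \<^bold>\<longrightarrow> \<psi> \<^bold>\<longrightarrow> \<phi> \<^bold>\<and> \<psi>) \<in> G"
    by (rule G_logic; use assms in \<open>auto intro: logic_ax.intros\<close>)+
  then show ?thesis using G_mp by blast
qed

lemma G_Or:
  assumes "\<phi> \<in> EPA_lang" "\<psi> \<in> EPA_lang" shows "(\<phi> \<^bold>\<or> \<psi>) \<in> G \<longleftrightarrow> \<phi> \<in> G \<or> \<psi> \<in> G"
proof -
  have "(\<phi> \<^bold>\<longrightarrow> \<phi> \<^bold>\<or> \<psi>) \<in> G" "(\<psi> \<^bold>\<longrightarrow> \<phi> \<^bold>\<or> \<psi>) \<in> G"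
    by (rule G_logic; use assms in \<open>auto intro: logic_ax.intros\<close>)+
  moreover have "(\<phi> \<^bold>\<or> \<psi> \<^bold>\<longrightarrow> Neg \<phi> \<^bold>\<longrightarrow> \<psi>) \<in> G"
    by (rule G_prov, rule EPA_taut) (use assms in auto)
  ultimately show ?thesis using G_mp G_neg[OF assms(1)] by blast
qed

section \<open>Equality and the term model of a Henkin theory\<close>

lemma eq_refl: "wt t \<Longrightarrow> (t \<^bold>= t) \<in> G"
  by (rule G_ax) (auto intro: EPA_ax.intros)

lemma eq_euclid:
  assumes "(r \<^bold>= s) \<in> G" "(r \<^bold>= t) \<in> G" shows "(s \<^bold>= t) \<in> G"
proof -
  have "(r \<^bold>= s \<^bold>\<longrightarrow> r \<^bold>= t \<^bold>\<longrightarrow> s \<^bold>= t) \<in> G"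
    by (rule G_ax) (use G_D[OF assms(1)] G_D[OF assms(2)] in \<open>auto intro: EPA_ax.intros\<close>)
  then show ?thesis using G_mp assms by blast
qed

lemma eq_sym: "(r \<^bold>= s) \<in> G \<Longrightarrow> (s \<^bold>= r) \<in> G"
  using eq_euclid[of r s r] eq_refl[of r] G_D[of "r \<^bold>= s"] by auto

lemma eq_trans: "(r \<^bold>= s) \<in> G \<Longrightarrow> (s \<^bold>= t) \<in> G \<Longrightarrow> (r \<^bold>= t) \<in> G"
  using eq_euclid[of s r t] eq_sym[of r s] by auto

lemma eq_App:
  assumes "(s \<^bold>= s') \<in> G" "(t \<^bold>= t') \<in> G" "wt (s \<cdot> t)" shows "(s \<cdot> t \<^bold>= s' \<cdot> t') \<in> G"
proof -
  have "(s \<^bold>= s' \<^bold>\<longrightarrow> t \<^bold>= t' \<^bold>\<longrightarrow> s \<cdot> t \<^bold>= s' \<cdot> t') \<in> G"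
    by (rule G_ax) (use G_D[OF assms(1)] G_D[OF assms(2)] assms(3) in \<open>auto intro: EPA_ax.intros\<close>)
  then show ?thesis using G_mp assms by blast
qed

text \<open>The class of a term under provable equality in \<open>G\<close>. The type tag lets
  \<open>fst\<close> serve as \<open>tp\<close> even on ill-typed terms, whose classes are
  empty.\<close>

definition el :: "tm \<Rightarrow> ty \<times> tm set" where "el t = (tyof t, {s. (t \<^bold>= s) \<in> G})"

definition okT :: "ty \<times> tm set \<Rightarrow> bool" where "okT a \<longleftrightarrow> (\<exists>t. wt t \<and> a = el t)"

definition apT :: "ty \<times> tm set \<Rightarrow> ty \<times> tm set \<Rightarrow> ty \<times> tm set" where
  "apT a b = (res (fst a), {u. \<exists>s\<in>snd a. \<exists>t\<in>snd b. (s \<cdot> t \<^bold>= u) \<in> G})"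

definition e\<^sub>T :: "var \<Rightarrow> ty \<times> tm set" where "e\<^sub>T x = el (Var x)"

lemma fst_el [simp]: "fst (el t) = tyof t"
  by (simp add: el_def)

lemma el_eq: "wt s \<Longrightarrow> wt t \<Longrightarrow> el s = el t \<longleftrightarrow> (s \<^bold>= t) \<in> G"
proof
  assume "wt s" "wt t" "el s = el t"
  then show "(s \<^bold>= t) \<in> G" using eq_refl[of t] unfolding el_def by auto
next
  assume "wt s" "wt t" and st: "(s \<^bold>= t) \<in> G"
  then have "tyof s = tyof t" using G_D[OF st] by simp
  then show "el s = el t" using eq_trans st eq_sym[OF st] unfolding el_def by blast
qed

lemma tyof_App: "tyof (s \<cdot> t) = res (tyof s)"
  by (simp split: ty.split)

lemma ap_el:
  assumes "wt (s \<cdot> t)" shows "apT (el s) (el t) = el (s \<cdot> t)"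
proof -
  have wt: "wt s" "wt t" using assms by auto
  have "(s' \<cdot> t' \<^bold>= u) \<in> G \<longleftrightarrow> (s \<cdot> t \<^bold>= u) \<in> G" if "(s \<^bold>= s') \<in> G" "(t \<^bold>= t') \<in> G" for s' t' u
    using eq_App[OF that assms] eq_trans eq_sym by blast
  then have "{u. \<exists>s'\<in>{s'. (s \<^bold>= s') \<in> G}. \<exists>t'\<in>{t'. (t \<^bold>= t') \<in> G}. (s' \<cdot> t' \<^bold>= u) \<in> G} = {u. (s \<cdot> t \<^bold>= u) \<in> G}"
    using eq_refl[OF wt(1)] eq_refl[OF wt(2)] by blast
  then show ?thesis unfolding apT_def el_def fst_conv snd_conv tyof_App by simp
qed

interpretation M: struc okT fst apT el .

lemma env_T: "M.env e\<^sub>T"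
  unfolding M.env_def e\<^sub>T_def okT_def el_def by (metis fst_conv tyof.simps(1) wt.simps(2))

lemma eval_T: "wt t \<Longrightarrow> M.eval e\<^sub>T t = el t"
  by (induction t) (auto simp: e\<^sub>T_def ap_el)

lemma G_Exists:
  assumes "subst x t \<phi> \<in> G" "wt t" "tyof t = snd x" "free_for x t \<phi>" "wff \<phi>" "internal \<phi>"
  shows "Exists x \<phi> \<in> G"
proof -
  have "(subst x t \<phi> \<^bold>\<longrightarrow> Exists x \<phi>) \<in> G"
    by (rule G_logic) (use assms in \<open>auto intro: logic_ax.intros\<close>)
  then show ?thesis using assms(1) G_mp by blast
qed

lemma G_Forall:
  assumes "Forall x \<phi> \<in> G" "wt t" "tyof t = snd x" "free_for x t \<phi>" shows "subst x t \<phi> \<in> G"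
proof -
  have "(Forall x \<phi> \<^bold>\<longrightarrow> subst x t \<phi>) \<in> G"
    by (rule G_logic) (use assms G_D[OF assms(1)] in \<open>auto intro: logic_ax.intros\<close>)
  then show ?thesis using assms(1) G_mp by blast
qed

lemma EPA_not_Forall:
  assumes "wff \<phi>" "internal \<phi>"
  shows "EPA_proves (Neg (Forall x \<phi>) \<^bold>\<longrightarrow> Exists x (Neg \<phi>))"
proof -
  have "EPA_proves (subst x (Var x) (Neg \<phi>) \<^bold>\<longrightarrow> Exists x (Neg \<phi>))"
    by (intro provable.logic logic_ax.intros) (use assms in auto)
  then have "EPA_proves (Neg \<phi> \<^bold>\<longrightarrow> Exists x (Neg \<phi>))" by simp
  then have "EPA_proves (Neg (Exists x (Neg \<phi>)) \<^bold>\<longrightarrow> \<phi>)"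
    by (rule EPA_taut1) (use assms in auto)
  then have "EPA_proves (Neg (Exists x (Neg \<phi>)) \<^bold>\<longrightarrow> Forall x \<phi>)"
    by (rule provable.gen_Forall) simp
  then show ?thesis by (rule EPA_taut1) (use assms in auto)
qed

text \<open>Every element is named by a variable that does not occur in a given formula, so substitution
  in the truth lemma never captures.\<close>

lemma el_Var:
  assumes "wt t" "wff \<phi>" "internal \<phi>" obtains n where "\<And>\<sigma>. (n, \<sigma>) \<notin> vars \<phi>" "el t = el (Var (n, tyof t))"
proof -
  obtain m where m: "\<And>\<sigma>. (m, \<sigma>) \<notin> fvt t \<union> vars \<phi>"
    by (rule fresh_name[of "fvt t \<union> vars \<phi>"], simp, blast)
  let ?y = "(m, tyof t)"
  let ?\<psi> = "Var ?y \<^bold>= t \<^bold>\<and> (\<phi> \<^bold>\<longrightarrow> \<phi>)"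
  have y: "?y \<notin> fvt t" "?y \<notin> fv \<phi>" using m fv_vars[of \<phi>] by auto
  have "(t \<^bold>= t \<^bold>\<and> (\<phi> \<^bold>\<longrightarrow> \<phi>)) \<in> G"
    using eq_refl[OF assms(1)] assms by (subst G_And) (auto simp: G_Imp)
  then have "Exists ?y ?\<psi> \<in> G"
    by (intro G_Exists[where t = t]) (use y assms in \<open>auto simp: subst_fresh free_for_not_fv\<close>)
  then obtain n where n: "\<forall>\<sigma>. (n, \<sigma>) \<notin> vars ?\<psi>" "subst ?y (Var (n, tyof t)) ?\<psi> \<in> G" using G_wit by fastforce
  then have "(Var (n, tyof t) \<^bold>= t \<^bold>\<and> (\<phi> \<^bold>\<longrightarrow> \<phi>)) \<in> G" using y by (simp add: subst_fresh)
  then have "(Var (n, tyof t) \<^bold>= t) \<in> G" using assms by (subst (asm) G_And) auto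
  then have "el t = el (Var (n, tyof t))" using el_eq[of "Var (n, tyof t)" t] assms by simp
  then show ?thesis using that[of n] n(1) by auto
qed

text \<open>The induction is on size because the quantifier cases pass to instances by variables,
  which are not subformulas but have the size of one.\<close>

lemma truth: "wff \<phi> \<Longrightarrow> internal \<phi> \<Longrightarrow> M.sat e\<^sub>T \<phi> \<longleftrightarrow> \<phi> \<in> G"
proof (induction "size \<phi>" arbitrary: \<phi> rule: less_induct)
  case less
  have Var: "M.sat (e\<^sub>T(x := el (Var z))) \<psi> \<longleftrightarrow> subst x (Var z) \<psi> \<in> G"
    if "z \<notin> vars \<psi>" "snd z = snd x" "size \<psi> < size \<phi>" "wff \<psi>" "internal \<psi>" for x z \<psi>
    using M.sat_subst[OF free_for_Var[OF that(1)], of e\<^sub>T x] that less.hyps[of "subst x (Var z) \<psi>"]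
    by (simp add: e\<^sub>T_def size_subst_Var)
  have ex: "\<exists>n. (\<forall>\<sigma>. (n, \<sigma>) \<notin> vars \<psi>) \<and> a = el (Var (n, snd x))" if a: "a \<in> M.D (snd x)" "wff \<psi>" "internal \<psi>" for a \<psi> and x :: var
  proof -
    obtain t where "wt t" "a = el t" "tyof t = snd x" using a(1) by (auto simp: okT_def)
    then show ?thesis using el_Var[of t \<psi>] a(2,3) by metis
  qed
  have VarD: "el (Var (n, snd x)) \<in> M.D (snd x)" for n and x :: var
    by (auto simp: okT_def intro!: exI[of _ "Var (n, snd x)"])
  show ?case
  proof (cases \<phi>)
    case (Eq s t)
    then show ?thesis using less.prems by (simp add: eval_T el_eq)
  next
    case Bot
    then show ?thesis using G_Bot by simp
  next
    case (And \<psi> \<chi>)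
    then show ?thesis using less by (simp add: G_And)
  next
    case (Or \<psi> \<chi>)
    then show ?thesis using less by (simp add: G_Or)
  next
    case (Imp \<psi> \<chi>)
    then show ?thesis using less by (simp add: G_Imp)
  next
    case (Forall x \<psi>)
    then have \<psi>: "wff \<psi>" "internal \<psi>" "size \<psi> < size \<phi>" using less.prems by auto
    show ?thesis
    proof
      assume sat: "M.sat e\<^sub>T \<phi>"
      show "\<phi> \<in> G"
      proof (rule ccontr)
        assume "\<phi> \<notin> G"
        then have "Neg (Forall x \<psi>) \<in> G" using G_neg[of \<phi>] Forall less.prems by simp
        then have "Exists x (Neg \<psi>) \<in> G" using G_mp[OF G_prov[OF EPA_not_Forall]] \<psi> by blast
        from G_wit[OF this] obtain n where n: "\<forall>\<sigma>. (n, \<sigma>) \<notin> vars \<psi>" "Neg (subst x (Var (n, snd x)) \<psi>) \<in> G"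
          by auto
        then have "subst x (Var (n, snd x)) \<psi> \<notin> G" using G_neg[of "subst x (Var (n, snd x)) \<psi>"] \<psi> by simp
        then have "\<not> M.sat (e\<^sub>T(x := el (Var (n, snd x)))) \<psi>" using Var[of "(n, snd x)" \<psi> x] n \<psi> by simp
        then show False using sat Forall VarD[of n x] by (simp only: M.sat.simps) blast
      qed
    next
      assume G: "\<phi> \<in> G"
      have "M.sat (e\<^sub>T(x := a)) \<psi>" if a: "a \<in> M.D (snd x)" for a
      proof -
        obtain n where n: "\<forall>\<sigma>. (n, \<sigma>) \<notin> vars \<psi>" "a = el (Var (n, snd x))" using ex[OF a \<psi>(1,2)] by blast
        have "subst x (Var (n, snd x)) \<psi> \<in> G"
          by (rule G_Forall) (use G Forall n free_for_Var in auto)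
        then show ?thesis using Var[of "(n, snd x)" \<psi> x] n \<psi> by simp
      qed
      then show "M.sat e\<^sub>T \<phi>" using Forall by simp
    qed
  next
    case (Exists x \<psi>)
    then have \<psi>: "wff \<psi>" "internal \<psi>" "size \<psi> < size \<phi>" using less.prems by auto
    show ?thesis
    proof
      assume "M.sat e\<^sub>T \<phi>"
      then obtain a where a: "a \<in> M.D (snd x)" "M.sat (e\<^sub>T(x := a)) \<psi>" using Exists by (simp only: M.sat.simps) blast
      obtain n where n: "\<forall>\<sigma>. (n, \<sigma>) \<notin> vars \<psi>" "a = el (Var (n, snd x))" using ex[OF a(1) \<psi>(1,2)] by blast
      then have "subst x (Var (n, snd x)) \<psi> \<in> G" using Var[of "(n, snd x)" \<psi> x] a \<psi> by simp
      then show "\<phi> \<in> G" unfolding Exists by (rule G_Exists) (use n \<psi> free_for_Var in auto)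
    next
      assume "\<phi> \<in> G"
      then obtain n where n: "\<forall>\<sigma>. (n, \<sigma>) \<notin> vars \<psi>" "subst x (Var (n, snd x)) \<psi> \<in> G" using G_wit Exists by blast
      then have "M.sat (e\<^sub>T(x := el (Var (n, snd x)))) \<psi>" using Var[of "(n, snd x)" \<psi> x] \<psi> by simp
      then show "M.sat e\<^sub>T \<phi>" unfolding Exists M.sat.simps using VarD by blast
    qed
  qed (use less.prems in auto)
qed

lemma sat_Foralls:
  assumes "M.sat d (Foralls xs \<phi>)" "M.env e" "\<And>y. y \<notin> set xs \<Longrightarrow> e y = d y" shows "M.sat e \<phi>"
  using assms(1,3)
proof (induction xs arbitrary: d)
  case Nil
  then have "e = d" by auto
  then show ?case using Nil by simp
next
  case (Cons x xs)
  have "e x \<in> M.D (snd x)" using assms(2) M.env_ok M.env_tp by simp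
  then have "M.sat (d(x := e x)) (Foralls xs \<phi>)" using Cons.prems(1) by simp
  then show ?case by (rule Cons.IH) (use Cons.prems(2) in auto)
qed

text \<open>The truth lemma concerns the environment \<open>e\<^sub>T\<close> only; all others are
  reached through the universal closure, which is provable too.\<close>

lemma sat_provable:
  assumes "EPA_proves \<phi>" "M.env e" shows "M.sat e \<phi>"
proof -
  obtain xs where xs: "set xs = fv \<phi>" using finite_list[OF finite_fv] by blast
  \<comment> \<open>\<open>sat_Foralls\<close> needs an environment that differs from
    \<open>e\<^sub>T\<close> only at the quantified variables.\<close>
  let ?e = "\<lambda>y. if y \<in> fv \<phi> then e y else e\<^sub>T y"
  have "EPA_proves (Foralls xs \<phi>)" by (rule EPA_gens[OF assms(1)])
  then have "M.sat e\<^sub>T (Foralls xs \<phi>)" using truth G_prov EPA_proves_lang by blast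
  moreover have "M.env ?e" using M.env_ok[OF assms(2)] M.env_tp[OF assms(2)] M.env_ok[OF env_T] M.env_tp[OF env_T]
    unfolding M.env_def by (metis (full_types))
  ultimately have "M.sat ?e \<phi>" by (rule sat_Foralls) (simp add: xs)
  moreover have "M.sat ?e \<phi> = M.sat e \<phi>" by (rule M.sat_cong) simp
  ultimately show ?thesis by simp
qed

lemma model_T: "model okT fst apT el"
proof
  fix f a
  show "fst (apT f a) = res (fst f)" by (simp add: apT_def)
  assume "okT f" "okT a" "fits (fst f) (fst a)"
  then obtain s t where st: "wt s" "wt t" "f = el s" "a = el t" "fits (tyof s) (tyof t)"
    by (auto simp: okT_def)
  then have "wt (s \<cdot> t)" by (cases "tyof s") auto
  then show "okT (apT f a)" using ap_el[of s t] st unfolding okT_def by metis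
next
  show "fst (el c) = tyof c" for c by (simp add: el_def)
  show "wt c \<Longrightarrow> okT (el c)" for c unfolding okT_def by blast
  show "\<phi> \<in> EPA_ax \<Longrightarrow> wff \<phi> \<Longrightarrow> internal \<phi> \<Longrightarrow> M.env e \<Longrightarrow> M.sat e \<phi>" for \<phi> e
    by (rule sat_provable) (auto intro: provable.axiom)
qed

end

section \<open>Extension of a consistent formula to a Henkin theory\<close>

definition consistent :: "fm \<Rightarrow> bool" where
  "consistent \<theta> \<longleftrightarrow> wff \<theta> \<and> internal \<theta> \<and> \<not> EPA_proves (Neg \<theta>)"

text \<open>One stage of the construction: \<open>\<theta>'\<close> strengthens
  \<open>\<theta>\<close>, decides \<open>\<psi>\<close>, and provides a witness if
  \<open>\<psi>\<close> is an existential formula decided positively.\<close>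

definition extends :: "fm \<Rightarrow> fm \<Rightarrow> fm \<Rightarrow> bool" where
  "extends \<theta> \<psi> \<theta>' \<longleftrightarrow> EPA_proves (\<theta>' \<^bold>\<longrightarrow> \<theta>) \<and>
     (\<psi> \<in> EPA_lang \<longrightarrow> EPA_proves (\<theta>' \<^bold>\<longrightarrow> \<psi>) \<or> EPA_proves (\<theta>' \<^bold>\<longrightarrow> Neg \<psi>)) \<and>
     (\<forall>x \<chi>. \<psi> = Exists x \<chi> \<longrightarrow> EPA_proves (\<theta>' \<^bold>\<longrightarrow> \<psi>) \<longrightarrow>
       (\<exists>n. (\<forall>\<sigma>. (n, \<sigma>) \<notin> vars \<chi>) \<and> EPA_proves (\<theta>' \<^bold>\<longrightarrow> subst x (Var (n, snd x)) \<chi>)))"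

text \<open>If the extension were refutable, \<open>gen_Exists\<close> for the fresh
  \<open>z\<close> would refute the original formula; \<open>subst_back\<close> leads from
  \<open>Exists x\<close> to its renaming \<open>Exists z\<close>.\<close>

lemma consistent_witness:
  assumes c: "consistent (\<theta> \<^bold>\<and> Exists x \<chi>)" and z: "z \<notin> vars \<theta> \<union> insert x (vars \<chi>)" "snd z = snd x"
  shows "consistent ((\<theta> \<^bold>\<and> Exists x \<chi>) \<^bold>\<and> subst x (Var z) \<chi>)"
proof -
  let ?\<alpha> = "\<theta> \<^bold>\<and> Exists x \<chi>" and ?s = "subst x (Var z) \<chi>"
  have L: "wff \<theta>" "wff \<chi>" "internal \<theta>" "internal \<chi>" "wff ?s" using c z unfolding consistent_def by auto
  have fv: "z \<notin> fv ?\<alpha>" "z \<noteq> x" using z fv_vars[of \<theta>] fv_vars[of \<chi>] by auto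
  have False if "EPA_proves (Neg (?\<alpha> \<^bold>\<and> ?s))"
  proof -
    have "EPA_proves (?s \<^bold>\<longrightarrow> Neg ?\<alpha>)" by (rule EPA_taut1[OF that]) (use L in auto)
    then have 1: "EPA_proves (Exists z ?s \<^bold>\<longrightarrow> Neg ?\<alpha>)" by (rule provable.gen_Exists) (use fv in simp)
    have "EPA_proves (subst z (Var x) ?s \<^bold>\<longrightarrow> Exists z ?s)"
      by (intro provable.logic logic_ax.intros) (use z L free_for_back in auto)
    then have "EPA_proves (\<chi> \<^bold>\<longrightarrow> Exists z ?s)" using subst_back[of z \<chi> x] z by simp
    then have "EPA_proves (Exists x \<chi> \<^bold>\<longrightarrow> Exists z ?s)"
      by (rule provable.gen_Exists) (use fv fv_subst_notin[of x "Var z" \<chi>] in auto)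
    then have "EPA_proves (Neg ?\<alpha>)" by (rule EPA_taut2[OF _ 1]) (use L in auto)
    then show False using c unfolding consistent_def by blast
  qed
  then show ?thesis using L unfolding consistent_def by auto
qed

lemma extends_ex:
  assumes "consistent \<theta>" shows "\<exists>\<theta>'. consistent \<theta>' \<and> extends \<theta> \<psi> \<theta>'"
proof (cases "consistent (\<theta> \<^bold>\<and> \<psi>)")
  case False
  have L: "wff \<theta>" "internal \<theta>" using assms unfolding consistent_def by auto
  have 1: "EPA_proves (\<theta> \<^bold>\<longrightarrow> \<theta>)" by (rule EPA_taut) (use L in auto)
  have 2: "EPA_proves (\<theta> \<^bold>\<longrightarrow> Neg \<psi>)" if "\<psi> \<in> EPA_lang"
  proof -
    have "EPA_proves (Neg (\<theta> \<^bold>\<and> \<psi>))" using False L that unfolding consistent_def by auto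
    then show ?thesis by (rule EPA_taut1) (use L that in auto)
  qed
  have "\<not> EPA_proves (\<theta> \<^bold>\<longrightarrow> \<psi>)"
  proof
    assume *: "EPA_proves (\<theta> \<^bold>\<longrightarrow> \<psi>)"
    then have \<psi>: "\<psi> \<in> EPA_lang" using EPA_proves_lang[OF *] by simp
    have "EPA_proves (Neg \<theta>)" by (rule EPA_taut2[OF * 2[OF \<psi>]]) (use L \<psi> in auto)
    then show False using assms unfolding consistent_def by blast
  qed
  then show ?thesis using assms 1 2 unfolding extends_def by blast
next
  case True
  then have L: "wff \<theta>" "internal \<theta>" "wff \<psi>" "internal \<psi>" unfolding consistent_def by auto
  show ?thesis
  proof (cases "\<exists>x \<chi>. \<psi> = Exists x \<chi>")
    case False
    have "EPA_proves (\<theta> \<^bold>\<and> \<psi> \<^bold>\<longrightarrow> \<theta>)" "EPA_proves (\<theta> \<^bold>\<and> \<psi> \<^bold>\<longrightarrow> \<psi>)"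
      by (rule EPA_taut; use L in auto)+
    then show ?thesis using True False unfolding extends_def by blast
  next
    case ex: True
    then obtain x \<chi> where \<psi>: "\<psi> = Exists x \<chi>" by blast
    obtain n where n: "\<And>\<sigma>. (n, \<sigma>) \<notin> vars \<theta> \<union> insert x (vars \<chi>)"
      by (rule fresh_name[of "vars \<theta> \<union> insert x (vars \<chi>)"], simp, blast)
    let ?s = "subst x (Var (n, snd x)) \<chi>"
    let ?\<theta>' = "(\<theta> \<^bold>\<and> \<psi>) \<^bold>\<and> ?s"
    have c: "consistent ?\<theta>'" unfolding \<psi> by (rule consistent_witness) (use True \<psi> n in auto)
    have Ls: "wff ?s" "internal ?s" using L \<psi> by auto
    have "EPA_proves (?\<theta>' \<^bold>\<longrightarrow> \<theta>)" "EPA_proves (?\<theta>' \<^bold>\<longrightarrow> \<psi>)" "EPA_proves (?\<theta>' \<^bold>\<longrightarrow> ?s)"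
      by (rule EPA_taut; use L Ls in auto)+
    then show ?thesis using c n \<psi> unfolding extends_def by blast
  qed
qed

lemma henkin_extension:
  assumes "consistent \<theta>" shows "\<exists>G. henkin G \<and> \<theta> \<in> G"
proof -
  \<comment> \<open>Stage \<open>n\<close> treats the formula with code \<open>n\<close>. Each stage
    is a single formula, so fresh variables never run out.\<close>
  have "\<exists>f. \<forall>n. (consistent (f n) \<and> (n = 0 \<longrightarrow> f n = \<theta>)) \<and> extends (f n) (from_nat n) (f (Suc n))"
    by (rule dependent_nat_choice) (use assms extends_ex in auto)
  then obtain f where f0: "f 0 = \<theta>" and fc: "\<And>n. consistent (f n)"
    and fs: "\<And>n. extends (f n) (from_nat n) (f (Suc n))" by blast
  have fL: "wff (f n)" "internal (f n)" for n using fc unfolding consistent_def by auto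
  define G where "G = {\<psi>. \<exists>n. EPA_proves (f n \<^bold>\<longrightarrow> \<psi>)}"
  have mono: "EPA_proves (f (n + k) \<^bold>\<longrightarrow> f n)" for n k
  proof (induction k)
    case 0
    show ?case by (rule EPA_taut) (use fL in auto)
  next
    case (Suc k)
    have "EPA_proves (f (n + Suc k) \<^bold>\<longrightarrow> f (n + k))" using fs[of "n + k"] unfolding extends_def by simp
    then show ?case by (rule EPA_taut2[OF _ Suc]) (use fL in auto)
  qed
  have up: "EPA_proves (f m \<^bold>\<longrightarrow> \<psi>)" if "EPA_proves (f n \<^bold>\<longrightarrow> \<psi>)" "n \<le> m" for n m \<psi>
  proof -
    have L: "wff \<psi>" "internal \<psi>" using EPA_proves_lang[OF that(1)] by auto
    have "EPA_proves (f m \<^bold>\<longrightarrow> f n)" using mono[of n "m - n"] that(2) by simp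
    then show ?thesis by (rule EPA_taut2[OF that(1)]) (use fL L in auto)
  qed
  have GL: "wff \<psi>" "internal \<psi>" if \<psi>: "\<psi> \<in> G" for \<psi>
  proof -
    obtain n where "EPA_proves (f n \<^bold>\<longrightarrow> \<psi>)" using \<psi> unfolding G_def by blast
    from EPA_proves_lang[OF this] show "wff \<psi>" "internal \<psi>" by simp_all
  qed
  have cons: "\<not> (EPA_proves (f n \<^bold>\<longrightarrow> \<psi>) \<and> EPA_proves (f m \<^bold>\<longrightarrow> Neg \<psi>))" for n m \<psi>
  proof
    assume "EPA_proves (f n \<^bold>\<longrightarrow> \<psi>) \<and> EPA_proves (f m \<^bold>\<longrightarrow> Neg \<psi>)"
    then have *: "EPA_proves (f (max n m) \<^bold>\<longrightarrow> \<psi>)" "EPA_proves (f (max n m) \<^bold>\<longrightarrow> Neg \<psi>)"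
      using up by (meson max.cobounded1 max.cobounded2)+
    then have "EPA_proves (Neg (f (max n m)))"
      by (rule EPA_taut2) (use fL EPA_proves_lang[OF *(1)] in auto)
    then show False using fc unfolding consistent_def by blast
  qed
  have "henkin G"
  proof
    show "G \<subseteq> EPA_lang" using GL by blast
    show "\<psi> \<in> G" if "EPA_proves \<psi>" for \<psi>
    proof -
      have "EPA_proves (f 0 \<^bold>\<longrightarrow> \<psi>)"
        by (rule EPA_taut1[OF that]) (use fL EPA_proves_lang[OF that] in auto)
      then show ?thesis unfolding G_def by blast
    qed
    show "\<psi> \<in> G" if *: "(\<phi> \<^bold>\<longrightarrow> \<psi>) \<in> G" "\<phi> \<in> G" for \<phi> \<psi>
    proof -
      obtain n m where "EPA_proves (f n \<^bold>\<longrightarrow> \<phi> \<^bold>\<longrightarrow> \<psi>)" "EPA_proves (f m \<^bold>\<longrightarrow> \<phi>)" using * unfolding G_def by blast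
      then have *: "EPA_proves (f (max n m) \<^bold>\<longrightarrow> \<phi> \<^bold>\<longrightarrow> \<psi>)" "EPA_proves (f (max n m) \<^bold>\<longrightarrow> \<phi>)"
        using up by (meson max.cobounded1 max.cobounded2)+
      then have "EPA_proves (f (max n m) \<^bold>\<longrightarrow> \<psi>)"
        by (rule EPA_taut2) (use fL EPA_proves_lang[OF *(1)] in auto)
      then show ?thesis unfolding G_def by blast
    qed
    show "Neg \<phi> \<in> G \<longleftrightarrow> \<phi> \<notin> G" if "\<phi> \<in> EPA_lang" for \<phi>
    proof -
      have "extends (f (to_nat \<phi>)) \<phi> (f (Suc (to_nat \<phi>)))" using fs[of "to_nat \<phi>"] by simp
      then have "\<phi> \<in> G \<or> Neg \<phi> \<in> G" using that unfolding extends_def G_def by blast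
      then show ?thesis using cons unfolding G_def by blast
    qed
    show "\<exists>n. (\<forall>\<sigma>. (n, \<sigma>) \<notin> vars \<phi>) \<and> subst x (Var (n, snd x)) \<phi> \<in> G" if "Exists x \<phi> \<in> G" for x \<phi>
    proof -
      let ?E = "Exists x \<phi>"
      have e: "extends (f (to_nat ?E)) ?E (f (Suc (to_nat ?E)))" using fs[of "to_nat ?E"] by simp
      have "\<not> EPA_proves (f (Suc (to_nat ?E)) \<^bold>\<longrightarrow> Neg ?E)" using that cons unfolding G_def by blast
      moreover have "?E \<in> EPA_lang" using GL[OF that] by simp
      ultimately have "EPA_proves (f (Suc (to_nat ?E)) \<^bold>\<longrightarrow> ?E)" using e unfolding extends_def by blast
      then show ?thesis using e unfolding extends_def G_def by blast
    qed
  qed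
  moreover have "\<theta> \<in> G" using mono[of 0 0] f0 unfolding G_def by auto
  ultimately show ?thesis by blast
qed

text \<open>Validity is required only over the carrier type of the term model, since a hypothesis in
  HOL cannot range over types; the interpretation above is available over every carrier.\<close>

theorem completeness:
  assumes "\<phi> \<in> EPA_lang"
    and valid: "\<And>(ok :: ty \<times> tm set \<Rightarrow> bool) tp ap I e. model ok tp ap I \<Longrightarrow> struc.env ok tp e \<Longrightarrow> struc.sat ok tp ap I e \<phi>"
  shows "EPA_proves \<phi>"
proof (rule ccontr)
  assume n: "\<not> EPA_proves \<phi>"
  have "\<not> EPA_proves (Neg (Neg \<phi>))"
    using EPA_taut1[of "Neg (Neg \<phi>)" \<phi>] n assms(1) by auto
  then have "consistent (Neg \<phi>)" using assms(1) unfolding consistent_def by simp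
  then obtain G where G: "henkin G" "Neg \<phi> \<in> G" using henkin_extension by blast
  interpret henkin G by (rule G(1))
  have "\<phi> \<notin> G" using G(2) G_neg assms(1) by blast
  then have "\<not> struc.sat okT fst apT el e\<^sub>T \<phi>" using truth[of \<phi>] assms(1) by simp
  then show False using valid[OF model_T env_T] by blast
qed

text \<open>Contains both claims: the list may be empty, and a block of internal existential
  quantifiers is part of the internal matrix.\<close>

lemma ForallSts_conservative:
  assumes "\<phi> \<in> EPA_lang" "EPA_st_I_HAC_PFTP_proves (ForallSts xs \<phi>)"
  shows "EPA_proves (Foralls xs \<phi>)"
proof (rule completeness)
  show "Foralls xs \<phi> \<in> EPA_lang" using assms(1) by simp
  fix ok :: "ty \<times> tm set \<Rightarrow> bool" and tp ap I e
  assume M: "model ok tp ap I" and e: "struc.env ok tp e"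
  interpret model ok tp ap I by (rule M)
  show "sat e (Foralls xs \<phi>)"
    by (rule ForallSts_sat) (use assms soundness e in auto)
qed

theorem corollary3p5:
  "(\<forall>\<phi> \<in> EPA_lang. EPA_st_I_HAC_PFTP_proves \<phi> \<longrightarrow> EPA_proves \<phi>) \<and>
   (\<forall>\<phi> \<in> EPA_lang. \<forall>xs ys :: var list. distinct (xs @ ys) \<longrightarrow>
      EPA_st_I_HAC_PFTP_proves (ForallSts xs (Existss ys \<phi>)) \<longrightarrow>
      EPA_proves (Foralls xs (Existss ys \<phi>)))"
proof (intro conjI ballI allI impI)
  fix \<phi> assume "\<phi> \<in> EPA_lang" "EPA_st_I_HAC_PFTP_proves \<phi>"
  then show "EPA_proves \<phi>" using ForallSts_conservative[of \<phi> "[]"] by simp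
next
  fix \<phi> xs ys assume "\<phi> \<in> EPA_lang" "EPA_st_I_HAC_PFTP_proves (ForallSts xs (Existss ys \<phi>))"
  then show "EPA_proves (Foralls xs (Existss ys \<phi>))" by (intro ForallSts_conservative) auto
qed

end
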